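(* Let $f:X\to Y$ be a locally Lipschitz map between $C^1$ Finsler manifolds, where $Y$ has smooth norm, and let $Jf$ be a strong pseudo-Jacobian mapping for $f$. Suppose that $f$ is $Jf$-regular at a point $x\in X$, with $C(Jf(x))>\alpha>0$. Then there is an open neighborhood $U$ of $x$ such that: 1. $f_x:=f|_U:U\to f(U)$ is a homeomorphism with $d_Y(f_x(u),f_x(u'))\ge\alpha\,d_X(u,u')$ for all $u,u'\in U$. 2. $f_x$ is open with linear rate around every point of $U$, and $C^*(Jf(u))=C(Jf(u))\ge\alpha$ for all $u\in U$. 3. $f_x^{-1}$ is Lipschitz continuous and $\operatorname{lip} f_x^{-1}(f(u))\le\alpha^{-1}$ for all $u\in U$.
   Context: **Manifolds and charts.** Manifolds are $C^1$ manifolds modeled on (possibly infinite-dimensional) real Banach spaces. A chart $(W,\varphi)$ at $x\in X$ is an open set $W\ni x$ with a chart map $\varphi$ from $W$ onto an open subset of the model space $E$; $d\varphi^{-1}(\varphi(x)):E\to T_xX$ is the induced linear isomorphism. $\mathcal L(E,F)$ denotes the bounded linear operators. **Finsler manifolds.** A Finsler structure on $X$ (modeled on $(E,|\cdot|_E)$) is a continuous map $\|\cdot\|:TX\to[0,\infty)$ such that: (1) for each $x$, its restriction $\|\cdot\|_x$ to $T_xX$ is a norm such that for every chart $(W,\varphi)$ at $x$, $\|d\varphi^{-1}(\varphi(x))(\cdot)\|_x$ is a norm on $E$ equivalent to $|\cdot|_E$; (2) for each $x_0\in X$, chart $(W,\varphi)$ at $x_0$ and $\varepsilon>0$ there is an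 open neighborhood $U\subset W$ of $x_0$ with $\frac1{1+\varepsilon}\|d\varphi^{-1}(\varphi(x_0))\mathbf v\|_{x_0}\le\|d\varphi^{-1}(\varphi(x))\mathbf v\|_x\le(1+\varepsilon)\|d\varphi^{-1}(\varphi(x_0))\mathbf v\|_{x_0}$ for all $x\in U$, $\mathbf v\in E$. A Finsler manifold is a $C^1$ Banach manifold with a Finsler structure; all Finsler manifolds are assumed connected. $d_X(u,u')$ is the infimum of the lengths $\int_a^b\|\dot\sigma(t)\|_{\sigma(t)}dt$ of $C^1$ paths $\sigma$ joining $u$ to $u'$; $B_X(x;r)$ is the open $d_X$-ball. $X$ has smooth norm if each $\|\cdot\|_x$ is Fréchet differentiable away from $0$. Locally Lipschitz means with respect to $d_X,d_Y$ (equivalently, in charts). **Pseudo-Jacobians.** For Banach spaces $E,F$, $U\subset E$ open and $\mathbf f:U\to F$ continuous, a nonempty set $J\mathbf f(\mathbf x)\subset\mathcal L(E,F)$ is a pseudo-Jacobian of $\mathbf f$ at $\mathbf x\in U$ if for all $y^*\in F^*$, $v\in E$: $\limsup_{t\to0^+}\frac{y^*(\mathbf f(\mathbf x+tv))-y^*(\mathbf f(\mathbf x))}{t}\le\sup\{\langle y^*,T(v)\rangle:T\in J\mathbf f(\mathbf x)\}$. A set-valued map $J\mathbf f:U\to2^{\mathcal L(E,F)}$ is a pseudo-Jacobian mapping if this holds at every point; it is locally bounded if each point has a ball $B\subset U$ around it with $\bigcup_{\mathbf z\in B}J\mathbf f(\mathbf z)$ norm bounded. Let $f:X\to Y$ be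 locally Lipschitz between $C^1$ manifolds modeled on $E,F$. An assignment $x\mapsto Jf(x)$, with $Jf(x)$ a set of linear operators $T_xX\to T_{f(x)}Y$, is a pseudo-Jacobian mapping for $f$ if for each $x\in X$ there are charts $(W,\varphi)$ at $x$ and $(V,\psi)$ at $f(x)$ with $f(W)\subset V$ and a locally bounded pseudo-Jacobian mapping $J\mathbf f:\varphi(W)\to2^{\mathcal L(E,F)}$ of $\mathbf f=\psi\circ f\circ\varphi^{-1}$ such that $Jf(u)=d\psi^{-1}(\psi(f(u)))\,J\mathbf f(\varphi(u))\,[d\varphi^{-1}(\varphi(u))]^{-1}$ for all $u\in W$. It is strong if in addition the charts can be chosen so that each $J\mathbf f(\mathbf u)$, $\mathbf u\in\varphi(W)$, is convex and compact in the weak operator topology. **Indices.** For $T\in\mathcal L(T_xX,T_{f(x)}Y)$ let $C_{\rm Finsler}(T)=\inf_{|y^*|_{f(x)}=1}|T^*y^*|_x$ (dual norms of the Finsler norms) and $C^*_{\rm Finsler}(T)=\inf_{\|u\|_x=1}\|Tu\|_{f(x)}$. Set $C(Jf(x)):=\sup_{R>0}\inf\{C_{\rm Finsler}(T):T\in\mathrm{co}\,Jf(B_X(x;R))\}$ and $C^*(Jf(x)):=\sup_{R>0}\inf\{C^*_{\rm Finsler}(T):T\in\mathrm{co}\,Jf(B_X(x;R))\}$, where co is the convex hull and $Jf(B_X(x;R))=\bigcup_{u\in B_X(x;R)}Jf(u)$ is regarded (for small $R$) as a subset of $\mathcal L(T_xX,T_{f(x)}Y)$ by means of a pair of charts $(W,\varphi)$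 at $x$ and $(V,\psi)$ at $f(x)$ with $f(W)\subset V$ for which there is a locally bounded pseudo-Jacobian mapping $J\mathbf f:\varphi(W)\to2^{\mathcal L(E,F)}$ of $\mathbf f=\psi\circ f\circ\varphi^{-1}$ such that $Jf(u)=d\psi^{-1}(\psi(f(u)))\,J\mathbf f(\varphi(u))\,[d\varphi^{-1}(\varphi(u))]^{-1}$ for all $u\in W$: the operator of $Jf(u)$ represented by $\mathbf T\in J\mathbf f(\varphi(u))$ is identified with $d\psi^{-1}(\psi(f(x)))\,\mathbf T\,[d\varphi^{-1}(\varphi(x))]^{-1}$. (The values do not depend on the charts.) **$Jf$-regularity.** $f$ is $Jf$-regular at $x$ if $C(Jf(x))>0$ and there is $R>0$ such that every $T\in\mathrm{co}\,Jf(B_X(x;R))$ is a linear isomorphism. **Openness and Lipschitz constants.** A map $h$ between metric spaces is open with linear rate around $x$ if there are a neighborhood $W_x$ and $a>0$ with $B(h(u);ar)\subset h(B(u;r))$ for all $u\in W_x$ and $r>0$ with $B(u;r)\subset W_x$. For a single-valued map $h$ between metric spaces, $\operatorname{lip} h(y)=\inf_{R>0}\sup\{d(h(z),h(z'))/d(z,z'):z\ne z'\in B(y;R)\}$ ($z,z'$ in the domain of $h$). *)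

theory Defs
  imports "HOL-Analysis.Analysis"
begin

section \<open>Banach manifolds of class C1\<close>

text \<open>
  The points of a manifold form a whole type of class t2_space. A chart is a pair of a domain
  and a map; the values of the map outside the domain are irrelevant, and the maximal atlas
  contains all the extensions of the same chart map.
\<close>

type_synonym ('x, 'e) chart = "'x set \<times> ('x \<Rightarrow> 'e)"

abbreviation chart_image :: "('x, 'e) chart \<Rightarrow> 'e set" where
  "chart_image c \<equiv> snd c ` fst c"

abbreviation chart_inv :: "('x, 'e) chart \<Rightarrow> 'e \<Rightarrow> 'x" where
  "chart_inv c \<equiv> inv_into (fst c) (snd c)"

definition is_chart :: "('x::topological_space, 'e::real_normed_vector) chart \<Rightarrow> bool" where
  "is_chart c \<longleftrightarrow>
     open (fst c) \<and> open (chart_image c) \<and>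
     homeomorphism (fst c) (chart_image c) (snd c) (chart_inv c)"

definition C1_on :: "'a::real_normed_vector set \<Rightarrow> ('a \<Rightarrow> 'b::real_normed_vector) \<Rightarrow> bool" where
  "C1_on S g \<longleftrightarrow>
     (\<exists>g' :: 'a \<Rightarrow> 'a \<Rightarrow>\<^sub>L 'b.
        (\<forall>p\<in>S. (g has_derivative blinfun_apply (g' p)) (at p)) \<and> continuous_on S g')"

definition chart_transition :: "('x, 'e) chart \<Rightarrow> ('x, 'e) chart \<Rightarrow> 'e \<Rightarrow> 'e" where
  "chart_transition c d = snd d \<circ> chart_inv c"

definition C1_compatible ::
    "('x, 'e::real_normed_vector) chart \<Rightarrow> ('x, 'e) chart \<Rightarrow> bool" where
  "C1_compatible c d \<longleftrightarrow>
     C1_on (snd c ` (fst c \<inter> fst d)) (chart_transition c d) \<and>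
     C1_on (snd d ` (fst c \<inter> fst d)) (chart_transition d c)"

definition C1_manifold :: "('x::t2_space, 'e::banach) chart set \<Rightarrow> bool" where
  "C1_manifold A \<longleftrightarrow>
     (\<forall>c\<in>A. is_chart c) \<and>
     (\<Union>c\<in>A. fst c) = UNIV \<and>
     (\<forall>c\<in>A. \<forall>d\<in>A. C1_compatible c d) \<and>
     (\<forall>c. is_chart c \<and> (\<forall>d\<in>A. C1_compatible c d) \<longrightarrow> c \<in> A)"

definition charts_at :: "('x, 'e) chart set \<Rightarrow> 'x \<Rightarrow> ('x, 'e) chart set" where
  "charts_at A x = {c \<in> A. x \<in> fst c}"


section \<open>Tangent spaces\<close>

text \<open>
  A tangent vector at x is an equivalence class of pairs (chart at x, vector of the model
  space), two pairs being equivalent if the derivative of the transition map takes one vector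
  to the other. A class contains exactly one pair for each chart at x. The class of (c, e) is
  the image of e under the differential of the inverse of the chart map.
\<close>

type_synonym ('x, 'e) tangent = "(('x, 'e) chart \<times> 'e) set"

definition tangent_vec ::
    "('x, 'e::real_normed_vector) chart set \<Rightarrow> 'x \<Rightarrow> ('x, 'e) chart \<Rightarrow> 'e \<Rightarrow> ('x, 'e) tangent" where
  "tangent_vec A x c e =
     {(d, frechet_derivative (chart_transition c d) (at (snd c x)) e) | d. d \<in> charts_at A x}"

definition tangent_space ::
    "('x, 'e::real_normed_vector) chart set \<Rightarrow> 'x \<Rightarrow> ('x, 'e) tangent set" where
  "tangent_space A x = {tangent_vec A x c e | c e. c \<in> charts_at A x}"

text \<open>The differential of a chart map, i.e. the inverse of \<open>tangent_vec A x c\<close>.\<close>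

definition tangent_coord :: "('x, 'e) chart \<Rightarrow> ('x, 'e) tangent \<Rightarrow> 'e" where
  "tangent_coord c v = (THE e. (c, e) \<in> v)"

definition tangent_zero ::
    "('x, 'e::real_normed_vector) chart set \<Rightarrow> 'x \<Rightarrow> ('x, 'e) tangent" where
  "tangent_zero A x = {(c, 0) | c. c \<in> charts_at A x}"

definition tangent_add ::
    "('x, 'e::real_normed_vector) tangent \<Rightarrow> ('x, 'e) tangent \<Rightarrow> ('x, 'e) tangent" where
  "tangent_add v w = {(c, a + b) | c a b. (c, a) \<in> v \<and> (c, b) \<in> w}"

definition tangent_scale ::
    "real \<Rightarrow> ('x, 'e::real_normed_vector) tangent \<Rightarrow> ('x, 'e) tangent" where
  "tangent_scale r v = {(c, r *\<^sub>R a) | c a. (c, a) \<in> v}"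

text \<open>
  The topology of the tangent bundle for which the trivialisations over the chart domains are
  homeomorphisms.
\<close>

definition tangent_bundle ::
    "('x, 'e::real_normed_vector) chart set \<Rightarrow> ('x \<times> ('x, 'e) tangent) set" where
  "tangent_bundle A = Sigma UNIV (tangent_space A)"

definition tangent_bundle_open ::
    "('x, 'e::real_normed_vector) chart set \<Rightarrow> ('x \<times> ('x, 'e) tangent) set \<Rightarrow> bool" where
  "tangent_bundle_open A S \<longleftrightarrow>
     S \<subseteq> tangent_bundle A \<and>
     (\<forall>c\<in>A. open {(p, e). p \<in> chart_image c \<and>
                          (chart_inv c p, tangent_vec A (chart_inv c p) c e) \<in> S})"

definition tangent_bundle_topology ::
    "('x, 'e::real_normed_vector) chart set \<Rightarrow> ('x \<times> ('x, 'e) tangent) topology" where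
  "tangent_bundle_topology A = topology (tangent_bundle_open A)"

lemma istopology_tangent_bundle_open: "istopology (tangent_bundle_open A)"
  unfolding istopology_def
proof (intro conjI allI impI)
  fix S T
  assume S: "tangent_bundle_open A S" and T: "tangent_bundle_open A T"
  have "open {(p, e). p \<in> chart_image c \<and>
                      (chart_inv c p, tangent_vec A (chart_inv c p) c e) \<in> S \<inter> T}"
    if "c \<in> A" for c
  proof -
    have "{(p, e). p \<in> chart_image c \<and>
                   (chart_inv c p, tangent_vec A (chart_inv c p) c e) \<in> S \<inter> T} =
          {(p, e). p \<in> chart_image c \<and>
                   (chart_inv c p, tangent_vec A (chart_inv c p) c e) \<in> S} \<inter>
          {(p, e). p \<in> chart_image c \<and>
                   (chart_inv c p, tangent_vec A (chart_inv c p) c e) \<in> T}"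
      by auto
    then show ?thesis
      using S T that unfolding tangent_bundle_open_def by (simp add: open_Int)
  qed
  then show "tangent_bundle_open A (S \<inter> T)"
    using S T unfolding tangent_bundle_open_def by blast
next
  fix K
  assume K: "\<forall>S\<in>K. tangent_bundle_open A S"
  have "open {(p, e). p \<in> chart_image c \<and>
                      (chart_inv c p, tangent_vec A (chart_inv c p) c e) \<in> \<Union>K}"
    if "c \<in> A" for c
  proof -
    have "{(p, e). p \<in> chart_image c \<and>
                   (chart_inv c p, tangent_vec A (chart_inv c p) c e) \<in> \<Union>K} =
          (\<Union>S\<in>K. {(p, e). p \<in> chart_image c \<and>
                   (chart_inv c p, tangent_vec A (chart_inv c p) c e) \<in> S})"
      by auto
    moreover have "open \<dots>"
      using K that unfolding tangent_bundle_open_def by (intro open_UN) blast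
    ultimately show ?thesis by simp
  qed
  then show "tangent_bundle_open A (\<Union>K)"
    using K unfolding tangent_bundle_open_def by blast
qed

lemma openin_tangent_bundle_topology:
  "openin (tangent_bundle_topology A) = tangent_bundle_open A"
  unfolding tangent_bundle_topology_def
  by (rule topology_inverse'[OF istopology_tangent_bundle_open])


section \<open>Finsler manifolds\<close>

record ('x, 'e) finsler =
  charts :: "('x, 'e) chart set"
  fnorm :: "'x \<Rightarrow> ('x, 'e) tangent \<Rightarrow> real"

definition tangent_norm ::
    "('x, 'e::real_normed_vector) chart set \<Rightarrow> 'x \<Rightarrow> (('x, 'e) tangent \<Rightarrow> real) \<Rightarrow> bool" where
  "tangent_norm A x n \<longleftrightarrow>
     (\<forall>v\<in>tangent_space A x. 0 \<le> n v \<and> (n v = 0 \<longleftrightarrow> v = tangent_zero A x)) \<and>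
     (\<forall>v\<in>tangent_space A x. \<forall>w\<in>tangent_space A x. n (tangent_add v w) \<le> n v + n w) \<and>
     (\<forall>v\<in>tangent_space A x. \<forall>r. n (tangent_scale r v) = \<bar>r\<bar> * n v)"

definition equivalent_norm :: "('e::real_normed_vector \<Rightarrow> real) \<Rightarrow> bool" where
  "equivalent_norm n \<longleftrightarrow>
     (\<forall>v w. n (v + w) \<le> n v + n w) \<and> (\<forall>r v. n (r *\<^sub>R v) = \<bar>r\<bar> * n v) \<and>
     (\<exists>a>0. \<exists>b>0. \<forall>v. a * norm v \<le> n v \<and> n v \<le> b * norm v)"

definition finsler_structure :: "('x::t2_space, 'e::banach) finsler \<Rightarrow> bool" where
  "finsler_structure X \<longleftrightarrow>
     continuous_map (tangent_bundle_topology (charts X)) euclideanreal (\<lambda>(x, v). fnorm X x v) \<and>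
     (\<forall>x. tangent_norm (charts X) x (fnorm X x) \<and>
          (\<forall>c\<in>charts_at (charts X) x.
             equivalent_norm (\<lambda>e. fnorm X x (tangent_vec (charts X) x c e)))) \<and>
     (\<forall>x0. \<forall>c\<in>charts_at (charts X) x0. \<forall>\<epsilon>>0.
        \<exists>U. open U \<and> x0 \<in> U \<and> U \<subseteq> fst c \<and>
          (\<forall>x\<in>U. \<forall>e.
             1 / (1 + \<epsilon>) * fnorm X x0 (tangent_vec (charts X) x0 c e)
               \<le> fnorm X x (tangent_vec (charts X) x c e) \<and>
             fnorm X x (tangent_vec (charts X) x c e)
               \<le> (1 + \<epsilon>) * fnorm X x0 (tangent_vec (charts X) x0 c e)))"

definition finsler_manifold :: "('x::t2_space, 'e::banach) finsler \<Rightarrow> bool" where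
  "finsler_manifold X \<longleftrightarrow>
     C1_manifold (charts X) \<and> finsler_structure X \<and> connected (UNIV :: 'x set)"

text \<open>
  For a path on \<open>{a..b}\<close> the derivatives at the end points are one-sided. The velocity at t
  has, for every chart at \<open>\<sigma> t\<close>, the derivative of the path read in this chart as its
  coordinate vector.
\<close>

definition C1_path ::
    "('x::topological_space, 'e::real_normed_vector) chart set \<Rightarrow>
     real \<Rightarrow> real \<Rightarrow> (real \<Rightarrow> 'x) \<Rightarrow> bool" where
  "C1_path A a b \<sigma> \<longleftrightarrow>
     continuous_on {a..b} \<sigma> \<and>
     (\<forall>c\<in>A. \<exists>D. continuous_on {t \<in> {a..b}. \<sigma> t \<in> fst c} D \<and>
        (\<forall>t\<in>{a..b}. \<sigma> t \<in> fst c \<longrightarrow>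
           ((snd c \<circ> \<sigma>) has_vector_derivative D t) (at t within {a..b})))"

definition path_velocity ::
    "('x, 'e::real_normed_vector) chart set \<Rightarrow>
     real \<Rightarrow> real \<Rightarrow> (real \<Rightarrow> 'x) \<Rightarrow> real \<Rightarrow> ('x, 'e) tangent" where
  "path_velocity A a b \<sigma> t =
     {(c, vector_derivative (snd c \<circ> \<sigma>) (at t within {a..b})) | c. c \<in> charts_at A (\<sigma> t)}"

definition path_len ::
    "('x, 'e::real_normed_vector) finsler \<Rightarrow> real \<Rightarrow> real \<Rightarrow> (real \<Rightarrow> 'x) \<Rightarrow> real" where
  "path_len X a b \<sigma> =
     integral {a..b} (\<lambda>t. fnorm X (\<sigma> t) (path_velocity (charts X) a b \<sigma> t))"

definition fdist ::
    "('x::topological_space, 'e::real_normed_vector) finsler \<Rightarrow> 'x \<Rightarrow> 'x \<Rightarrow> real" where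
  "fdist X u u' =
     Inf {path_len X a b \<sigma> | a b \<sigma>.
            a < b \<and> C1_path (charts X) a b \<sigma> \<and> \<sigma> a = u \<and> \<sigma> b = u'}"

definition fball ::
    "('x::topological_space, 'e::real_normed_vector) finsler \<Rightarrow> 'x \<Rightarrow> real \<Rightarrow> 'x set" where
  "fball X x r = {u. fdist X x u < r}"

text \<open>
  Differentiability of the norm of a tangent space is read through the charts, which are
  isomorphisms of normed spaces between the model space and the tangent space.
\<close>

definition smooth_norm :: "('x, 'e::real_normed_vector) finsler \<Rightarrow> bool" where
  "smooth_norm X \<longleftrightarrow>
     (\<forall>x. \<forall>c\<in>charts_at (charts X) x. \<forall>e. e \<noteq> 0 \<longrightarrow>
        (\<lambda>e. fnorm X x (tangent_vec (charts X) x c e)) differentiable (at e))"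

definition lipschitz_map ::
    "('a \<Rightarrow> 'a \<Rightarrow> real) \<Rightarrow> ('b \<Rightarrow> 'b \<Rightarrow> real) \<Rightarrow> 'a set \<Rightarrow> ('a \<Rightarrow> 'b) \<Rightarrow> bool" where
  "lipschitz_map d d' S h \<longleftrightarrow> (\<exists>L\<ge>0. \<forall>z\<in>S. \<forall>z'\<in>S. d' (h z) (h z') \<le> L * d z z')"

definition locally_lipschitz_map ::
    "('x::topological_space, 'e::real_normed_vector) finsler \<Rightarrow>
     ('y::topological_space, 'f::real_normed_vector) finsler \<Rightarrow> ('x \<Rightarrow> 'y) \<Rightarrow> bool" where
  "locally_lipschitz_map X Y f \<longleftrightarrow>
     (\<forall>x. \<exists>U. open U \<and> x \<in> U \<and> lipschitz_map (fdist X) (fdist Y) U f)"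


section \<open>Pseudo-Jacobians\<close>

definition pseudo_jacobian_at ::
    "('e::real_normed_vector \<Rightarrow> 'f::real_normed_vector) \<Rightarrow> 'e \<Rightarrow> ('e \<Rightarrow>\<^sub>L 'f) set \<Rightarrow> bool" where
  "pseudo_jacobian_at f x J \<longleftrightarrow>
     J \<noteq> {} \<and>
     (\<forall>(y :: 'f \<Rightarrow>\<^sub>L real) v.
        Limsup (at_right 0) (\<lambda>t. ereal ((y (f (x + t *\<^sub>R v)) - y (f x)) / t))
          \<le> (SUP T\<in>J. ereal (y (blinfun_apply T v))))"

definition pseudo_jacobian_mapping_on ::
    "'e set \<Rightarrow> ('e::real_normed_vector \<Rightarrow> 'f::real_normed_vector) \<Rightarrow>
     ('e \<Rightarrow> ('e \<Rightarrow>\<^sub>L 'f) set) \<Rightarrow> bool" where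
  "pseudo_jacobian_mapping_on U f J \<longleftrightarrow> (\<forall>p\<in>U. pseudo_jacobian_at f p (J p))"

definition locally_bounded_on ::
    "'e::real_normed_vector set \<Rightarrow> ('e \<Rightarrow> ('e \<Rightarrow>\<^sub>L 'f::real_normed_vector) set) \<Rightarrow> bool" where
  "locally_bounded_on U J \<longleftrightarrow>
     (\<forall>p\<in>U. \<exists>r>0. ball p r \<subseteq> U \<and> bounded (\<Union>z\<in>ball p r. J z))"

definition weak_operator_topology ::
    "('e::real_normed_vector \<Rightarrow>\<^sub>L 'f::real_normed_vector) topology" where
  "weak_operator_topology =
     pullback_topology UNIV (\<lambda>T (v, y :: 'f \<Rightarrow>\<^sub>L real). y (blinfun_apply T v)) euclidean"

text \<open>
  Operators between tangent spaces are functions that are \<open>undefined\<close> outside the tangent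
  space at x. The next definition turns an operator between the model spaces into an operator
  from the tangent space at x to the one at y by means of charts c at x and k at y.
\<close>

definition chart_operator ::
    "('x, 'e::real_normed_vector) chart set \<Rightarrow> ('y, 'f::real_normed_vector) chart set \<Rightarrow>
     ('x, 'e) chart \<Rightarrow> ('y, 'f) chart \<Rightarrow> 'x \<Rightarrow> 'y \<Rightarrow> ('e \<Rightarrow>\<^sub>L 'f) \<Rightarrow>
     ('x, 'e) tangent \<Rightarrow> ('y, 'f) tangent" where
  "chart_operator A B c k x y T =
     (\<lambda>v\<in>tangent_space A x. tangent_vec B y k (T (tangent_coord c v)))"

definition jacobian_rep ::
    "('x, 'e::real_normed_vector) finsler \<Rightarrow> ('y, 'f::real_normed_vector) finsler \<Rightarrow> ('x \<Rightarrow> 'y) \<Rightarrow>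
     ('x \<Rightarrow> (('x, 'e) tangent \<Rightarrow> ('y, 'f) tangent) set) \<Rightarrow> 'x \<Rightarrow>
     ('x, 'e) chart \<Rightarrow> ('y, 'f) chart \<Rightarrow> ('e \<Rightarrow> ('e \<Rightarrow>\<^sub>L 'f) set) \<Rightarrow> bool" where
  "jacobian_rep X Y f Jf x c k J \<longleftrightarrow>
     c \<in> charts_at (charts X) x \<and> k \<in> charts_at (charts Y) (f x) \<and> f ` fst c \<subseteq> fst k \<and>
     pseudo_jacobian_mapping_on (chart_image c) (snd k \<circ> f \<circ> chart_inv c) J \<and>
     locally_bounded_on (chart_image c) J \<and>
     (\<forall>u\<in>fst c. Jf u = chart_operator (charts X) (charts Y) c k u (f u) ` J (snd c u))"

definition strong_pseudo_jacobian_mapping ::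
    "('x, 'e::real_normed_vector) finsler \<Rightarrow> ('y, 'f::real_normed_vector) finsler \<Rightarrow> ('x \<Rightarrow> 'y) \<Rightarrow>
     ('x \<Rightarrow> (('x, 'e) tangent \<Rightarrow> ('y, 'f) tangent) set) \<Rightarrow> bool" where
  "strong_pseudo_jacobian_mapping X Y f Jf \<longleftrightarrow>
     (\<forall>x. \<exists>c k J. jacobian_rep X Y f Jf x c k J \<and>
        (\<forall>p\<in>chart_image c. convex (J p) \<and> compactin weak_operator_topology (J p)))"


section \<open>Indices and regularity\<close>

definition tangent_dual ::
    "('x, 'e::real_normed_vector) finsler \<Rightarrow> 'x \<Rightarrow> (('x, 'e) tangent \<Rightarrow> real) set" where
  "tangent_dual X x =
     {l. (\<forall>v\<in>tangent_space (charts X) x. \<forall>w\<in>tangent_space (charts X) x.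
            l (tangent_add v w) = l v + l w) \<and>
         (\<forall>v\<in>tangent_space (charts X) x. \<forall>r. l (tangent_scale r v) = r * l v) \<and>
         (\<exists>K. \<forall>v\<in>tangent_space (charts X) x. \<bar>l v\<bar> \<le> K * fnorm X x v)}"

definition dual_norm ::
    "('x, 'e::real_normed_vector) finsler \<Rightarrow> 'x \<Rightarrow> (('x, 'e) tangent \<Rightarrow> real) \<Rightarrow> real" where
  "dual_norm X x l = (SUP v\<in>{v \<in> tangent_space (charts X) x. fnorm X x v \<le> 1}. \<bar>l v\<bar>)"

text \<open>
  The indices take values in \<open>[0, \<infinity>]\<close>, so that an infimum over the empty unit sphere of a
  zero space is \<open>\<infinity>\<close>.
\<close>

definition finsler_C ::
    "('x, 'e::real_normed_vector) finsler \<Rightarrow> ('y, 'f::real_normed_vector) finsler \<Rightarrow>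
     'x \<Rightarrow> 'y \<Rightarrow> (('x, 'e) tangent \<Rightarrow> ('y, 'f) tangent) \<Rightarrow> ennreal" where
  "finsler_C X Y x y T =
     (INF l\<in>{l \<in> tangent_dual Y y. dual_norm Y y l = 1}. ennreal (dual_norm X x (l \<circ> T)))"

definition finsler_C_star ::
    "('x, 'e::real_normed_vector) finsler \<Rightarrow> ('y, 'f::real_normed_vector) finsler \<Rightarrow>
     'x \<Rightarrow> 'y \<Rightarrow> (('x, 'e) tangent \<Rightarrow> ('y, 'f) tangent) \<Rightarrow> ennreal" where
  "finsler_C_star X Y x y T =
     (INF v\<in>{v \<in> tangent_space (charts X) x. fnorm X x v = 1}. ennreal (fnorm Y y (T v)))"

text \<open>
  The indices and regularity do not depend on the charts that identify the operators over a
  small ball with operators on the tangent space at its centre; the charts (with the local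
  pseudo-Jacobian mapping) are therefore fixed by choice. The radii are those of the balls
  contained in the chart domain. The convex hull is taken in the space of operators between
  the model spaces, with which the identification is linear.
\<close>

definition chosen_rep ::
    "('x, 'e::real_normed_vector) finsler \<Rightarrow> ('y, 'f::real_normed_vector) finsler \<Rightarrow> ('x \<Rightarrow> 'y) \<Rightarrow>
     ('x \<Rightarrow> (('x, 'e) tangent \<Rightarrow> ('y, 'f) tangent) set) \<Rightarrow> 'x \<Rightarrow>
     ('x, 'e) chart \<times> ('y, 'f) chart \<times> ('e \<Rightarrow> ('e \<Rightarrow>\<^sub>L 'f) set)" where
  "chosen_rep X Y f Jf x = (SOME (c, k, J). jacobian_rep X Y f Jf x c k J)"

definition small_radii ::
    "('x::topological_space, 'e::real_normed_vector) finsler \<Rightarrow>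
     ('y, 'f::real_normed_vector) finsler \<Rightarrow> ('x \<Rightarrow> 'y) \<Rightarrow>
     ('x \<Rightarrow> (('x, 'e) tangent \<Rightarrow> ('y, 'f) tangent) set) \<Rightarrow> 'x \<Rightarrow> real set" where
  "small_radii X Y f Jf x =
     (case chosen_rep X Y f Jf x of (c, k, J) \<Rightarrow> {R. 0 < R \<and> fball X x R \<subseteq> fst c})"

definition co_jacobian ::
    "('x::topological_space, 'e::real_normed_vector) finsler \<Rightarrow>
     ('y, 'f::real_normed_vector) finsler \<Rightarrow> ('x \<Rightarrow> 'y) \<Rightarrow>
     ('x \<Rightarrow> (('x, 'e) tangent \<Rightarrow> ('y, 'f) tangent) set) \<Rightarrow> 'x \<Rightarrow> real \<Rightarrow>
     (('x, 'e) tangent \<Rightarrow> ('y, 'f) tangent) set" where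
  "co_jacobian X Y f Jf x R =
     (case chosen_rep X Y f Jf x of (c, k, J) \<Rightarrow>
        chart_operator (charts X) (charts Y) c k x (f x) `
          (convex hull (\<Union>u\<in>fball X x R. J (snd c u))))"

definition index_C ::
    "('x::topological_space, 'e::real_normed_vector) finsler \<Rightarrow>
     ('y, 'f::real_normed_vector) finsler \<Rightarrow> ('x \<Rightarrow> 'y) \<Rightarrow>
     ('x \<Rightarrow> (('x, 'e) tangent \<Rightarrow> ('y, 'f) tangent) set) \<Rightarrow> 'x \<Rightarrow> ennreal" where
  "index_C X Y f Jf x =
     (SUP R\<in>small_radii X Y f Jf x. INF T\<in>co_jacobian X Y f Jf x R. finsler_C X Y x (f x) T)"

definition index_C_star ::
    "('x::topological_space, 'e::real_normed_vector) finsler \<Rightarrow>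
     ('y, 'f::real_normed_vector) finsler \<Rightarrow> ('x \<Rightarrow> 'y) \<Rightarrow>
     ('x \<Rightarrow> (('x, 'e) tangent \<Rightarrow> ('y, 'f) tangent) set) \<Rightarrow> 'x \<Rightarrow> ennreal" where
  "index_C_star X Y f Jf x =
     (SUP R\<in>small_radii X Y f Jf x. INF T\<in>co_jacobian X Y f Jf x R. finsler_C_star X Y x (f x) T)"

definition tangent_isomorphism ::
    "('x, 'e::real_normed_vector) chart set \<Rightarrow> ('y, 'f::real_normed_vector) chart set \<Rightarrow>
     'x \<Rightarrow> 'y \<Rightarrow> (('x, 'e) tangent \<Rightarrow> ('y, 'f) tangent) \<Rightarrow> bool" where
  "tangent_isomorphism A B x y T \<longleftrightarrow>
     (\<forall>v\<in>tangent_space A x. \<forall>w\<in>tangent_space A x.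
        T (tangent_add v w) = tangent_add (T v) (T w)) \<and>
     (\<forall>v\<in>tangent_space A x. \<forall>r. T (tangent_scale r v) = tangent_scale r (T v)) \<and>
     bij_betw T (tangent_space A x) (tangent_space B y)"

definition J_regular ::
    "('x::topological_space, 'e::real_normed_vector) finsler \<Rightarrow>
     ('y, 'f::real_normed_vector) finsler \<Rightarrow> ('x \<Rightarrow> 'y) \<Rightarrow>
     ('x \<Rightarrow> (('x, 'e) tangent \<Rightarrow> ('y, 'f) tangent) set) \<Rightarrow> 'x \<Rightarrow> bool" where
  "J_regular X Y f Jf x \<longleftrightarrow>
     index_C X Y f Jf x > 0 \<and>
     (\<exists>R\<in>small_radii X Y f Jf x. \<forall>T\<in>co_jacobian X Y f Jf x R.
        tangent_isomorphism (charts X) (charts Y) x (f x) T)"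


section \<open>Openness with linear rate and Lipschitz constants\<close>

text \<open>
  The domain is the metric space U with the metric d, so its balls are relative to U; the
  balls in the target are those of the metric space V with the metric d'.
\<close>

definition open_linear_rate_around ::
    "'x::topological_space set \<Rightarrow> ('x \<Rightarrow> 'x \<Rightarrow> real) \<Rightarrow> 'y set \<Rightarrow> ('y \<Rightarrow> 'y \<Rightarrow> real) \<Rightarrow>
     ('x \<Rightarrow> 'y) \<Rightarrow> 'x \<Rightarrow> bool" where
  "open_linear_rate_around U d V d' h x \<longleftrightarrow>
     (\<exists>W a. openin (top_of_set U) W \<and> x \<in> W \<and> 0 < a \<and>
        (\<forall>u\<in>W. \<forall>r>0. {z\<in>U. d u z < r} \<subseteq> W \<longrightarrow>
           {y\<in>V. d' (h u) y < a * r} \<subseteq> h ` {z\<in>U. d u z < r}))"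

definition lip_at ::
    "('a \<Rightarrow> 'a \<Rightarrow> real) \<Rightarrow> ('b \<Rightarrow> 'b \<Rightarrow> real) \<Rightarrow> 'a set \<Rightarrow> ('a \<Rightarrow> 'b) \<Rightarrow> 'a \<Rightarrow> ennreal" where
  "lip_at d d' S h y =
     (INF R\<in>{0<..}. SUP (z, z')\<in>{(z, z'). z \<in> S \<and> z' \<in> S \<and> d y z < R \<and> d y z' < R \<and> z \<noteq> z'}.
        ennreal (d' (h z) (h z') / d z z'))"

end

theory Submission
  imports Defs
begin

text \<open>
  In charts at x and f x, every operator T in the convex hull of the local pseudo-Jacobian over a
  small ball is an isomorphism with \<open>C0 * norm e \<le> norm (T e)\<close> for some \<open>C0 > \<alpha>\<close> and the Finsler norms
  at x and f x. A convex set of vectors of norm at least b is separated from the ball of radius b by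
  a functional, so the scalar mean value theorem along segments shows that f expands distances by
  the factor C0 there. Openness follows by continuation: for an isomorphism A in the hull, all the
  maps \<open>(1 - t) A + t f\<close> are expanding with the same constant, and each of them is a small Lipschitz
  perturbation of a previous one, to which the contraction principle applies. The Finsler distances
  are compared with the norms of the charts up to a factor close to 1, and the identification of
  the operators at nearby points changes the indices only by such a factor, which the gap between
  \<open>\<alpha>\<close> and C0 absorbs.
\<close>


section \<open>Dominated linear functionals\<close>

text \<open>The index C is defined through adjoints, whereas expansion of f needs a lower bound for
  \<open>T e\<close> itself. For isomorphisms the two bounds agree, but the passage from the dual
  one to the primal one needs an argument of its own: separation gives approximate solutions of
  \<open>S v = y\<close> of the right size, a geometric series makes them exact, and injectivity
  identifies the solution. Expansion alone gives injectivity but not openness, since invariance of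
  domain fails in infinite dimensions. The continuation from A to f works because the functional
  found for a pair of points serves every operator of the hull and f at once, so every convex
  combination of A and f obeys the same estimate. A perturbation step by itself loses part of the
  openness rate, but expansion restores it, so finitely many equal steps suffice. The Finsler
  distance is an infimum over paths that may leave every chart. A lower bound for it in coordinates
  therefore rests on the confinement of short paths to the chart.\<close>

definition sublinear :: "('a::real_vector \<Rightarrow> real) \<Rightarrow> bool" where
  "sublinear p \<longleftrightarrow> (\<forall>v w. p (v + w) \<le> p v + p w) \<and> (\<forall>r\<ge>0. \<forall>v. p (r *\<^sub>R v) = r * p v)"

lemma sublinear_zero: "sublinear p \<Longrightarrow> p 0 = 0"
  unfolding sublinear_def by (metis mult_zero_left order_refl scale_zero_left)

lemma sublinear_neg: "sublinear p \<Longrightarrow> - p (- v) \<le> p v"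
  using sublinear_zero[of p] unfolding sublinear_def
  by (metis add.right_inverse add_le_cancel_left diff_0 diff_le_eq add.commute)

text \<open>The functional \<open>q v\<close> is the infimum of
  \<open>p (v + t *\<^sub>R k) - t * \<beta>\<close> over \<open>t \<ge> 0\<close> and
  \<open>k \<in> K\<close>. It is finite because \<open>t * \<beta> \<le> p (t *\<^sub>R k) \<le> p
  (- v) + p (v + t *\<^sub>R k)\<close>, and \<open>t = 1\<close> at \<open>v = - k\<close> gives
  the last claim. The lower bound on K thereby becomes an upper bound for q, which every linear
  functional below q inherits with the sign reversed.\<close>

lemma sublinear_minorant:
  fixes p :: "'a::real_vector \<Rightarrow> real"
  assumes p: "sublinear p" and K: "convex K" "K \<noteq> {}" and \<beta>: "\<And>k. k \<in> K \<Longrightarrow> \<beta> \<le> p k"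
  shows "\<exists>q. sublinear q \<and> (\<forall>v. q v \<le> p v) \<and> (\<forall>k\<in>K. q (- k) \<le> - \<beta>)"
proof -
  define I where "I v = {p (v + t *\<^sub>R k) - t * \<beta> |t k. 0 \<le> t \<and> k \<in> K}" for v
  define q where "q v = Inf (I v)" for v
  have add: "p (v + w) \<le> p v + p w" and scale: "0 \<le> r \<Longrightarrow> p (r *\<^sub>R v) = r * p v" for v w r
    using p by (auto simp: sublinear_def)
  obtain k0 where k0: "k0 \<in> K" using K by auto
  have lower: "- p (- v) \<le> p (v + t *\<^sub>R k) - t * \<beta>" if "0 \<le> t" "k \<in> K" for v t k
  proof -
    have "t * \<beta> \<le> p (t *\<^sub>R k)" using \<beta>[OF that(2)] that scale by (simp add: mult_left_mono)
    also have "\<dots> \<le> p (- v) + p (v + t *\<^sub>R k)" using add[of "- v" "v + t *\<^sub>R k"] by simp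
    finally show ?thesis by simp
  qed
  have bdd: "bdd_below (I v)" for v
    unfolding I_def bdd_below_def using lower by fastforce
  have mem: "p (v + t *\<^sub>R k) - t * \<beta> \<in> I v" if "0 \<le> t" "k \<in> K" for v t k
    using that I_def by blast
  have ne: "I v \<noteq> {}" for v using mem[of 0 k0 v] k0 by auto
  have le: "q v \<le> p (v + t *\<^sub>R k) - t * \<beta>" if "0 \<le> t" "k \<in> K" for v t k
    unfolding q_def using mem[OF that] bdd by (rule cInf_lower)
  have ge: "z \<le> q v" if "\<And>t k. 0 \<le> t \<Longrightarrow> k \<in> K \<Longrightarrow> z \<le> p (v + t *\<^sub>R k) - t * \<beta>" for z v
    unfolding q_def by (rule cInf_greatest[OF ne]) (use that in \<open>auto simp: I_def\<close>)
  have qle: "q v \<le> p v" for v using le[of 0 k0 v] k0 by simp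
  have qadd: "q (v + w) \<le> q v + q w" for v w
  proof -
    have "q (v + w) \<le> (p (v + s *\<^sub>R k) - s * \<beta>) + (p (w + t *\<^sub>R k') - t * \<beta>)"
      if st: "0 \<le> s" "0 \<le> t" and k: "k \<in> K" "k' \<in> K" for s t k k'
    proof (cases "s + t = 0")
      case True
      then have "s = 0" "t = 0" using st by auto
      then show ?thesis using qle[of "v + w"] add[of v w] by simp
    next
      case False
      then have pos: "s + t > 0" using st by simp
      \<comment> \<open>Convexity of K replaces the two displacements by one:
        \<open>s *\<^sub>R k + t *\<^sub>R k'\<close> is \<open>s + t\<close> times a point of
        K.\<close>
      define k'' where "k'' = (s / (s + t)) *\<^sub>R k + (t / (s + t)) *\<^sub>R k'"
      have k'': "k'' \<in> K" unfolding k''_def using K(1) k st pos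
        by (intro convexD) (auto simp: add_divide_distrib[symmetric])
      have eq: "(s + t) *\<^sub>R k'' = s *\<^sub>R k + t *\<^sub>R k'"
        using pos by (simp add: k''_def scaleR_add_right)
      have "q (v + w) \<le> p ((v + w) + (s + t) *\<^sub>R k'') - (s + t) * \<beta>"
        using le st k'' by simp
      also have "p ((v + w) + (s + t) *\<^sub>R k'') \<le> p (v + s *\<^sub>R k) + p (w + t *\<^sub>R k')"
        using add[of "v + s *\<^sub>R k" "w + t *\<^sub>R k'"] unfolding eq by (simp add: add_ac)
      finally show ?thesis by (simp add: algebra_simps)
    qed
    then have "q (v + w) - (p (w + t *\<^sub>R k') - t * \<beta>) \<le> q v" if "0 \<le> t" "k' \<in> K" for t k'
      using that by (intro ge) (smt (verit))
    then have "q (v + w) - q v \<le> q w" by (intro ge) (smt (verit))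
    then show ?thesis by simp
  qed
  have qscale: "q (r *\<^sub>R v) = r * q v" if "0 \<le> r" for r v
  proof (cases "r = 0")
    case True
    have "q 0 = 0" using qle[of 0] ge[of 0 0] lower[of _ _ 0] sublinear_zero[OF p]
      by (metis add_0 add.inverse_neutral antisym)
    then show ?thesis using True by simp
  next
    case False
    then have r: "r > 0" using that by simp
    \<comment> \<open>One inequality for every positive factor suffices: the factor
      \<open>1 / r\<close> at the vector \<open>r *\<^sub>R v\<close> gives the other.\<close>
    have half: "q (r *\<^sub>R v) \<le> r * q v" if r: "r > 0" for r v
    proof -
      have "q (r *\<^sub>R v) / r \<le> q v"
      proof (rule ge)
        fix t k assume "0 \<le> (t::real)" "k \<in> K"
        then have "q (r *\<^sub>R v) \<le> p (r *\<^sub>R v + (r * t) *\<^sub>R k) - (r * t) * \<beta>" using r by (intro le) auto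
        also have "\<dots> = r * (p (v + t *\<^sub>R k) - t * \<beta>)"
          using scale[of r "v + t *\<^sub>R k"] r by (simp add: algebra_simps)
        finally show "q (r *\<^sub>R v) / r \<le> p (v + t *\<^sub>R k) - t * \<beta>" using r by (simp add: field_simps)
      qed
      then show ?thesis using r by (simp add: field_simps)
    qed
    have "q v \<le> (1 / r) * q (r *\<^sub>R v)" using half[of "1/r" "r *\<^sub>R v"] r by simp
    then show ?thesis using half[OF r, of v] r by (simp add: field_simps)
  qed
  have "q (- k) \<le> - \<beta>" if "k \<in> K" for k
    using le[of 1 k "- k"] that sublinear_zero[OF p] by simp
  then show ?thesis using qadd qscale qle unfolding sublinear_def by blast
qed

text \<open>A minimal element among the sublinear functionals below p is linear.\<close>

lemma sublinear_above_linear: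
  fixes p :: "'a::real_vector \<Rightarrow> real"
  assumes p: "sublinear p"
  shows "\<exists>l. linear l \<and> (\<forall>v. l v \<le> p v)"
proof -
  define P where "P = {q. sublinear q \<and> (\<forall>v. q v \<le> p v)}"
  \<comment> \<open>The order is reversed, a pair going from a functional to one below it, so that
    the maximal element supplied by Zorn's lemma is a minimal functional.\<close>
  define r where "r = {(q, q'). q \<in> P \<and> q' \<in> P \<and> (\<forall>v. q' v \<le> q v)}"
  have F: "Field r = P" unfolding r_def Field_def by auto
  have anti: "q = q'" if "\<forall>v. q' v \<le> q v" "\<forall>v. q v \<le> q' v" for q q' :: "'a \<Rightarrow> real"
    using that by (intro ext antisym) auto
  have "antisym r" unfolding r_def antisym_def using anti by blast
  moreover have "trans r" unfolding r_def trans_def by (auto intro: order_trans)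
  moreover have "refl_on P r" unfolding r_def refl_on_def by auto
  moreover have "r \<subseteq> P \<times> P" unfolding r_def by auto
  ultimately have po: "Partial_order r"
    unfolding partial_order_on_def preorder_on_def F by blast
  have lowb: "- p (- v) \<le> q v" if "q \<in> P" for q v
    using that sublinear_neg[of q v] unfolding P_def by (smt (verit) mem_Collect_eq)
  have "\<exists>m\<in>Field r. \<forall>a\<in>Field r. (m, a) \<in> r \<longrightarrow> a = m"
  proof (rule Zorns_po_lemma[OF po])
    fix C assume C: "C \<in> Chains r"
    show "\<exists>u\<in>Field r. \<forall>a\<in>C. (a, u) \<in> r"
    proof (cases "C = {}")
      case True
      then show ?thesis using p F P_def by auto
    next
      case False
      have CP: "C \<subseteq> P" using C unfolding Chains_def r_def by auto
      have tot: "(\<forall>v. a v \<le> b v) \<or> (\<forall>v. b v \<le> a v)" if "a \<in> C" "b \<in> C" for a b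
        using C that unfolding Chains_def r_def by blast
      define u where "u v = (INF q\<in>C. q v)" for v
      have bdd: "bdd_below ((\<lambda>q. q v) ` C)" for v
        unfolding bdd_below_def using lowb CP by (intro exI[of _ "- p (- v)"]) auto
      have ule: "u v \<le> q v" if "q \<in> C" for q v unfolding u_def using bdd that by (rule cINF_lower)
      have uge: "z \<le> u v" if "\<And>q. q \<in> C \<Longrightarrow> z \<le> q v" for z v
        unfolding u_def using False that by (rule cINF_greatest)
      have sub: "sublinear q" if "q \<in> C" for q using that CP P_def by auto
      have "u (v + w) \<le> u v + u w" for v w
      proof -
        \<comment> \<open>The infima at v and at w range over different members of the chain; the
          smaller of two comparable members serves for both summands.\<close>
        have "u (v + w) \<le> a v + b w" if "a \<in> C" "b \<in> C" for a b
          using tot[OF that]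
        proof
          assume le: "\<forall>v. a v \<le> b v"
          have "u (v + w) \<le> a v + a w"
            using ule[OF that(1), of "v + w"] sub[OF that(1)] unfolding sublinear_def
            by (meson order_trans)
          then show ?thesis using le[rule_format, of w] by linarith
        next
          assume le: "\<forall>v. b v \<le> a v"
          have "u (v + w) \<le> b v + b w"
            using ule[OF that(2), of "v + w"] sub[OF that(2)] unfolding sublinear_def
            by (meson order_trans)
          then show ?thesis using le[rule_format, of v] by linarith
        qed
        then have "u (v + w) - b w \<le> u v" if "b \<in> C" for b
          using that by (intro uge) (smt (verit))
        then have "u (v + w) - u v \<le> u w" by (intro uge) (smt (verit))
        then show ?thesis by simp
      qed
      moreover have "u (s *\<^sub>R v) = s * u v" if "s \<ge> 0" for s v
      proof (cases "s = 0")
        case True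
        have "(\<lambda>q. q 0) ` C = {0}" using False sub sublinear_zero by force
        then show ?thesis using True by (simp add: u_def)
      next
        case False
        then have s: "s > 0" using that by simp
        have half: "u (s *\<^sub>R v) \<le> s * u v" if s: "s > 0" for s v
        proof -
          have "u (s *\<^sub>R v) / s \<le> u v"
          proof (rule uge)
            fix q assume q: "q \<in> C"
            have "u (s *\<^sub>R v) \<le> s * q v"
              using ule[OF q, of "s *\<^sub>R v"] sub[OF q] s unfolding sublinear_def by simp
            then show "u (s *\<^sub>R v) / s \<le> q v" using s by (simp add: field_simps)
          qed
          then show ?thesis using s by (simp add: field_simps)
        qed
        have "u v \<le> (1 / s) * u (s *\<^sub>R v)" using half[of "1/s" "s *\<^sub>R v"] s by simp
        then show ?thesis using half[OF s, of v] s by (simp add: field_simps)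
      qed
      ultimately have "sublinear u" unfolding sublinear_def by blast
      moreover have "u v \<le> p v" for v
      proof -
        obtain q where q: "q \<in> C" using \<open>C \<noteq> {}\<close> by auto
        then have "q v \<le> p v" using CP P_def by auto
        then show ?thesis using ule[OF q, of v] by simp
      qed
      ultimately have "u \<in> P" unfolding P_def by blast
      then show ?thesis using CP ule F unfolding r_def by (intro bexI[of _ u]) auto
    qed
  qed
  then obtain m where m: "m \<in> P" and min: "\<And>a. a \<in> P \<Longrightarrow> (\<And>v. a v \<le> m v) \<Longrightarrow> a = m"
    unfolding F using r_def by auto
  have ms: "sublinear m" using m P_def by auto
  have odd: "m (- v) = - m v" for v
  proof -
    \<comment> \<open>Applied to the single vector v with bound \<open>m v\<close>, the minorant
      lies below m and satisfies \<open>q (- v) \<le> - m v\<close>. Minimality makes it equal to m,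
      so m is odd, and an odd sublinear functional is linear.\<close>
    obtain q where q: "sublinear q" "\<And>w. q w \<le> m w" "q (- v) \<le> - m v"
      using sublinear_minorant[OF ms convex_singleton[of v], of "m v"] by blast
    have "q \<in> P" using q m unfolding P_def by (blast intro: order_trans)
    then have "m (- v) \<le> - m v" using q min by blast
    then show ?thesis using sublinear_neg[OF ms, of v] by linarith
  qed
  have le: "m (v + w) \<le> m v + m w" for v w using ms unfolding sublinear_def by blast
  have "m (v + w) = m v + m w" for v w
    using le[of v w] le[of "- v" "- w"] odd[of v] odd[of w] odd[of "v + w"] by simp
  moreover have "m (s *\<^sub>R v) = s * m v" for s v
  proof (cases "s \<ge> 0")
    case True then show ?thesis using ms unfolding sublinear_def by simp
  next
    case False
    then have "m ((- s) *\<^sub>R v) = - s * m v"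
      using ms unfolding sublinear_def by (meson less_eq_real_def neg_0_le_iff_le linorder_le_cases)
    then show ?thesis using odd[of "s *\<^sub>R v"] by simp
  qed
  ultimately have "linear m" by (intro linearI) auto
  then show ?thesis using m P_def by auto
qed

theorem mazur_orlicz:
  fixes p :: "'a::real_vector \<Rightarrow> real"
  assumes "sublinear p" and "convex K" "K \<noteq> {}" and "\<And>k. k \<in> K \<Longrightarrow> \<beta> \<le> p k"
  shows "\<exists>l. linear l \<and> (\<forall>v. l v \<le> p v) \<and> (\<forall>k\<in>K. \<beta> \<le> l k)"
proof -
  obtain q where q: "sublinear q" "\<And>v. q v \<le> p v" "\<And>k. k \<in> K \<Longrightarrow> q (- k) \<le> - \<beta>"
    using sublinear_minorant[OF assms] by blast
  obtain l where l: "linear l" "\<And>v. l v \<le> q v" using sublinear_above_linear[OF q(1)] by blast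
  have "\<beta> \<le> l k" if "k \<in> K" for k
    using l(2)[of "- k"] q(3)[OF that] linear_neg[OF l(1)] by (smt (verit))
  then show ?thesis using l q(2) by (meson order_trans)
qed

section \<open>Functionals dominated by an equivalent norm\<close>

lemma equivalent_norm_sublinear: "equivalent_norm n \<Longrightarrow> sublinear n"
  unfolding equivalent_norm_def sublinear_def by auto

lemma linear_below_equivalent_norm:
  fixes n :: "'a::real_normed_vector \<Rightarrow> real"
  assumes n: "equivalent_norm n" and l: "linear l" "\<And>v. l v \<le> n v"
  shows "\<bar>l v\<bar> \<le> n v" and "bounded_linear l"
proof -
  have 1: "\<bar>l v\<bar> \<le> n v" for v
  proof -
    have "n (- v) = n v" using n unfolding equivalent_norm_def by (metis abs_1 abs_neg_one mult_1 scaleR_minus1_left)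
    then show ?thesis using l(2)[of v] l(2)[of "- v"] linear_neg[OF l(1), of v] by simp
  qed
  show "\<bar>l v\<bar> \<le> n v" by fact
  obtain b where "\<And>v. n v \<le> b * norm v" using n unfolding equivalent_norm_def by blast
  then have "norm (l v) \<le> norm v * b" for v using 1[of v] by (metis mult.commute order_trans real_norm_def)
  then show "bounded_linear l" using l(1) by (intro bounded_linear_intro[of l b]) (auto simp: linear_add linear_scale)
qed

text \<open>With K a singleton \<open>{w}\<close> and \<open>\<beta> = n w\<close> it yields a
  norming functional of w; with K the set of values \<open>T w\<close> of a convex set of operators
  it yields the separating functional of the mean value argument. Continuity comes from the
  domination by n.\<close>

lemma mazur_orlicz_blinfun:
  fixes n :: "'a::real_normed_vector \<Rightarrow> real"
  assumes n: "equivalent_norm n" and K: "convex K" "K \<noteq> {}" and "\<And>k. k \<in> K \<Longrightarrow> \<beta> \<le> n k"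
  shows "\<exists>y :: 'a \<Rightarrow>\<^sub>L real. (\<forall>v. \<bar>y v\<bar> \<le> n v) \<and> (\<forall>k\<in>K. \<beta> \<le> y k)"
proof -
  obtain l where l: "linear l" "\<And>v. l v \<le> n v" "\<And>k. k \<in> K \<Longrightarrow> \<beta> \<le> l k"
    using mazur_orlicz[OF equivalent_norm_sublinear[OF n] K] assms(4) by blast
  note bl = linear_below_equivalent_norm[OF n l(1,2)]
  show ?thesis
    by (rule exI[of _ "Blinfun l"]) (use bl l(3) in \<open>auto simp: bounded_linear_Blinfun_apply\<close>)
qed

lemma equivalent_norm_norm: "equivalent_norm norm"
  unfolding equivalent_norm_def
  by (auto intro: norm_triangle_ineq intro!: exI[of _ "1::real"])

section \<open>Mean value inequalities\<close>

text \<open>The bound \<open>M + \<epsilon>\<close> on the slopes from 0 persists up to a supremum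
  \<tau>, where it holds by continuity. If \<tau> were below 1, the Dini bound at \<tau> would push
  it further to the right; the slack \<epsilon> turns the bound on the limit superior into a strict
  inequality near \<tau>.\<close>

lemma dini_mean_value:
  fixes \<phi> :: "real \<Rightarrow> real"
  assumes cont: "continuous_on {0..1} \<phi>"
    and dini: "\<And>t. 0 \<le> t \<Longrightarrow> t < 1 \<Longrightarrow>
      Limsup (at_right 0) (\<lambda>s. ereal ((\<phi> (t + s) - \<phi> t) / s)) \<le> ereal M"
  shows "\<phi> 1 - \<phi> 0 \<le> M"
proof (rule field_le_epsilon)
  fix \<epsilon> :: real assume \<epsilon>: "\<epsilon> > 0"
  \<comment> \<open>The inequality is required at all earlier times too, so that S is an interval
    starting at 0.\<close>
  define S where "S = {t\<in>{0..1}. \<forall>s\<in>{0..t}. \<phi> s - \<phi> 0 \<le> (M + \<epsilon>) * s}"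
  have 0: "0 \<in> S" unfolding S_def by auto
  have bdd: "bdd_above S" unfolding S_def by (rule bdd_aboveI[of _ 1]) auto
  define \<tau> where "\<tau> = Sup S"
  have "t \<le> 1" if "t \<in> S" for t using that unfolding S_def by simp
  then have \<tau>: "0 \<le> \<tau>" "\<tau> \<le> 1"
    unfolding \<tau>_def using cSup_upper[OF 0 bdd] 0 by (blast intro: cSup_least)+
  have below: "\<phi> s - \<phi> 0 \<le> (M + \<epsilon>) * s" if s: "0 \<le> s" "s < \<tau>" for s
  proof -
    obtain t where "t \<in> S" "s < t" using s(2) 0 bdd less_cSup_iff[of S s] unfolding \<tau>_def by auto
    then show ?thesis using s unfolding S_def by auto
  qed
  have at: "\<phi> \<tau> - \<phi> 0 \<le> (M + \<epsilon>) * \<tau>"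
  proof (cases "\<tau> = 0")
    case False
    then have pos: "\<tau> > 0" using \<tau> by simp
    define \<xi> where "\<xi> s = \<phi> s - \<phi> 0 - (M + \<epsilon>) * s" for s
    have cl: "closure {0<..<\<tau>} = {0..\<tau>}" using pos by simp
    have "continuous_on {0..\<tau>} \<xi>"
      using \<tau> unfolding \<xi>_def by (intro continuous_intros continuous_on_subset[OF cont]) auto
    moreover have "\<xi> s \<le> 0" if "s \<in> {0<..<\<tau>}" for s
      using below[of s] that by (simp add: \<xi>_def)
    ultimately have "\<xi> \<tau> \<le> 0"
      using pos by (intro continuous_le_on_closure[of "{0<..<\<tau>}" \<xi> \<tau> 0]) (simp_all add: cl)
    then have "\<phi> \<tau> - \<phi> 0 - (M + \<epsilon>) * \<tau> \<le> 0" by (simp add: \<xi>_def)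
    then show ?thesis by simp
  qed auto
  have "\<tau> = 1"
  proof (rule ccontr)
    assume "\<tau> \<noteq> 1"
    then have lt: "\<tau> < 1" using \<tau> by simp
    have "Limsup (at_right 0) (\<lambda>s. ereal ((\<phi> (\<tau> + s) - \<phi> \<tau>) / s)) < ereal (M + \<epsilon>)"
      using dini[OF \<tau>(1) lt] \<epsilon> by (metis ereal_less_eq(3) less_ereal.simps(1) less_add_same_cancel1 le_less_trans)
    then have "\<forall>\<^sub>F s in at_right 0. ereal ((\<phi> (\<tau> + s) - \<phi> \<tau>) / s) < ereal (M + \<epsilon>)"
      by (rule Limsup_lessD)
    then obtain \<delta> where \<delta>: "\<delta> > 0" "\<And>s. 0 < s \<Longrightarrow> s < \<delta> \<Longrightarrow> (\<phi> (\<tau> + s) - \<phi> \<tau>) / s < M + \<epsilon>"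
      unfolding eventually_at_right_field by auto
    define \<tau>' where "\<tau>' = min (\<tau> + \<delta> / 2) 1"
    have "\<phi> s - \<phi> 0 \<le> (M + \<epsilon>) * s" if s: "0 \<le> s" "s \<le> \<tau>'" for s
    proof (cases "s \<le> \<tau>")
      case True then show ?thesis using below[OF s(1)] at by (cases "s = \<tau>") auto
    next
      case False
      then have "(\<phi> (\<tau> + (s - \<tau>)) - \<phi> \<tau>) / (s - \<tau>) < M + \<epsilon>"
        using \<delta>(1) s(2) by (intro \<delta>(2)) (auto simp: \<tau>'_def)
      then have "\<phi> s - \<phi> \<tau> < (M + \<epsilon>) * (s - \<tau>)" using False by (simp add: field_simps)
      then show ?thesis using at by (simp add: algebra_simps)
    qed
    moreover have "0 \<le> \<tau>'" "\<tau>' \<le> 1" using \<tau> \<delta>(1) by (auto simp: \<tau>'_def)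
    ultimately have "\<tau>' \<in> S" unfolding S_def by auto
    then have "\<tau>' \<le> \<tau>" unfolding \<tau>_def using bdd by (rule cSup_upper)
    then show False using lt \<delta>(1) by (auto simp: \<tau>'_def min_def split: if_splits)
  qed
  then show "\<phi> 1 - \<phi> 0 \<le> M + \<epsilon>" using at by simp
qed

text \<open>Along the segment from u to \<open>u'\<close> the pseudo-Jacobian inequality in the
  direction \<open>u' - u\<close> bounds the upper right Dini derivative of the scalar function
  \<open>y (g (u + t *\<^sub>R (u' - u)))\<close>; convexity of N keeps the segment in N.\<close>

lemma pseudo_jacobian_mean_value:
  fixes g :: "'a::real_normed_vector \<Rightarrow> 'b::real_normed_vector" and y :: "'b \<Rightarrow>\<^sub>L real"
  assumes N: "convex N" and J: "pseudo_jacobian_mapping_on N g J" and cont: "continuous_on N g"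
    and u: "u \<in> N" "u' \<in> N"
    and M: "\<And>p T. p \<in> N \<Longrightarrow> T \<in> J p \<Longrightarrow> y (blinfun_apply T (u' - u)) \<le> M"
  shows "y (g u' - g u) \<le> M"
proof -
  define w where "w = u' - u"
  define \<phi> where "\<phi> t = y (g (u + t *\<^sub>R w))" for t
  have mem: "u + t *\<^sub>R w \<in> N" if "0 \<le> t" "t \<le> 1" for t
    using convexD_alt[OF N u that] by (simp add: w_def algebra_simps)
  have "\<phi> 1 - \<phi> 0 \<le> M"
  proof (rule dini_mean_value)
    show "continuous_on {0..1} \<phi>"
      unfolding \<phi>_def by (intro continuous_intros continuous_on_compose2[OF cont]) (auto intro: mem)
    fix t :: real assume t: "0 \<le> t" "t < 1"
    have "Limsup (at_right 0) (\<lambda>s. ereal ((y (g ((u + t *\<^sub>R w) + s *\<^sub>R w)) - y (g (u + t *\<^sub>R w))) / s))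
        \<le> (SUP T\<in>J (u + t *\<^sub>R w). ereal (y (blinfun_apply T w)))"
      using J mem[of t] t unfolding pseudo_jacobian_mapping_on_def pseudo_jacobian_at_def by auto
    also have "\<dots> \<le> ereal M"
      using M mem[of t] t by (intro SUP_least) (auto simp: w_def)
    finally show "Limsup (at_right 0) (\<lambda>s. ereal ((\<phi> (t + s) - \<phi> t) / s)) \<le> ereal M"
      unfolding \<phi>_def by (simp add: algebra_simps)
  qed
  then show ?thesis by (simp add: \<phi>_def w_def blinfun.diff_right)
qed


section \<open>Expanding maps and openness\<close>

text \<open>The rate is uniform in centre and radius as long as the source ball lies in N. This
  uniformity lets a target be approached in many small steps.\<close>

definition open_rate_on :: "'a::real_normed_vector set \<Rightarrow> real \<Rightarrow> ('a \<Rightarrow> 'b::real_normed_vector) \<Rightarrow> bool" where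
  "open_rate_on N m g \<longleftrightarrow> (\<forall>u r. 0 < r \<longrightarrow> ball u r \<subseteq> N \<longrightarrow> ball (g u) (m * r) \<subseteq> g ` ball u r)"

definition expanding_on :: "'a::real_normed_vector set \<Rightarrow> real \<Rightarrow> ('a \<Rightarrow> 'b::real_normed_vector) \<Rightarrow> bool" where
  "expanding_on N m g \<longleftrightarrow> (\<forall>u\<in>N. \<forall>u'\<in>N. m * norm (u' - u) \<le> norm (g u' - g u))"

text \<open>
  Follow the segment from \<open>g u\<close> to the target in steps so short that the smaller rate suffices;
  the preimages stay in a smaller concentric ball because g is expanding.
\<close>

lemma open_rate_on_expanding:
  fixes g :: "'a::real_normed_vector \<Rightarrow> 'b::real_normed_vector"
  assumes exp: "expanding_on N m g" and m: "0 < m" and rate: "open_rate_on N m0 g" and m0: "0 < m0"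
  shows "open_rate_on N m g"
  unfolding open_rate_on_def
proof (intro allI impI subsetI)
  fix u :: 'a and r :: real and y :: 'b
  assume r: "0 < r" and N: "ball u r \<subseteq> N" and y: "y \<in> ball (g u) (m * r)"
  define D where "D = norm (y - g u)"
  \<comment> \<open>Expansion forces a preimage of any point of the segment to lie within
    \<open>D / m\<close> of u. Hence the ball of radius \<delta> about it is still inside
    \<open>ball u r\<close>, and steps of length \<open>D / n\<close> below
    \<open>m0 * \<delta>\<close> can use the rate m0 there.\<close>
  define \<delta> where "\<delta> = r - D / m"
  have \<delta>: "\<delta> > 0" using y m by (simp add: \<delta>_def D_def dist_norm norm_minus_commute field_simps)
  have D0: "D \<ge> 0" by (simp add: D_def)
  obtain n :: nat where n: "n > 0" "D / n < m0 * \<delta>"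
  proof -
    obtain n :: nat where "D / (m0 * \<delta>) < n" using reals_Archimedean2 by blast
    then have "D / real (Suc n) < m0 * \<delta>" using m0 \<delta> by (simp add: field_simps add_strict_increasing2)
    then show ?thesis using that[of "Suc n"] by simp
  qed
  have "i \<le> n \<Longrightarrow> \<exists>z\<in>ball u r. g z = g u + (real i / n) *\<^sub>R (y - g u)" for i
  proof (induction i)
    case 0
    show ?case using r by (intro bexI[of _ u]) auto
  next
    case (Suc i)
    then obtain z where z: "z \<in> ball u r" "g z = g u + (real i / n) *\<^sub>R (y - g u)" by auto
    have "m * norm (z - u) \<le> norm (g z - g u)"
      using exp z(1) N r unfolding expanding_on_def by (meson centre_in_ball subsetD)
    also have "\<dots> = (real i / n) * D" by (simp add: z(2) D_def)
    also have "\<dots> \<le> 1 * D" using Suc.prems n(1) D0 by (intro mult_right_mono) auto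
    finally have "norm (z - u) \<le> D / m" using m by (simp add: field_simps)
    then have zu: "dist u z \<le> r - \<delta>" by (simp add: \<delta>_def dist_norm norm_minus_commute)
    have sub: "ball z \<delta> \<subseteq> ball u r"
    proof
      fix w assume "w \<in> ball z \<delta>"
      then show "w \<in> ball u r" using zu dist_triangle[of u w z] by simp
    qed
    have step: "real (Suc i) / n = real i / n + 1 / real n" by (simp add: add_divide_distrib)
    have "norm (g u + (real (Suc i) / n) *\<^sub>R (y - g u) - g z) = norm ((1 / real n) *\<^sub>R (y - g u))"
      unfolding z(2) step by (simp add: scaleR_add_left)
    also have "\<dots> = D / n" by (simp add: D_def)
    finally have "g u + (real (Suc i) / n) *\<^sub>R (y - g u) \<in> ball (g z) (m0 * \<delta>)"
      using n(2) by (simp add: dist_norm norm_minus_commute)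
    then show ?case
      using rate \<delta> sub N unfolding open_rate_on_def by (smt (verit) image_iff subset_iff)
  qed
  from this[of n] n(1) show "y \<in> g ` ball u r" by force
qed

text \<open>
  The equation \<open>g' z = y\<close> is the fixed point equation \<open>z = g\<^sup>-\<^sup>1 (y - (g' z - g z))\<close> of a
  contraction.
\<close>

lemma open_rate_on_perturbation:
  fixes g g' :: "'a::banach \<Rightarrow> 'b::real_normed_vector"
  assumes exp: "expanding_on N m g" and rate: "open_rate_on N m g" and exp': "expanding_on N m g'"
    and lip: "\<And>u u'. u \<in> N \<Longrightarrow> u' \<in> N \<Longrightarrow>
      norm ((g' u' - g u') - (g' u - g u)) \<le> l * norm (u' - u)"
    and l: "0 \<le> l" "l < m"
  shows "open_rate_on N m g'"
proof (rule open_rate_on_expanding[OF exp'])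
  show "0 < m" "0 < m - l" using l by auto
  \<comment> \<open>The contraction argument only yields the rate \<open>m - l\<close>. Expansion of
    \<open>g'\<close> restores m, so the rate does not deteriorate when the lemma is
    iterated.\<close>
  show "open_rate_on N (m - l) g'"
    unfolding open_rate_on_def
  proof (intro allI impI subsetI)
    fix u r y assume r: "0 < r" and N: "ball u r \<subseteq> N" and y: "y \<in> ball (g' u) ((m - l) * r)"
    define h where "h z = g' z - g z" for z
    \<comment> \<open>This radius makes \<open>cball u r'\<close> invariant:
      \<open>norm (y - g' u) + l * r' = m * r'\<close>, and division by the expansion constant m of
      g returns \<open>r'\<close>.\<close>
    define r' where "r' = norm (y - g' u) / (m - l)"
    have r': "0 \<le> r'" "r' < r" "norm (y - g' u) = (m - l) * r'"
      using y l by (auto simp: r'_def dist_norm norm_minus_commute field_simps)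
    have C: "cball u r' \<subseteq> ball u r" using r' by auto
    have u: "u \<in> N" using N r by auto
    have h: "norm (h z' - h z) \<le> l * norm (z' - z)" if "z \<in> N" "z' \<in> N" for z z'
      using lip that unfolding h_def by blast
    have close: "norm (y - h z - g u) \<le> m * r'" if z: "z \<in> cball u r'" for z
    proof -
      have "y - h z - g u = (y - g' u) + (h u - h z)" by (simp add: h_def)
      then have "norm (y - h z - g u) \<le> norm (y - g' u) + norm (h u - h z)"
        by (metis norm_triangle_ineq)
      also have "norm (h u - h z) \<le> l * norm (u - z)" using h C N z u by blast
      also have "l * norm (u - z) \<le> l * r'" using z l by (intro mult_left_mono) (auto simp: dist_norm)
      finally show ?thesis unfolding r'(3) by (simp add: algebra_simps)
    qed
    have "\<exists>z'\<in>ball u r. g z' = y - h z" if z: "z \<in> cball u r'" for z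
    proof -
      have "m * r' < m * r" using r' l by simp
      then have "y - h z \<in> ball (g u) (m * r)"
        using close[OF z] by (simp add: dist_norm norm_minus_commute)
      then show ?thesis using rate r N unfolding open_rate_on_def by (smt (verit) image_iff subset_iff)
    qed
    then obtain \<Phi> where \<Phi>: "\<And>z. z \<in> cball u r' \<Longrightarrow> \<Phi> z \<in> ball u r"
      "\<And>z. z \<in> cball u r' \<Longrightarrow> g (\<Phi> z) = y - h z"
      by metis
    have expg: "m * norm (z' - z) \<le> norm (g z' - g z)" if "z \<in> N" "z' \<in> N" for z z'
      using exp that unfolding expanding_on_def by blast
    have "\<exists>!z\<in>cball u r'. \<Phi> z = z"
    proof (rule Banach_fix[where c = "l / m"])
      show "complete (cball u r')" by (simp add: complete_eq_closed)
      show "cball u r' \<noteq> {}" using r' by simp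
      show "0 \<le> l / m" "l / m < 1" using l by auto
      show "\<Phi> ` cball u r' \<subseteq> cball u r'"
      proof
        fix w assume "w \<in> \<Phi> ` cball u r'"
        then obtain z where z: "z \<in> cball u r'" "w = \<Phi> z" by auto
        have "m * norm (w - u) \<le> norm (g w - g u)" using expg u \<Phi>(1)[OF z(1)] z(2) N by blast
        also have "\<dots> \<le> m * r'" using close[OF z(1)] \<Phi>(2)[OF z(1)] z(2) by simp
        finally show "w \<in> cball u r'" using l by (simp add: dist_norm norm_minus_commute)
      qed
      fix z z' assume z: "z \<in> cball u r'" "z' \<in> cball u r'"
      then have "m * norm (\<Phi> z - \<Phi> z') \<le> norm (g (\<Phi> z) - g (\<Phi> z'))" using expg \<Phi>(1) N by blast
      also have "\<dots> = norm (h z' - h z)" using z \<Phi>(2) by simp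
      also have "\<dots> \<le> l * norm (z - z')"
        using h[of z z'] C N z by (metis norm_minus_commute subsetD)
      finally show "dist (\<Phi> z) (\<Phi> z') \<le> l / m * dist z z'"
        using l by (simp add: dist_norm field_simps)
    qed
    then obtain z where "z \<in> cball u r'" "\<Phi> z = z" by blast
    then have "g' z = y" "z \<in> ball u r" using \<Phi>[of z] by (auto simp: h_def)
    then show "y \<in> g' ` ball u r" by blast
  qed
qed

text \<open>The homotopy from A to g is cut into n equal steps. Consecutive maps differ by a map
  with Lipschitz constant at most \<open>(M + norm A) / n\<close>, which is below m for large n, and
  the rate m passes unchanged from each to the next.\<close>

lemma open_rate_on_continuation:
  fixes g :: "'a::banach \<Rightarrow> 'b::real_normed_vector" and A :: "'a \<Rightarrow>\<^sub>L 'b"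
  assumes m: "0 < m"
    and exp: "\<And>t. 0 \<le> t \<Longrightarrow> t \<le> 1 \<Longrightarrow> expanding_on N m (\<lambda>z. (1 - t) *\<^sub>R A z + t *\<^sub>R g z)"
    and expA: "expanding_on UNIV m A" and surj: "surj A"
    and M: "0 \<le> M" "\<And>u u'. u \<in> N \<Longrightarrow> u' \<in> N \<Longrightarrow> norm (g u' - g u) \<le> M * norm (u' - u)"
  shows "open_rate_on N m g"
proof -
  define G where "G t z = (1 - t) *\<^sub>R A z + t *\<^sub>R g z" for t :: real and z
  define L where "L = M + norm A"
  have L: "L \<ge> 0" using M by (simp add: L_def)
  obtain n :: nat where n: "n > 0" "L / n < m"
  proof -
    obtain n :: nat where "L / m < n" using reals_Archimedean2 by blast
    then have "L / real (Suc n) < m" using m by (simp add: field_simps add_strict_increasing2)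
    then show ?thesis using that[of "Suc n"] by simp
  qed
  have "i \<le> n \<Longrightarrow> open_rate_on N m (G (real i / n))" for i
  proof (induction i)
    case 0
    \<comment> \<open>For the linear map A the rate is immediate: surjectivity provides a preimage
      of y, and expansion places it within r of u.\<close>
    have "ball (A u) (m * r) \<subseteq> A ` ball u r" for u r
    proof
      fix y assume y: "y \<in> ball (A u) (m * r)"
      obtain v where v: "y = A v" using surj by auto
      have "m * norm (v - u) \<le> norm (A v - A u)" using expA unfolding expanding_on_def by blast
      also have "\<dots> < m * r" using y v by (simp add: dist_norm norm_minus_commute)
      finally show "y \<in> A ` ball u r" using m v by (simp add: dist_norm norm_minus_commute)
    qed
    then show ?case unfolding open_rate_on_def G_def by simp
  next
    case (Suc i)
    let ?t = "real i / n" and ?s = "real (Suc i) / n"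
    have st: "?s - ?t = 1 / real n" by (simp add: diff_divide_distrib[symmetric])
    have diff: "(G s u' - G t u') - (G s u - G t u) = (s - t) *\<^sub>R ((g u' - g u) - A (u' - u))"
      for s t u u'
      unfolding G_def by (simp add: algebra_simps blinfun.diff_right)
    show ?case
    proof (rule open_rate_on_perturbation)
      show "expanding_on N m (G ?t)" "expanding_on N m (G ?s)"
        unfolding G_def using Suc.prems n by (auto intro!: exp)
      show "open_rate_on N m (G ?t)" using Suc by simp
      show "0 \<le> L / n" "L / n < m" using n L by auto
      fix u u' assume u: "u \<in> N" "u' \<in> N"
      have "(G ?s u' - G ?t u') - (G ?s u - G ?t u) = (?s - ?t) *\<^sub>R ((g u' - g u) - A (u' - u))"
        by (rule diff)
      also have "norm \<dots> = (1 / real n) * norm ((g u' - g u) - A (u' - u))" unfolding st by simp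
      also have "\<dots> \<le> (1 / real n) * (norm (g u' - g u) + norm (A (u' - u)))"
        by (intro mult_left_mono norm_triangle_ineq4) auto
      also have "\<dots> \<le> (1 / real n) * (M * norm (u' - u) + norm A * norm (u' - u))"
        by (intro mult_left_mono add_mono M(2) u norm_blinfun) auto
      finally show "norm ((G ?s u' - G ?t u') - (G ?s u - G ?t u)) \<le> L / n * norm (u' - u)"
        by (simp add: L_def algebra_simps add_divide_distrib)
    qed
  qed
  moreover have "G 1 = g" by (rule ext) (simp add: G_def)
  ultimately show ?thesis using n(1) by (metis div_self of_nat_0_less_iff order_less_irrefl order_refl)
qed

text \<open>The equation \<open>T z = y\<close> reads \<open>S z = y - (T - S) z\<close>. The
  inverse of S is Lipschitz with constant \<open>1 / m\<close>, so z is the fixed point of a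
  contraction with factor \<open>norm (T - S) / m\<close>.\<close>

lemma surj_perturbation:
  fixes S T :: "'a::banach \<Rightarrow>\<^sub>L 'b::real_normed_vector"
  assumes m: "0 < m" and S: "\<And>v. m * norm v \<le> norm (S v)" "surj S" and T: "norm (T - S) < m"
  shows "surj T"
proof -
  have "\<exists>v. T v = y" for y
  proof -
    define \<Phi> where "\<Phi> z = inv (blinfun_apply S) (y - (T - S) z)" for z
    have \<Phi>: "S (\<Phi> z) = y - (T - S) z" for z unfolding \<Phi>_def by (rule surj_f_inv_f[OF S(2)])
    have "\<exists>!z. \<Phi> z = z"
    proof (rule banach_fix_type[where c = "norm (T - S) / m"])
      show "0 \<le> norm (T - S) / m" "norm (T - S) / m < 1" using m T by auto
      show "\<forall>z z'. dist (\<Phi> z) (\<Phi> z') \<le> norm (T - S) / m * dist z z'"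
      proof (intro allI)
        fix z z'
        have "m * norm (\<Phi> z - \<Phi> z') \<le> norm (S (\<Phi> z) - S (\<Phi> z'))"
          using S(1)[of "\<Phi> z - \<Phi> z'"] by (simp add: blinfun.diff_right)
        also have "\<dots> = norm ((T - S) (z - z'))"
          unfolding \<Phi> by (simp add: blinfun.diff_right norm_minus_commute)
        also have "\<dots> \<le> norm (T - S) * norm (z - z')" by (rule norm_blinfun)
        finally show "dist (\<Phi> z) (\<Phi> z') \<le> norm (T - S) / m * dist z z'"
          using m by (simp add: dist_norm field_simps)
      qed
    qed
    then obtain z where "\<Phi> z = z" by blast
    then have "T z = y" using \<Phi>[of z] by (simp add: blinfun.diff_left)
    then show ?thesis by blast
  qed
  then show ?thesis unfolding surj_def by metis
qed

section \<open>Maps whose pseudo-Jacobian hull is bounded below\<close>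

context
  fixes g :: "'a::banach \<Rightarrow> 'b::real_normed_vector" and N J nE nF \<beta> M
  assumes nE: "equivalent_norm nE" and nF: "equivalent_norm nF"
    and N: "convex N" and J: "pseudo_jacobian_mapping_on N g J" and cont: "continuous_on N g"
    and \<beta>: "0 < \<beta>"
    and lower: "\<And>T e. T \<in> convex hull (\<Union>p\<in>N. J p) \<Longrightarrow> \<beta> * nE e \<le> nF (blinfun_apply T e)"
    and M: "\<And>p T. p \<in> N \<Longrightarrow> T \<in> J p \<Longrightarrow> norm T \<le> M"
begin

text \<open>The values \<open>T (u' - u)\<close> over the hull form a convex set on which
  \<open>nF\<close> is at least \<open>\<beta> * nE (u' - u)\<close>, so some functional dominated
  by \<open>nF\<close> stays above this number on the whole set. The same functional then controls
  the increment of g through the mean value inequality; the continuation depends on this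
  simultaneity.\<close>

lemma separating_functional:
  assumes u: "u \<in> N" "u' \<in> N"
  shows "\<exists>y :: 'b \<Rightarrow>\<^sub>L real. (\<forall>v. \<bar>y v\<bar> \<le> nF v) \<and> \<beta> * nE (u' - u) \<le> y (g u' - g u) \<and>
    (\<forall>T\<in>convex hull (\<Union>p\<in>N. J p). \<beta> * nE (u' - u) \<le> y (blinfun_apply T (u' - u)))"
proof -
  let ?C = "convex hull (\<Union>p\<in>N. J p)"
  let ?K = "(\<lambda>T. blinfun_apply T (u' - u)) ` ?C"
  have "linear (\<lambda>T :: 'a \<Rightarrow>\<^sub>L 'b. blinfun_apply T (u' - u))"
    by (intro linearI) (auto simp: blinfun.add_left blinfun.scaleR_left)
  then have "convex ?K" by (intro convex_linear_image convex_convex_hull)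
  moreover have "?K \<noteq> {}"
    using J u unfolding pseudo_jacobian_mapping_on_def pseudo_jacobian_at_def by auto
  ultimately obtain y :: "'b \<Rightarrow>\<^sub>L real" where y: "\<And>v. \<bar>y v\<bar> \<le> nF v"
    "\<And>k. k \<in> ?K \<Longrightarrow> \<beta> * nE (u' - u) \<le> y k"
    using mazur_orlicz_blinfun[OF nF, of ?K "\<beta> * nE (u' - u)"] lower by blast
  have yT: "\<beta> * nE (u' - u) \<le> y (blinfun_apply T (u' - u))" if "T \<in> ?C" for T
    using y(2) that by blast
  \<comment> \<open>The mean value inequality bounds from above, so it is applied to
    \<open>- y\<close>.\<close>
  have "(- y) (g u' - g u) \<le> - (\<beta> * nE (u' - u))"
  proof (rule pseudo_jacobian_mean_value[OF N J cont u])
    fix p T assume "p \<in> N" "T \<in> J p"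
    then have "T \<in> convex hull (\<Union>p\<in>N. J p)" by (intro hull_inc) blast
    then show "(- y) (blinfun_apply T (u' - u)) \<le> - (\<beta> * nE (u' - u))"
      using yT by (simp add: blinfun.minus_left)
  qed
  then have "\<beta> * nE (u' - u) \<le> y (g u' - g u)" by (simp add: blinfun.minus_left)
  then show ?thesis using y(1) yT by blast
qed

lemma pseudo_jacobian_expanding:
  assumes u: "u \<in> N" "u' \<in> N"
  shows "\<beta> * nE (u' - u) \<le> nF (g u' - g u)"
proof -
  obtain y :: "'b \<Rightarrow>\<^sub>L real" where "\<And>v. \<bar>y v\<bar> \<le> nF v" "\<beta> * nE (u' - u) \<le> y (g u' - g u)"
    using separating_functional[OF u] by blast
  then show ?thesis by (smt (verit))
qed

lemma pseudo_jacobian_lipschitz: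
  assumes u: "u \<in> N" "u' \<in> N"
  shows "norm (g u' - g u) \<le> M * norm (u' - u)"
proof -
  \<comment> \<open>A norming functional of the increment reduces the vector inequality to the
    scalar one.\<close>
  obtain y :: "'b \<Rightarrow>\<^sub>L real" where y: "\<And>v. \<bar>y v\<bar> \<le> norm v" "norm (g u' - g u) \<le> y (g u' - g u)"
    using mazur_orlicz_blinfun[OF equivalent_norm_norm, of "{g u' - g u}" "norm (g u' - g u)"]
      convex_singleton by blast
  have "y (g u' - g u) \<le> M * norm (u' - u)"
  proof (rule pseudo_jacobian_mean_value[OF N J cont u])
    fix p T assume "p \<in> N" "T \<in> J p"
    then have "norm (blinfun_apply T (u' - u)) \<le> M * norm (u' - u)"
      using M norm_blinfun[of T "u' - u"] by (meson mult_right_mono norm_ge_zero order_trans)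
    then show "y (blinfun_apply T (u' - u)) \<le> M * norm (u' - u)"
      using y(1)[of "blinfun_apply T (u' - u)"] by linarith
  qed
  then show ?thesis using y(2) by linarith
qed

text \<open>
  All the maps \<open>(1 - t) A + t g\<close> are expanding with the same constant, so openness propagates from
  the isomorphism A to g.
\<close>

lemma pseudo_jacobian_open_rate:
  assumes A: "A \<in> convex hull (\<Union>p\<in>N. J p)" "surj (blinfun_apply A)"
  shows "\<exists>m>0. open_rate_on N m g"
proof -
  obtain a where a: "a > 0" "\<And>v. a * norm v \<le> nE v" using nE unfolding equivalent_norm_def by blast
  obtain b where b: "b > 0" "\<And>v. nF v \<le> b * norm v" using nF unfolding equivalent_norm_def by blast
  \<comment> \<open>The constant that the estimate \<open>\<beta> * nE v \<le> nF w\<close> gives in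
    the model norms, from \<open>a * norm v \<le> nE v\<close> and
    \<open>nF w \<le> b * norm w\<close>.\<close>
  define m where "m = \<beta> * a / b"
  have m: "m > 0" using a b \<beta> by (simp add: m_def)
  have native: "m * norm v \<le> norm w" if "\<beta> * nE v \<le> nF w" for v w
  proof -
    have "\<beta> * (a * norm v) \<le> \<beta> * nE v" using a \<beta> by (intro mult_left_mono) auto
    also have "\<dots> \<le> b * norm w" using that b(2)[of w] by linarith
    finally show ?thesis using b(1) by (simp add: m_def field_simps)
  qed
  have "expanding_on N m (\<lambda>z. (1 - t) *\<^sub>R A z + t *\<^sub>R g z)" if t: "0 \<le> t" "t \<le> 1" for t
    unfolding expanding_on_def
  proof (intro ballI)
    fix u u' assume u: "u \<in> N" "u' \<in> N"
    obtain y :: "'b \<Rightarrow>\<^sub>L real" where y: "\<And>v. \<bar>y v\<bar> \<le> nF v" "\<beta> * nE (u' - u) \<le> y (g u' - g u)"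
      "\<beta> * nE (u' - u) \<le> y (A (u' - u))"
      using separating_functional[OF u] A(1) by blast
    let ?G = "\<lambda>z. (1 - t) *\<^sub>R A z + t *\<^sub>R g z"
    \<comment> \<open>The bound is split in the proportion of the homotopy: y bounds the increments
      of A and of g from below by the same number.\<close>
    have "\<beta> * nE (u' - u) = (1 - t) * (\<beta> * nE (u' - u)) + t * (\<beta> * nE (u' - u))"
      by (simp add: algebra_simps)
    also have "\<dots> \<le> (1 - t) * y (A (u' - u)) + t * y (g u' - g u)"
      using t y by (intro add_mono mult_left_mono) auto
    also have "\<dots> = y (?G u' - ?G u)"
      by (simp add: blinfun.diff_right blinfun.add_right blinfun.scaleR_right algebra_simps)
    also have "\<dots> \<le> nF (?G u' - ?G u)" using y(1)[of "?G u' - ?G u"] by linarith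
    finally show "m * norm (u' - u) \<le> norm (?G u' - ?G u)" by (rule native)
  qed
  moreover have "expanding_on UNIV m A"
    unfolding expanding_on_def using lower[OF A(1)] native by (simp add: blinfun.diff_right[symmetric])
  moreover have "norm (g u' - g u) \<le> max 0 M * norm (u' - u)" if "u \<in> N" "u' \<in> N" for u u'
    using pseudo_jacobian_lipschitz[OF that] by (smt (verit) mult_right_mono norm_ge_zero)
  ultimately have "open_rate_on N m g"
    using A(2) m by (intro open_rate_on_continuation[of m N A g "max 0 M"]) auto
  then show ?thesis using m by blast
qed

end


section \<open>Tangent spaces\<close>

text \<open>It depends on the point of the manifold instead of its coordinates in \<open>c\<close>,
  so that at a common point these operators compose directly and their continuity along a path or
  after f is easily stated.\<close>

definition trans_deriv ::
    "('x, 'e::real_normed_vector) chart \<Rightarrow> ('x, 'e) chart \<Rightarrow> 'x \<Rightarrow> 'e \<Rightarrow>\<^sub>L 'e" where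
  "trans_deriv c d x = Blinfun (frechet_derivative (chart_transition c d) (at (snd c x)))"

context
  fixes A :: "('x::t2_space, 'e::banach) chart set"
  assumes A: "C1_manifold A"
begin

lemma charts_at_iff: "c \<in> charts_at A x \<longleftrightarrow> c \<in> A \<and> x \<in> fst c"
  by (simp add: charts_at_def)

lemma ex_chart_at: "\<exists>c. c \<in> charts_at A x"
  using A unfolding C1_manifold_def charts_at_def by (metis (mono_tags, lifting) UNIV_I UN_iff mem_Collect_eq)

lemma chart_is_chart: "c \<in> A \<Longrightarrow> is_chart c"
  using A unfolding C1_manifold_def by blast

lemma chart_open: "c \<in> A \<Longrightarrow> open (fst c)" "c \<in> A \<Longrightarrow> open (chart_image c)"
  using chart_is_chart unfolding is_chart_def by blast+

lemma chart_cont: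
  "c \<in> A \<Longrightarrow> continuous_on (fst c) (snd c)" "c \<in> A \<Longrightarrow> continuous_on (chart_image c) (chart_inv c)"
  using chart_is_chart unfolding is_chart_def homeomorphism_def by blast+

lemma chart_inv_left: "c \<in> A \<Longrightarrow> z \<in> fst c \<Longrightarrow> chart_inv c (snd c z) = z"
  using chart_is_chart unfolding is_chart_def homeomorphism_def by blast

lemma chart_inv_right: "p \<in> chart_image c \<Longrightarrow> snd c (chart_inv c p) = p"
  by (rule f_inv_into_f)

lemma chart_inv_mem: "p \<in> chart_image c \<Longrightarrow> chart_inv c p \<in> fst c"
  by (rule inv_into_into)

lemma chart_inj: "c \<in> A \<Longrightarrow> inj_on (snd c) (fst c)"
  by (metis chart_inv_left inj_on_inverseI)

lemma chart_inv_open: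
  assumes c: "c \<in> A" and P: "open P" "P \<subseteq> chart_image c"
  shows "open (chart_inv c ` P)"
proof -
  have "chart_inv c ` P = fst c \<inter> snd c -` P"
  proof (intro equalityI subsetI)
    fix z assume "z \<in> chart_inv c ` P"
    then obtain p where p: "p \<in> P" "z = chart_inv c p" by blast
    then have "p \<in> chart_image c" using P(2) by blast
    then show "z \<in> fst c \<inter> snd c -` P" using p chart_inv_mem[of p c] chart_inv_right[of p c] by simp
  next
    fix z assume "z \<in> fst c \<inter> snd c -` P"
    then show "z \<in> chart_inv c ` P" using chart_inv_left[OF c, of z] by (metis IntE imageI vimageD)
  qed
  then show ?thesis
    using continuous_open_preimage[OF chart_cont(1)[OF c] chart_open(1)[OF c] P(1)] by simp
qed

lemma chart_image_open:
  assumes c: "c \<in> A" and U: "open U" "U \<subseteq> fst c"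
  shows "open (snd c ` U)"
proof -
  have "snd c ` U = chart_image c \<inter> chart_inv c -` U"
  proof (intro equalityI subsetI)
    fix p assume "p \<in> snd c ` U"
    then show "p \<in> chart_image c \<inter> chart_inv c -` U" using U(2) chart_inv_left[OF c] by auto
  next
    fix p assume "p \<in> chart_image c \<inter> chart_inv c -` U"
    then show "p \<in> snd c ` U" using chart_inv_right[of p c] by (metis IntE imageI vimageD)
  qed
  then show ?thesis
    using continuous_open_preimage[OF chart_cont(2)[OF c] chart_open(2)[OF c] U(1)] by simp
qed

lemma trans_deriv_C1:
  assumes c: "c \<in> A" and d: "d \<in> A"
  shows "z \<in> fst c \<inter> fst d \<Longrightarrow>
      (chart_transition c d has_derivative blinfun_apply (trans_deriv c d z)) (at (snd c z))"
    and "continuous_on (fst c \<inter> fst d) (trans_deriv c d)"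
proof -
  have "C1_on (snd c ` (fst c \<inter> fst d)) (chart_transition c d)"
    using A c d unfolding C1_manifold_def C1_compatible_def by blast
  then obtain g' :: "'e \<Rightarrow> 'e \<Rightarrow>\<^sub>L 'e" where
    g': "\<And>p. p \<in> snd c ` (fst c \<inter> fst d) \<Longrightarrow>
        (chart_transition c d has_derivative blinfun_apply (g' p)) (at p)"
      "continuous_on (snd c ` (fst c \<inter> fst d)) g'"
    unfolding C1_on_def by blast
  have eq: "trans_deriv c d z = g' (snd c z)" if "z \<in> fst c \<inter> fst d" for z
    using g'(1)[of "snd c z"] that unfolding trans_deriv_def
    by (metis blinfun_apply_inverse frechet_derivative_at imageI)
  then show "z \<in> fst c \<inter> fst d \<Longrightarrow>
      (chart_transition c d has_derivative blinfun_apply (trans_deriv c d z)) (at (snd c z))"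
    using g'(1)[of "snd c z"] by auto
  have "continuous_on (fst c \<inter> fst d) (\<lambda>z. g' (snd c z))"
    by (rule continuous_on_compose2[OF g'(2) continuous_on_subset[OF chart_cont(1)[OF c]]]) auto
  then show "continuous_on (fst c \<inter> fst d) (trans_deriv c d)"
    using eq continuous_on_cong by (metis (no_types, lifting))
qed

lemma trans_deriv_self:
  assumes c: "c \<in> charts_at A x"
  shows "trans_deriv c c x v = v"
proof -
  have cA: "c \<in> A" "x \<in> fst c" using c charts_at_iff by auto
  have "((\<lambda>p. p) has_derivative (\<lambda>v. v)) (at (snd c x))" by (rule has_derivative_ident)
  then have "(chart_transition c c has_derivative (\<lambda>v. v)) (at (snd c x))"
    by (rule has_derivative_transform_within_open[OF _ chart_open(2)[OF cA(1)]])
       (use cA chart_inv_right[of _ c] in \<open>auto simp: chart_transition_def\<close>)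
  moreover have "(chart_transition c c has_derivative blinfun_apply (trans_deriv c c x)) (at (snd c x))"
    using trans_deriv_C1(1)[OF cA(1) cA(1)] cA by auto
  ultimately show ?thesis using has_derivative_unique by metis
qed

text \<open>The chain rule. The composite of the two transition maps is identified with the direct
  one on the image of the overlap of the domains of \<open>c\<close> and \<open>d\<close>, an open
  set, which is enough for derivatives.\<close>

lemma trans_deriv_trans:
  assumes c: "c \<in> charts_at A x" "d \<in> charts_at A x" "e \<in> charts_at A x"
  shows "trans_deriv d e x (trans_deriv c d x v) = trans_deriv c e x v"
proof -
  have cA: "c \<in> A" "x \<in> fst c" "d \<in> A" "x \<in> fst d" "e \<in> A" "x \<in> fst e" using c charts_at_iff by auto
  have tr: "chart_transition c d (snd c z) = snd d z" if "c \<in> A" "z \<in> fst c" for c d :: "('x, 'e) chart" and z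
    using that chart_inv_left by (simp add: chart_transition_def)
  have "(chart_transition c d has_derivative blinfun_apply (trans_deriv c d x)) (at (snd c x))"
    using trans_deriv_C1(1)[of c d] cA by auto
  moreover have "(chart_transition d e has_derivative blinfun_apply (trans_deriv d e x)) (at (snd d x))"
    using trans_deriv_C1(1)[of d e] cA by auto
  ultimately have "(chart_transition d e \<circ> chart_transition c d has_derivative
      blinfun_apply (trans_deriv d e x) \<circ> blinfun_apply (trans_deriv c d x)) (at (snd c x))"
    using tr[of c x d] cA by (intro diff_chain_at) auto
  then have "(chart_transition c e has_derivative
      blinfun_apply (trans_deriv d e x) \<circ> blinfun_apply (trans_deriv c d x)) (at (snd c x))"
  proof (rule has_derivative_transform_within_open)
    show "open (snd c ` (fst c \<inter> fst d))"
      using cA by (intro chart_image_open open_Int chart_open) auto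
    show "snd c x \<in> snd c ` (fst c \<inter> fst d)" using cA by auto
    fix p assume "p \<in> snd c ` (fst c \<inter> fst d)"
    then obtain z where "z \<in> fst c" "z \<in> fst d" "p = snd c z" by auto
    then show "(chart_transition d e \<circ> chart_transition c d) p = chart_transition c e p"
      using tr cA by auto
  qed
  moreover have "(chart_transition c e has_derivative blinfun_apply (trans_deriv c e x)) (at (snd c x))"
    using trans_deriv_C1(1)[of c e] cA by auto
  ultimately show ?thesis using has_derivative_unique by (metis comp_apply)
qed

lemma trans_deriv_inverse:
  assumes "c \<in> charts_at A x" "d \<in> charts_at A x"
  shows "trans_deriv d c x (trans_deriv c d x v) = v"
  using trans_deriv_trans[OF assms assms(1)] trans_deriv_self[OF assms(1)] by simp

lemma tangent_vec_eq:
  assumes c: "c \<in> charts_at A x"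
  shows "tangent_vec A x c v = {(d, trans_deriv c d x v) | d. d \<in> charts_at A x}"
proof -
  have "frechet_derivative (chart_transition c d) (at (snd c x)) v = trans_deriv c d x v"
    if d: "d \<in> charts_at A x" for d
    using trans_deriv_C1(1)[of c d x] frechet_derivative_at c d charts_at_iff by (metis IntI)
  then show ?thesis unfolding tangent_vec_def by force
qed

lemma tangent_vec_change:
  assumes c: "c \<in> charts_at A x" "d \<in> charts_at A x"
  shows "tangent_vec A x d (trans_deriv c d x v) = tangent_vec A x c v"
proof -
  have "trans_deriv d e x (trans_deriv c d x v) = trans_deriv c e x v" if "e \<in> charts_at A x" for e
    using trans_deriv_trans c that by blast
  then show ?thesis unfolding tangent_vec_eq[OF c(1)] tangent_vec_eq[OF c(2)] by force
qed

lemma tangent_coord_tangent_vec: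
  assumes c: "c \<in> charts_at A x" "d \<in> charts_at A x"
  shows "tangent_coord d (tangent_vec A x c v) = trans_deriv c d x v"
  unfolding tangent_coord_def tangent_vec_eq[OF c(1)] using c(2) by (intro the_equality) force+

lemma tangent_coord_self:
  "c \<in> charts_at A x \<Longrightarrow> tangent_coord c (tangent_vec A x c v) = v"
  by (simp add: tangent_coord_tangent_vec trans_deriv_self)

lemma tangent_vec_inj:
  "c \<in> charts_at A x \<Longrightarrow> tangent_vec A x c v = tangent_vec A x c w \<longleftrightarrow> v = w"
  by (metis tangent_coord_self)

lemma tangent_space_eq:
  assumes c: "c \<in> charts_at A x"
  shows "tangent_space A x = range (tangent_vec A x c)"
proof (intro equalityI subsetI)
  fix v assume "v \<in> tangent_space A x"
  then obtain d e where "d \<in> charts_at A x" "v = tangent_vec A x d e" unfolding tangent_space_def by blast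
  then have "v = tangent_vec A x c (trans_deriv d c x e)" using tangent_vec_change c by simp
  then show "v \<in> range (tangent_vec A x c)" by simp
next
  fix v assume "v \<in> range (tangent_vec A x c)"
  then show "v \<in> tangent_space A x" unfolding tangent_space_def using c by blast
qed

lemma tangent_vec_mem: "c \<in> charts_at A x \<Longrightarrow> tangent_vec A x c v \<in> tangent_space A x"
  using tangent_space_eq by blast

lemma tangent_add_vec:
  assumes c: "c \<in> charts_at A x"
  shows "tangent_add (tangent_vec A x c v) (tangent_vec A x c w) = tangent_vec A x c (v + w)"
  unfolding tangent_vec_eq[OF c] tangent_add_def by (auto simp: blinfun.add_right)

lemma tangent_scale_vec:
  assumes c: "c \<in> charts_at A x"
  shows "tangent_scale r (tangent_vec A x c v) = tangent_vec A x c (r *\<^sub>R v)"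
  unfolding tangent_vec_eq[OF c] tangent_scale_def by (auto simp: blinfun.scaleR_right)

lemma chart_operator_vec:
  assumes c: "c \<in> charts_at A x"
  shows "chart_operator A B c k x y T (tangent_vec A x c v) = tangent_vec B y k (blinfun_apply T v)"
  unfolding chart_operator_def using tangent_vec_mem[OF c] tangent_coord_self[OF c] by simp

end

text \<open>Pseudo-Jacobians chosen at different base points represent the same sets
  \<open>Jf z\<close>. This formula turns that equality into a relation between their coordinate
  operators.\<close>

lemma chart_operator_eq_iff:
  fixes T :: "'e::banach \<Rightarrow>\<^sub>L 'f::banach"
  assumes A: "C1_manifold A" and B: "C1_manifold B"
    and c: "c \<in> charts_at A x" "c' \<in> charts_at A x" and k: "k \<in> charts_at B y" "k' \<in> charts_at B y"
    and eq: "chart_operator A B c k x y T = chart_operator A B c' k' x y T'"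
  shows "T' = trans_deriv k k' y o\<^sub>L T o\<^sub>L trans_deriv c' c x"
proof (rule blinfun_eqI)
  fix v
  have "tangent_vec B y k' (T' v) = chart_operator A B c k x y T (tangent_vec A x c' v)"
    unfolding eq chart_operator_vec[OF A c(2)] ..
  also have "tangent_vec A x c' v = tangent_vec A x c (trans_deriv c' c x v)"
    using tangent_vec_change[OF A c(2) c(1)] by simp
  also have "chart_operator A B c k x y T \<dots> = tangent_vec B y k (T (trans_deriv c' c x v))"
    by (rule chart_operator_vec[OF A c(1)])
  also have "\<dots> = tangent_vec B y k' (trans_deriv k k' y (T (trans_deriv c' c x v)))"
    using tangent_vec_change[OF B k] by simp
  finally show "T' v = (trans_deriv k k' y o\<^sub>L T o\<^sub>L trans_deriv c' c x) v"
    using tangent_vec_inj[OF B k(2)] by simp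
qed

lemma tangent_isomorphism_chart_operator:
  fixes T :: "'e::banach \<Rightarrow>\<^sub>L 'f::banach"
  assumes A: "C1_manifold A" and B: "C1_manifold B"
    and c: "c \<in> charts_at A x" and k: "k \<in> charts_at B y"
    and iso: "tangent_isomorphism A B x y (chart_operator A B c k x y T)"
  shows "bij (blinfun_apply T)"
proof -
  let ?C = "chart_operator A B c k x y T"
  have bij: "bij_betw ?C (range (tangent_vec A x c)) (range (tangent_vec B y k))"
    using iso unfolding tangent_isomorphism_def tangent_space_eq[OF A c] tangent_space_eq[OF B k] by blast
  note op = chart_operator_vec[OF A c, of B k y T]
  have "inj (blinfun_apply T)"
  proof (rule injI)
    fix v w assume "T v = T w"
    then have "?C (tangent_vec A x c v) = ?C (tangent_vec A x c w)" by (simp add: op)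
    then have "tangent_vec A x c v = tangent_vec A x c w"
      using bij unfolding bij_betw_def inj_on_def by blast
    then show "v = w" using tangent_vec_inj[OF A c] by simp
  qed
  moreover have "\<exists>v. w = T v" for w
  proof -
    have "tangent_vec B y k w \<in> ?C ` range (tangent_vec A x c)"
      using bij unfolding bij_betw_def by blast
    then obtain v where "tangent_vec B y k w = ?C (tangent_vec A x c v)" by blast
    then show ?thesis unfolding op tangent_vec_inj[OF B k] by blast
  qed
  ultimately show ?thesis unfolding bij_def surj_def by blast
qed


section \<open>Finsler norms and lengths\<close>

definition cnorm ::
    "('x, 'e::real_normed_vector) finsler \<Rightarrow> ('x, 'e) chart \<Rightarrow> 'x \<Rightarrow> 'e \<Rightarrow> real" where
  "cnorm X c x e = fnorm X x (tangent_vec (charts X) x c e)"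

definition speed ::
    "('x, 'e::real_normed_vector) finsler \<Rightarrow> real \<Rightarrow> real \<Rightarrow> (real \<Rightarrow> 'x) \<Rightarrow> real \<Rightarrow> real" where
  "speed X a b \<sigma> t = fnorm X (\<sigma> t) (path_velocity (charts X) a b \<sigma> t)"

lemma equivalent_normD:
  assumes "equivalent_norm n"
  shows "n (v + w) \<le> n v + n w" "n (r *\<^sub>R v) = \<bar>r\<bar> * n v" "0 \<le> n v" "n 0 = 0" "n (v - w) = n (w - v)"
    "n v = 0 \<longleftrightarrow> v = 0" "n (u - w) \<le> n (u - v) + n (v - w)" "n (- v) = n v"
proof -
  have add: "\<And>v w. n (v + w) \<le> n v + n w" and sc: "\<And>r v. n (r *\<^sub>R v) = \<bar>r\<bar> * n v"
    using assms unfolding equivalent_norm_def by blast+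
  obtain a where a: "a > 0" "\<And>v. a * norm v \<le> n v" using assms unfolding equivalent_norm_def by blast
  show "n (v + w) \<le> n v + n w" "n (r *\<^sub>R v) = \<bar>r\<bar> * n v" using add sc by auto
  show nn: "0 \<le> n v" using a(2)[of v] a(1) by (smt (verit) mult_nonneg_nonneg norm_ge_zero)
  show z: "n 0 = 0" using sc[of 0 0] by simp
  show neg: "n (- v) = n v" using sc[of "-1" v] by simp
  show "n (v - w) = n (w - v)" using sc[of "-1" "v - w"] by simp
  show "n v = 0 \<longleftrightarrow> v = 0"
    using z a(2)[of v] a(1) by (metis mult_le_0_iff norm_le_zero_iff not_less)
  show "n (u - w) \<le> n (u - v) + n (v - w)" using add[of "u - v" "v - w"] by simp
qed

lemma C1_pathD:
  assumes "C1_path A a b \<sigma>"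
  shows "continuous_on {a..b} \<sigma>"
    and "c \<in> A \<Longrightarrow> \<exists>D. continuous_on {t \<in> {a..b}. \<sigma> t \<in> fst c} D \<and>
        (\<forall>t\<in>{a..b}. \<sigma> t \<in> fst c \<longrightarrow> ((snd c \<circ> \<sigma>) has_vector_derivative D t) (at t within {a..b}))"
  using assms unfolding C1_path_def by blast+

context
  fixes X :: "('x::t2_space, 'e::banach) finsler"
  assumes X: "finsler_manifold X"
begin

lemma finsler_C1: "C1_manifold (charts X)"
  using X unfolding finsler_manifold_def by blast

lemma cnorm_equivalent: "c \<in> charts_at (charts X) x \<Longrightarrow> equivalent_norm (cnorm X c x)"
  using X unfolding finsler_manifold_def finsler_structure_def cnorm_def by blast

lemma cnorm_change:
  "c \<in> charts_at (charts X) x \<Longrightarrow> d \<in> charts_at (charts X) x \<Longrightarrow>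
    cnorm X d x (trans_deriv c d x v) = cnorm X c x v"
  unfolding cnorm_def using tangent_vec_change[OF finsler_C1] by simp

lemma cnorm_compare:
  assumes c: "c \<in> charts_at (charts X) x0" and \<kappa>: "1 < \<kappa>"
  shows "\<exists>U. open U \<and> x0 \<in> U \<and> U \<subseteq> fst c \<and>
    (\<forall>x\<in>U. \<forall>e. cnorm X c x0 e \<le> \<kappa> * cnorm X c x e \<and> cnorm X c x e \<le> \<kappa> * cnorm X c x0 e)"
proof -
  have "\<forall>\<epsilon>>0. \<exists>U. open U \<and> x0 \<in> U \<and> U \<subseteq> fst c \<and>
      (\<forall>x\<in>U. \<forall>e. 1 / (1 + \<epsilon>) * cnorm X c x0 e \<le> cnorm X c x e \<and>
        cnorm X c x e \<le> (1 + \<epsilon>) * cnorm X c x0 e)"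
    using X c unfolding finsler_manifold_def finsler_structure_def cnorm_def by blast
  from this[rule_format, of "\<kappa> - 1"] obtain U where U: "open U" "x0 \<in> U" "U \<subseteq> fst c"
    "\<And>x e. x \<in> U \<Longrightarrow> 1 / \<kappa> * cnorm X c x0 e \<le> cnorm X c x e"
    "\<And>x e. x \<in> U \<Longrightarrow> cnorm X c x e \<le> \<kappa> * cnorm X c x0 e"
    using \<kappa> by auto
  have "cnorm X c x0 e \<le> \<kappa> * cnorm X c x e" if "x \<in> U" for x e
    using U(4)[OF that, of e] \<kappa> by (simp add: field_simps)
  then show ?thesis using U(1-3,5) by (intro exI[of _ U]) simp
qed

lemma cnorm_continuous:
  assumes c: "c \<in> charts X"
  shows "continuous_on (chart_image c \<times> UNIV) (\<lambda>(p, e). cnorm X c (chart_inv c p) e)"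
proof -
  note A = finsler_C1
  have "open ({z \<in> chart_image c \<times> UNIV. (case z of (p, e) \<Rightarrow> cnorm X c (chart_inv c p) e) \<in> V})"
    if V: "open V" for V
  proof -
    let ?S = "{z \<in> topspace (tangent_bundle_topology (charts X)). (case z of (x, v) \<Rightarrow> fnorm X x v) \<in> V}"
    have "openin (tangent_bundle_topology (charts X)) ?S"
      using X V unfolding finsler_manifold_def finsler_structure_def
      by (auto intro: openin_continuous_map_preimage)
    then have op: "open {(p, e). p \<in> chart_image c \<and>
        (chart_inv c p, tangent_vec (charts X) (chart_inv c p) c e) \<in> ?S}"
      using c unfolding openin_tangent_bundle_topology tangent_bundle_open_def by blast
    \<comment> \<open>The carrier of \<open>tangent_bundle_topology\<close> is the union of its open
      sets; it is the whole bundle because the preimage of the bundle under each trivialisation is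
      an open product.\<close>
    have "tangent_bundle_open (charts X) (tangent_bundle (charts X))"
      unfolding tangent_bundle_open_def
    proof (intro conjI ballI)
      fix d assume d: "d \<in> charts X"
      have "{(p, e). p \<in> chart_image d \<and>
          (chart_inv d p, tangent_vec (charts X) (chart_inv d p) d e) \<in> tangent_bundle (charts X)}
        = chart_image d \<times> UNIV"
        using chart_inv_mem[OF A, of _ d] tangent_vec_mem[OF A, of d] d charts_at_iff[OF A]
        unfolding tangent_bundle_def by fastforce
      then show "open {(p, e). p \<in> chart_image d \<and>
          (chart_inv d p, tangent_vec (charts X) (chart_inv d p) d e) \<in> tangent_bundle (charts X)}"
        using chart_open(2)[OF A d] by (simp add: open_Times)
    qed auto
    then have "tangent_bundle (charts X) \<subseteq> topspace (tangent_bundle_topology (charts X))"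
      by (intro openin_subset) (simp add: openin_tangent_bundle_topology)
    then have "(chart_inv c p, tangent_vec (charts X) (chart_inv c p) c e)
        \<in> topspace (tangent_bundle_topology (charts X))" if "p \<in> chart_image c" for p e
      using chart_inv_mem[OF A that] tangent_vec_mem[OF A] c charts_at_iff[OF A]
      unfolding tangent_bundle_def by blast
    then have "{(p, e). p \<in> chart_image c \<and>
        (chart_inv c p, tangent_vec (charts X) (chart_inv c p) c e) \<in> ?S} =
      {z \<in> chart_image c \<times> UNIV. (case z of (p, e) \<Rightarrow> cnorm X c (chart_inv c p) e) \<in> V}"
      unfolding cnorm_def by auto
    then show ?thesis using op by simp
  qed
  then have "open ((\<lambda>(p, e). cnorm X c (chart_inv c p) e) -` V \<inter> chart_image c \<times> UNIV)" if "open V" for V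
    using that by (simp add: vimage_def Int_def conj_commute)
  then show ?thesis
    using continuous_on_open_vimage[OF open_Times[OF chart_open(2)[OF A c] open_UNIV]] by blast
qed

lemma cnorm_continuous_path:
  assumes c: "c \<in> charts X" and \<sigma>: "continuous_on S \<sigma>" "\<sigma> ` S \<subseteq> fst c" and D: "continuous_on S D"
  shows "continuous_on S (\<lambda>t. cnorm X c (\<sigma> t) (D t))"
proof -
  note A = finsler_C1
  have "continuous_on S (\<lambda>t. (snd c (\<sigma> t), D t))"
    by (intro continuous_intros continuous_on_compose2[OF chart_cont(1)[OF A c] \<sigma>(1)] D \<sigma>(2))
  then have "continuous_on S (\<lambda>t. case (snd c (\<sigma> t), D t) of (p, e) \<Rightarrow> cnorm X c (chart_inv c p) e)"
    using \<sigma>(2) by (intro continuous_on_compose2[OF cnorm_continuous[OF c]]) auto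
  then show ?thesis
    using \<sigma>(2) chart_inv_left[OF A c] by (subst continuous_on_cong[OF refl]) auto
qed

lemma path_velocity_eq:
  assumes \<sigma>: "continuous_on {a..b} \<sigma>" and ab: "a < b" and t: "t \<in> {a..b}"
    and c: "c \<in> charts X" "\<sigma> t \<in> fst c"
    and D: "((snd c \<circ> \<sigma>) has_vector_derivative D) (at t within {a..b})"
  shows "path_velocity (charts X) a b \<sigma> t = tangent_vec (charts X) (\<sigma> t) c D"
proof -
  note A = finsler_C1
  have "vector_derivative (snd d \<circ> \<sigma>) (at t within {a..b}) = trans_deriv c d (\<sigma> t) D"
    if d: "d \<in> charts_at (charts X) (\<sigma> t)" for d
  proof -
    have dA: "d \<in> charts X" "\<sigma> t \<in> fst d" using d charts_at_iff[OF A] by auto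
    have "((snd c \<circ> \<sigma>) has_derivative (\<lambda>s. s *\<^sub>R D)) (at t within {a..b})"
      using D unfolding has_vector_derivative_def .
    moreover have "(chart_transition c d has_derivative blinfun_apply (trans_deriv c d (\<sigma> t)))
        (at ((snd c \<circ> \<sigma>) t))"
      using trans_deriv_C1(1)[OF A c(1) dA(1)] c dA by auto
    ultimately have "(chart_transition c d \<circ> (snd c \<circ> \<sigma>) has_derivative
        blinfun_apply (trans_deriv c d (\<sigma> t)) \<circ> (\<lambda>s. s *\<^sub>R D)) (at t within {a..b})"
      by (intro diff_chain_within) (auto intro: has_derivative_at_withinI)
    then have 1: "(chart_transition c d \<circ> (snd c \<circ> \<sigma>) has_vector_derivative
        trans_deriv c d (\<sigma> t) D) (at t within {a..b})"
      by (simp add: has_vector_derivative_def comp_def blinfun.scaleR_right)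
    \<comment> \<open>Near t, within the interval, the path stays in the domain of \<open>c\<close>,
      where the transition map links the two coordinate expressions.\<close>
    obtain O' where O': "open O'" "O' \<inter> {a..b} = \<sigma> -` fst c \<inter> {a..b}"
      using \<sigma> chart_open(1)[OF A c(1)] unfolding continuous_on_open_invariant by blast
    then have "t \<in> O'" using t c(2) by blast
    then obtain \<delta> where \<delta>: "\<delta> > 0" "ball t \<delta> \<subseteq> O'" using O'(1) open_contains_ball by blast
    have "(snd d \<circ> \<sigma> has_vector_derivative trans_deriv c d (\<sigma> t) D) (at t within {a..b})"
    proof (rule has_vector_derivative_transform_within[OF 1 \<delta>(1) t])
      fix s assume s: "s \<in> {a..b}" "dist s t < \<delta>"
      then have "s \<in> O'" using \<delta>(2) by (auto simp: dist_commute)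
      then have "\<sigma> s \<in> fst c" using s O'(2) by blast
      then show "(chart_transition c d \<circ> (snd c \<circ> \<sigma>)) s = (snd d \<circ> \<sigma>) s"
        using chart_inv_left[OF A c(1)] by (simp add: chart_transition_def)
    qed
    \<comment> \<open>Derivatives within the interval are unique, also at its ends, because
      \<open>a < b\<close>.\<close>
    then show ?thesis
      using vector_derivative_within_cbox[of a b t "snd d \<circ> \<sigma>"] ab t by simp
  qed
  moreover have "c \<in> charts_at (charts X) (\<sigma> t)" using c charts_at_iff[OF A] by auto
  ultimately show ?thesis
    unfolding path_velocity_def tangent_vec_eq[OF A \<open>c \<in> charts_at (charts X) (\<sigma> t)\<close>] by force
qed

lemma speed_eq:
  assumes "continuous_on {a..b} \<sigma>" "a < b" "t \<in> {a..b}" "c \<in> charts X" "\<sigma> t \<in> fst c"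
    and "((snd c \<circ> \<sigma>) has_vector_derivative D) (at t within {a..b})"
  shows "speed X a b \<sigma> t = cnorm X c (\<sigma> t) D"
  unfolding speed_def cnorm_def path_velocity_eq[OF assms] ..

text \<open>Continuity is local in time, so one chart suffices near each t: the times spent in its
  domain form a neighbourhood of t within the interval.\<close>

lemma speed_continuous:
  assumes \<sigma>: "C1_path (charts X) a b \<sigma>" and ab: "a < b"
  shows "continuous_on {a..b} (speed X a b \<sigma>)"
  unfolding continuous_on_eq_continuous_within
proof
  note A = finsler_C1 and cont = C1_pathD(1)[OF \<sigma>]
  fix t assume t: "t \<in> {a..b}"
  obtain c where "c \<in> charts_at (charts X) (\<sigma> t)" using ex_chart_at[OF A] by blast
  then have c: "c \<in> charts X" "\<sigma> t \<in> fst c" using charts_at_iff[OF A] by auto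
  let ?T = "{t \<in> {a..b}. \<sigma> t \<in> fst c}"
  obtain D where D: "continuous_on ?T D"
    "\<And>s. s \<in> ?T \<Longrightarrow> ((snd c \<circ> \<sigma>) has_vector_derivative D s) (at s within {a..b})"
    using C1_pathD(2)[OF \<sigma> c(1)] by blast
  have "continuous_on ?T (\<lambda>s. cnorm X c (\<sigma> s) (D s))"
    by (rule cnorm_continuous_path[OF c(1) continuous_on_subset[OF cont] _ D(1)]) auto
  moreover have "speed X a b \<sigma> s = cnorm X c (\<sigma> s) (D s)" if "s \<in> ?T" for s
    using speed_eq[OF cont ab _ c(1) _ D(2)] that by blast
  ultimately have "continuous_on ?T (speed X a b \<sigma>)" by (metis (no_types, lifting) continuous_on_cong)
  then have 1: "continuous (at t within ?T) (speed X a b \<sigma>)"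
    using t c(2) continuous_on_eq_continuous_within by blast
  obtain O' where O': "open O'" "O' \<inter> {a..b} = \<sigma> -` fst c \<inter> {a..b}"
    using cont chart_open(1)[OF A c(1)] unfolding continuous_on_open_invariant by blast
  have tO: "t \<in> O'" using O'(2) t c(2) by blast
  have "{a..b} \<inter> O' - {t} = ?T \<inter> O' - {t}" using O'(2) by blast
  then have "at t within {a..b} = at t within ?T" by (rule at_within_nhd[OF tO O'(1)])
  then show "continuous (at t within {a..b}) (speed X a b \<sigma>)" using 1 by simp
qed

lemma speed_nonneg:
  assumes \<sigma>: "C1_path (charts X) a b \<sigma>" and ab: "a < b" and t: "t \<in> {a..b}"
  shows "0 \<le> speed X a b \<sigma> t"
proof -
  note A = finsler_C1 and cont = C1_pathD(1)[OF \<sigma>]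
  obtain c where cx: "c \<in> charts_at (charts X) (\<sigma> t)" using ex_chart_at[OF A] by blast
  then have c: "c \<in> charts X" "\<sigma> t \<in> fst c" using charts_at_iff[OF A] by auto
  obtain D where "((snd c \<circ> \<sigma>) has_vector_derivative D) (at t within {a..b})"
    using C1_pathD(2)[OF \<sigma> c(1)] t c(2) by blast
  then show ?thesis
    using speed_eq[OF cont ab t c] equivalent_normD(3)[OF cnorm_equivalent[OF cx]] by simp
qed

lemma speed_integrable:
  "C1_path (charts X) a b \<sigma> \<Longrightarrow> a < b \<Longrightarrow> speed X a b \<sigma> integrable_on {a..b}"
  by (intro integrable_continuous_real speed_continuous)

lemma path_len_speed: "path_len X a b \<sigma> = integral {a..b} (speed X a b \<sigma>)"
  unfolding path_len_def speed_def ..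

lemma path_len_nonneg:
  "C1_path (charts X) a b \<sigma> \<Longrightarrow> a < b \<Longrightarrow> 0 \<le> path_len X a b \<sigma>"
  unfolding path_len_speed using speed_nonneg by (intro integral_nonneg speed_integrable) auto

lemma fdist_le_path_len:
  assumes "C1_path (charts X) a b \<sigma>" "a < b"
  shows "fdist X (\<sigma> a) (\<sigma> b) \<le> path_len X a b \<sigma>"
proof -
  have "bdd_below {path_len X a' b' \<sigma>' | a' b' \<sigma>'.
      a' < b' \<and> C1_path (charts X) a' b' \<sigma>' \<and> \<sigma>' a' = \<sigma> a \<and> \<sigma>' b' = \<sigma> b}"
    using path_len_nonneg by (intro bdd_belowI[of _ 0]) auto
  then show ?thesis unfolding fdist_def using assms by (intro cInf_lower) auto
qed

end

section \<open>Balls for an equivalent norm\<close>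

text \<open>For n the Finsler norm at a fixed point, distances can be compared on such balls with a
  factor \<kappa> close to 1; balls of the model norm would bring in the constants of norm
  equivalence.\<close>

definition nball :: "('e::real_normed_vector \<Rightarrow> real) \<Rightarrow> 'e \<Rightarrow> real \<Rightarrow> 'e set" where
  "nball n p r = {q. n (q - p) < r}"

lemma equivalent_norm_continuous:
  assumes n: "equivalent_norm n"
  shows "continuous_on S n"
proof -
  obtain b where b: "b > 0" "\<And>v. n v \<le> b * norm v" using n unfolding equivalent_norm_def by blast
  have "dist (n v) (n w) \<le> b * dist v w" for v w
    using equivalent_normD(1)[OF n, of "v - w" w] equivalent_normD(1)[OF n, of "w - v" v]
      b(2)[of "v - w"] equivalent_normD(5)[OF n, of v w]
    by (simp add: dist_norm abs_le_iff)
  then have "b-lipschitz_on S n" using b(1) by (intro lipschitz_onI) auto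
  then show ?thesis by (rule lipschitz_on_continuous_on)
qed

lemma nball_open:
  assumes "equivalent_norm n"
  shows "open (nball n p r)"
  unfolding nball_def
  by (intro open_Collect_less continuous_intros continuous_on_compose2[OF equivalent_norm_continuous[OF assms]])
     auto

lemma nball_convex:
  assumes n: "equivalent_norm n"
  shows "convex (nball n p r)"
  unfolding convex_alt nball_def
proof clarify
  fix v w :: 'a and u :: real assume v: "n (v - p) < r" and w: "n (w - p) < r" and u: "0 \<le> u" "u \<le> 1"
  have "n ((1 - u) *\<^sub>R v + u *\<^sub>R w - p) = n ((1 - u) *\<^sub>R (v - p) + u *\<^sub>R (w - p))"
    by (simp add: algebra_simps)
  also have "\<dots> \<le> (1 - u) * n (v - p) + u * n (w - p)"
    using equivalent_normD(1)[OF n, of "(1 - u) *\<^sub>R (v - p)" "u *\<^sub>R (w - p)"] u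
    by (simp add: equivalent_normD(2)[OF n])
  also have "\<dots> < r" by (rule convex_bound_lt[OF v w]) (use u in auto)
  finally show "n ((1 - u) *\<^sub>R v + u *\<^sub>R w - p) < r" .
qed

lemma nball_mono: "r \<le> s \<Longrightarrow> nball n p r \<subseteq> nball n p s"
  unfolding nball_def by auto

lemma nball_center: "equivalent_norm n \<Longrightarrow> 0 < r \<Longrightarrow> p \<in> nball n p r"
  unfolding nball_def by (simp add: equivalent_normD)

lemma nball_small:
  assumes n: "equivalent_norm n" and S: "open S" "p \<in> S"
  shows "\<exists>r>0. nball n p r \<subseteq> S"
proof -
  obtain a where a: "a > 0" "\<And>v. a * norm v \<le> n v" using n unfolding equivalent_norm_def by blast
  obtain e where e: "e > 0" "ball p e \<subseteq> S" using S open_contains_ball by blast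
  have "nball n p (a * e) \<subseteq> ball p e"
  proof
    fix q assume "q \<in> nball n p (a * e)"
    then have "a * norm (q - p) < a * e" using a(2)[of "q - p"] unfolding nball_def by auto
    then show "q \<in> ball p e" using a(1) by (simp add: dist_norm norm_minus_commute)
  qed
  then show ?thesis using a e by (intro exI[of _ "a * e"]) auto
qed

context
  fixes X :: "('x::t2_space, 'e::banach) finsler"
  assumes X: "finsler_manifold X"
begin

lemma chart_segment:
  assumes c: "c \<in> charts X" and P: "convex P" "P \<subseteq> chart_image c" and p: "p \<in> P" "q \<in> P"
  defines "\<sigma> \<equiv> \<lambda>t. chart_inv c (p + t *\<^sub>R (q - p))"
  shows "C1_path (charts X) 0 1 \<sigma>"
    and "t \<in> {0..1} \<Longrightarrow> speed X 0 1 \<sigma> t = cnorm X c (\<sigma> t) (q - p)"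
proof -
  note A = finsler_C1[OF X]
  have mem: "p + t *\<^sub>R (q - p) \<in> P" if "t \<in> {0..1}" for t
    using convexD_alt[OF P(1) p, of t] that by (simp add: algebra_simps)
  have fc: "\<sigma> t \<in> fst c" "snd c (\<sigma> t) = p + t *\<^sub>R (q - p)" if "t \<in> {0..1}" for t
    using mem[OF that] P(2) chart_inv_mem[OF A, of _ c] chart_inv_right[OF A, of _ c]
    unfolding \<sigma>_def by blast+
  have cont: "continuous_on {0..1} \<sigma>"
    unfolding \<sigma>_def
    by (intro continuous_on_compose2[OF chart_cont(2)[OF A c]] continuous_intros) (use mem P(2) in auto)
  have line: "((\<lambda>t. p + t *\<^sub>R (q - p)) has_derivative (\<lambda>s. s *\<^sub>R (q - p))) (at t within {0..1})" for t
    by (auto intro!: derivative_eq_intros)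
  have vd: "((snd d \<circ> \<sigma>) has_vector_derivative trans_deriv c d (\<sigma> t) (q - p)) (at t within {0..1})"
    if d: "d \<in> charts X" "\<sigma> t \<in> fst d" "t \<in> {0..1}" for d t
  proof -
    have "(chart_transition c d has_derivative blinfun_apply (trans_deriv c d (\<sigma> t)))
        (at (p + t *\<^sub>R (q - p)))"
      using trans_deriv_C1(1)[OF A c d(1), of "\<sigma> t"] fc[OF d(3)] d(2) by auto
    then have "(chart_transition c d \<circ> (\<lambda>t. p + t *\<^sub>R (q - p)) has_derivative
        blinfun_apply (trans_deriv c d (\<sigma> t)) \<circ> (\<lambda>s. s *\<^sub>R (q - p))) (at t within {0..1})"
      by (intro diff_chain_within line) (auto intro: has_derivative_at_withinI)
    moreover have "chart_transition c d \<circ> (\<lambda>t. p + t *\<^sub>R (q - p)) = snd d \<circ> \<sigma>"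
      by (simp add: fun_eq_iff chart_transition_def \<sigma>_def)
    ultimately show ?thesis
      by (simp add: has_vector_derivative_def comp_def blinfun.scaleR_right)
  qed
  show "C1_path (charts X) 0 1 \<sigma>"
    unfolding C1_path_def
  proof (intro conjI cont ballI)
    fix d assume d: "d \<in> charts X"
    have "continuous_on {t \<in> {0..1}. \<sigma> t \<in> fst d} (\<lambda>t. trans_deriv c d (\<sigma> t))"
      by (rule continuous_on_compose2[OF trans_deriv_C1(2)[OF A c d] continuous_on_subset[OF cont]])
         (use fc in auto)
    then have "continuous_on {t \<in> {0..1}. \<sigma> t \<in> fst d} (\<lambda>t. trans_deriv c d (\<sigma> t) (q - p))"
      by (intro continuous_intros)
    then show "\<exists>D. continuous_on {t \<in> {0..1}. \<sigma> t \<in> fst d} D \<and>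
        (\<forall>t\<in>{0..1}. \<sigma> t \<in> fst d \<longrightarrow> (snd d \<circ> \<sigma> has_vector_derivative D t) (at t within {0..1}))"
      using vd d by blast
  qed
  assume t: "t \<in> {0..1}"
  have "trans_deriv c c (\<sigma> t) (q - p) = q - p"
    using trans_deriv_self[OF A] charts_at_iff[OF A] c fc[OF t] by blast
  then have "((snd c \<circ> \<sigma>) has_vector_derivative (q - p)) (at t within {0..1})"
    using vd[OF c fc(1)[OF t] t] by simp
  then show "speed X 0 1 \<sigma> t = cnorm X c (\<sigma> t) (q - p)"
    by (intro speed_eq[OF X cont _ t c fc(1)[OF t]]) auto
qed

text \<open>The segment in the chart competes in the infimum that defines the distance, and its
  speed is the norm of the constant vector \<open>q - p\<close> at the moving point.\<close>

lemma fdist_le_chart: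
  assumes c: "c \<in> charts X" and P: "convex P" "P \<subseteq> chart_image c" and p: "p \<in> P" "q \<in> P"
    and K: "\<And>p'. p' \<in> P \<Longrightarrow> cnorm X c (chart_inv c p') (q - p) \<le> K"
  shows "fdist X (chart_inv c p) (chart_inv c q) \<le> K"
proof -
  define \<sigma> where "\<sigma> t = chart_inv c (p + t *\<^sub>R (q - p))" for t
  note seg = chart_segment[OF c P p, folded \<sigma>_def]
  have mem: "p + t *\<^sub>R (q - p) \<in> P" if "t \<in> {0..1}" for t
    using convexD_alt[OF P(1) p, of t] that by (simp add: algebra_simps)
  have "fdist X (\<sigma> 0) (\<sigma> 1) \<le> path_len X 0 1 \<sigma>"
    by (rule fdist_le_path_len[OF X seg(1)]) simp
  also have "\<dots> \<le> integral {0..1} (\<lambda>t::real. K)"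
    unfolding path_len_speed[OF X]
  proof (rule integral_le)
    show "speed X 0 1 \<sigma> integrable_on {0..1}" by (rule speed_integrable[OF X seg(1)]) simp
    fix t :: real assume t: "t \<in> {0..1}"
    show "speed X 0 1 \<sigma> t \<le> K" unfolding seg(2)[OF t] using K[OF mem[OF t]] by (simp add: \<sigma>_def)
  qed (intro integrable_const_ivl)
  finally show ?thesis by (simp add: \<sigma>_def)
qed

text \<open>Mere juxtaposition could leave a corner. Both paths are reparametrised by the cubic
  \<open>s\<close>, which increases from 0 to 1 on the unit interval with zero derivative at both
  ends, so that in every chart the two velocities vanish at the junction \<open>t = 1\<close> and
  match.\<close>

lemma C1_path_concat:
  assumes \<sigma>1: "C1_path (charts X) a1 b1 \<sigma>1" "a1 < b1" and \<sigma>2: "C1_path (charts X) a2 b2 \<sigma>2" "a2 < b2"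
    and meet: "\<sigma>1 b1 = \<sigma>2 a2"
  shows "\<exists>\<tau>. C1_path (charts X) 0 2 \<tau> \<and> \<tau> 0 = \<sigma>1 a1 \<and> \<tau> 2 = \<sigma>2 b2"
proof -
  define s :: "real \<Rightarrow> real" where "s t = t\<^sup>2 * (3 - 2 * t)" for t
  define s' :: "real \<Rightarrow> real" where "s' t = 6 * t * (1 - t)" for t
  have s: "(s has_real_derivative s' t) (at t within S)" for t S
    unfolding s_def s'_def by (auto intro!: derivative_eq_intros simp: power2_eq_square algebra_simps)
  have s_cont: "continuous_on S s'" for S unfolding s'_def by (intro continuous_intros)
  have s01: "s 0 = 0" "s 1 = 1" "s' 0 = 0" "s' 1 = 0" by (auto simp: s_def s'_def)
  have s_range: "s t \<in> {0..1}" if t: "t \<in> {0..1}" for t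
  proof -
    have "1 - s t = (1 - t)\<^sup>2 * (1 + 2 * t)" by (simp add: s_def power2_eq_square algebra_simps)
    also have "\<dots> \<ge> 0" using t by simp
    finally show ?thesis using t by (simp add: s_def)
  qed
  define \<phi>1 where "\<phi>1 t = a1 + (b1 - a1) * s t" for t
  define \<phi>2 where "\<phi>2 t = a2 + (b2 - a2) * s (t - 1)" for t
  have \<phi>1: "\<phi>1 t \<in> {a1..b1}" if "t \<in> {0..1}" for t
  proof -
    have "0 \<le> s t" "s t \<le> 1" using s_range[OF that] by auto
    then have "(b1 - a1) * s t \<le> b1 - a1" "0 \<le> (b1 - a1) * s t"
      using \<sigma>1(2) by (auto intro!: mult_left_le)
    then show ?thesis by (simp add: \<phi>1_def)
  qed
  have \<phi>2: "\<phi>2 t \<in> {a2..b2}" if "t \<in> {1..2}" for t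
  proof -
    have "0 \<le> s (t - 1)" "s (t - 1) \<le> 1" using s_range[of "t - 1"] that by auto
    then have "(b2 - a2) * s (t - 1) \<le> b2 - a2" "0 \<le> (b2 - a2) * s (t - 1)"
      using \<sigma>2(2) by (auto intro!: mult_left_le)
    then show ?thesis by (simp add: \<phi>2_def)
  qed
  have d\<phi>1: "(\<phi>1 has_vector_derivative (b1 - a1) * s' t) (at t within S)" for t S
    unfolding \<phi>1_def has_real_derivative_iff_has_vector_derivative[symmetric]
    by (rule DERIV_cong[OF DERIV_add[OF DERIV_const DERIV_cmult[OF s]]]) simp
  have ds: "((\<lambda>t. s (t - 1)) has_real_derivative s' (t - 1)) (at t within S)" for t S
    by (rule DERIV_cong[OF DERIV_chain2[OF s DERIV_diff[OF DERIV_ident DERIV_const]]]) simp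
  have d\<phi>2: "(\<phi>2 has_vector_derivative (b2 - a2) * s' (t - 1)) (at t within S)" for t S
    unfolding \<phi>2_def has_real_derivative_iff_has_vector_derivative[symmetric]
    by (rule DERIV_cong[OF DERIV_add[OF DERIV_const DERIV_cmult[OF ds]]]) simp
  have c\<phi>1: "continuous_on S \<phi>1" and c\<phi>2: "continuous_on S \<phi>2" for S
    unfolding \<phi>1_def \<phi>2_def s_def by (intro continuous_intros)+
  define \<tau> where "\<tau> t = (if t \<in> {0..1} then \<sigma>1 (\<phi>1 t) else \<sigma>2 (\<phi>2 t))" for t
  have \<phi>_ends: "\<phi>1 0 = a1" "\<phi>1 1 = b1" "\<phi>2 1 = a2" "\<phi>2 2 = b2" by (auto simp: \<phi>1_def \<phi>2_def s01)
  have \<tau>1: "\<tau> t = \<sigma>1 (\<phi>1 t)" if "t \<in> {0..1}" for t using that by (simp add: \<tau>_def)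
  have \<tau>2: "\<tau> t = \<sigma>2 (\<phi>2 t)" if "t \<in> {1..2}" for t
    using that meet \<phi>_ends by (cases "t = 1") (auto simp: \<tau>_def)
  have union: "{0..2::real} = {0..1} \<union> {1..2}" by auto
  have cont1: "continuous_on {0..1} (\<lambda>t. \<sigma>1 (\<phi>1 t))"
    by (rule continuous_on_compose2[OF C1_pathD(1)[OF \<sigma>1(1)] c\<phi>1]) (use \<phi>1 in auto)
  have cont2: "continuous_on {1..2} (\<lambda>t. \<sigma>2 (\<phi>2 t))"
    by (rule continuous_on_compose2[OF C1_pathD(1)[OF \<sigma>2(1)] c\<phi>2]) (use \<phi>2 in auto)
  have "continuous_on {0..2} \<tau>"
    unfolding union
  proof (rule continuous_on_closed_Un)
    show "continuous_on {0..1} \<tau>" using cont1 \<tau>1 by (metis (no_types, lifting) continuous_on_cong)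
    show "continuous_on {1..2} \<tau>" using cont2 \<tau>2 by (metis (no_types, lifting) continuous_on_cong)
  qed auto
  moreover have "\<exists>D. continuous_on {t \<in> {0..2}. \<tau> t \<in> fst c} D \<and>
      (\<forall>t\<in>{0..2}. \<tau> t \<in> fst c \<longrightarrow> ((snd c \<circ> \<tau>) has_vector_derivative D t) (at t within {0..2}))"
    if c: "c \<in> charts X" for c
  proof -
    obtain D1 where D1: "continuous_on {t \<in> {a1..b1}. \<sigma>1 t \<in> fst c} D1"
      "\<And>t. t \<in> {a1..b1} \<Longrightarrow> \<sigma>1 t \<in> fst c \<Longrightarrow> ((snd c \<circ> \<sigma>1) has_vector_derivative D1 t) (at t within {a1..b1})"
      using C1_pathD(2)[OF \<sigma>1(1) c] by blast
    obtain D2 where D2: "continuous_on {t \<in> {a2..b2}. \<sigma>2 t \<in> fst c} D2"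
      "\<And>t. t \<in> {a2..b2} \<Longrightarrow> \<sigma>2 t \<in> fst c \<Longrightarrow> ((snd c \<circ> \<sigma>2) has_vector_derivative D2 t) (at t within {a2..b2})"
      using C1_pathD(2)[OF \<sigma>2(1) c] by blast
    define E1 where "E1 t = ((b1 - a1) * s' t) *\<^sub>R D1 (\<phi>1 t)" for t
    define E2 where "E2 t = ((b2 - a2) * s' (t - 1)) *\<^sub>R D2 (\<phi>2 t)" for t
    have E0: "E1 1 = 0" "E2 1 = 0" by (auto simp: E1_def E2_def s01)
    define D where "D t = (if t \<in> {0..1} then E1 t else E2 t)" for t
    let ?S = "{t \<in> {0..1}. \<tau> t \<in> fst c}" and ?T = "{t \<in> {1..2}. \<tau> t \<in> fst c}"
    have un: "{t \<in> {0..2}. \<tau> t \<in> fst c} = ?S \<union> ?T" by auto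
    have DE1: "D t = E1 t" if "t \<in> ?S" for t using that by (simp add: D_def)
    have DE2: "D t = E2 t" if "t \<in> ?T" for t using that E0 by (cases "t = 1") (auto simp: D_def)
    have "continuous_on ?S E1"
      unfolding E1_def
      by (intro continuous_intros s_cont continuous_on_compose2[OF D1(1) c\<phi>1]) (use \<phi>1 \<tau>1 in auto)
    then have S: "continuous_on ?S D" using DE1 by (metis (no_types, lifting) continuous_on_cong)
    have "continuous_on ?T E2"
      unfolding E2_def
      by (intro continuous_intros continuous_on_compose2[OF s_cont] continuous_on_compose2[OF D2(1) c\<phi>2])
         (use \<phi>2 \<tau>2 in auto)
    then have T: "continuous_on ?T D" using DE2 by (metis (no_types, lifting) continuous_on_cong)
    have "closedin (top_of_set (?S \<union> ?T)) ((?S \<union> ?T) \<inter> {0..1})"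
      "closedin (top_of_set (?S \<union> ?T)) ((?S \<union> ?T) \<inter> {1..2})"
      by (intro closedin_closed_Int closed_atLeastAtMost)+
    moreover have "(?S \<union> ?T) \<inter> {0..1} = ?S" "(?S \<union> ?T) \<inter> {1..2} = ?T" by auto
    ultimately have "continuous_on (?S \<union> ?T) D"
      using S T by (intro continuous_on_Un_local) auto
    moreover have "((snd c \<circ> \<tau>) has_vector_derivative D t) (at t within {0..2})"
      if t: "t \<in> {0..2}" "\<tau> t \<in> fst c" for t
    proof -
      have 1: "((\<lambda>t. (snd c \<circ> \<sigma>1) (\<phi>1 t)) has_vector_derivative E1 t) (at t within {0..1})"
        if t1: "t \<in> {0..1}"
      proof -
        have "\<sigma>1 (\<phi>1 t) \<in> fst c" using t(2) \<tau>1[OF t1] by simp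
        then have "((snd c \<circ> \<sigma>1) has_vector_derivative D1 (\<phi>1 t)) (at (\<phi>1 t) within \<phi>1 ` {0..1})"
          using D1(2)[OF \<phi>1[OF t1]] \<phi>1 by (blast intro: has_vector_derivative_within_subset)
        from vector_diff_chain_within[OF d\<phi>1 this] show ?thesis by (simp add: E1_def comp_def)
      qed
      have 2: "((\<lambda>t. (snd c \<circ> \<sigma>2) (\<phi>2 t)) has_vector_derivative E2 t) (at t within {1..2})"
        if t1: "t \<in> {1..2}"
      proof -
        have "\<sigma>2 (\<phi>2 t) \<in> fst c" using t(2) \<tau>2[OF t1] by simp
        then have "((snd c \<circ> \<sigma>2) has_vector_derivative D2 (\<phi>2 t)) (at (\<phi>2 t) within \<phi>2 ` {1..2})"
          using D2(2)[OF \<phi>2[OF t1]] \<phi>2 by (blast intro: has_vector_derivative_within_subset)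
        from vector_diff_chain_within[OF d\<phi>2 this] show ?thesis by (simp add: E2_def comp_def)
      qed
      have i: "{0..1} \<union> ({0..1} \<inter> {1..2}) = {0..1::real}" "{1..2} \<union> ({0..1} \<inter> {1..2}) = {1..2::real}"
        by auto
      have "((\<lambda>t. if t \<in> {0..1} then (snd c \<circ> \<sigma>1) (\<phi>1 t) else (snd c \<circ> \<sigma>2) (\<phi>2 t))
          has_vector_derivative (if t \<in> {0..1} then E1 t else E2 t)) (at t within {0..2})"
      proof (rule has_vector_derivative_If_within_closures)
        have eq1: "t = 1" if "t \<in> {0..1}" "t \<in> {1..2}" using that by auto
        show "t \<in> {0..1} \<union> {1..2}" using t(1) by auto
        show "t \<in> closure {0..1} \<Longrightarrow> t \<in> closure {1..2} \<Longrightarrow> (snd c \<circ> \<sigma>1) (\<phi>1 t) = (snd c \<circ> \<sigma>2) (\<phi>2 t)"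
          using eq1 \<phi>_ends meet by auto
        show "t \<in> closure {0..1} \<Longrightarrow> t \<in> closure {1..2} \<Longrightarrow> E1 t = E2 t"
          using eq1 E0 by auto
        have cl: "closure {0..1::real} = {0..1}" "closure {1..2::real} = {1..2}" by auto
        show "t \<in> {0..1} \<union> (closure {0..1} \<inter> closure {1..2}) \<Longrightarrow>
            ((\<lambda>t. (snd c \<circ> \<sigma>1) (\<phi>1 t)) has_vector_derivative E1 t)
              (at t within {0..1} \<union> (closure {0..1} \<inter> closure {1..2}))"
          unfolding cl i by (rule 1)
        show "t \<in> {1..2} \<union> (closure {0..1} \<inter> closure {1..2}) \<Longrightarrow>
            ((\<lambda>t. (snd c \<circ> \<sigma>2) (\<phi>2 t)) has_vector_derivative E2 t)
              (at t within {1..2} \<union> (closure {0..1} \<inter> closure {1..2}))"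
          unfolding cl i by (rule 2)
      qed (rule union)
      moreover have "(snd c \<circ> \<tau>) = (\<lambda>t. if t \<in> {0..1} then (snd c \<circ> \<sigma>1) (\<phi>1 t) else (snd c \<circ> \<sigma>2) (\<phi>2 t))"
        by (auto simp: \<tau>_def fun_eq_iff)
      ultimately show ?thesis unfolding D_def by simp
    qed
    ultimately show ?thesis unfolding un by blast
  qed
  ultimately have "C1_path (charts X) 0 2 \<tau>" unfolding C1_path_def by blast
  moreover have "\<tau> 0 = \<sigma>1 a1" "\<tau> 2 = \<sigma>2 b2" using \<tau>1[of 0] \<tau>2[of 2] \<phi>_ends by auto
  ultimately show ?thesis by blast
qed

text \<open>The points reachable from u form an open set with open complement, since chart segments
  join any two points near a given one; connectedness does the rest. Without a joining path the
  infimum in \<open>fdist\<close> would be taken over the empty set and say nothing about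
  lengths.\<close>

lemma C1_path_connected: "\<exists>a b \<sigma>. a < b \<and> C1_path (charts X) a b \<sigma> \<and> \<sigma> a = u \<and> \<sigma> b = v"
proof -
  note A = finsler_C1[OF X]
  define R where "R = {v. \<exists>a b \<sigma>. a < b \<and> C1_path (charts X) a b \<sigma> \<and> \<sigma> a = u \<and> \<sigma> b = v}"
  have nbhd: "\<exists>W. open W \<and> z \<in> W \<and> (\<forall>v\<in>W. \<forall>w\<in>W. \<exists>\<sigma>. C1_path (charts X) 0 1 \<sigma> \<and> \<sigma> 0 = v \<and> \<sigma> 1 = w)" for z
  proof -
    obtain c where cz: "c \<in> charts_at (charts X) z" using ex_chart_at[OF A] by blast
    then have c: "c \<in> charts X" "z \<in> fst c" using charts_at_iff[OF A] by auto
    obtain r where r: "r > 0" "ball (snd c z) r \<subseteq> chart_image c"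
      using chart_open(2)[OF A c(1)] c(2) open_contains_ball by blast
    let ?W = "chart_inv c ` ball (snd c z) r"
    have "\<exists>\<sigma>. C1_path (charts X) 0 1 \<sigma> \<and> \<sigma> 0 = v \<and> \<sigma> 1 = w" if vw: "v \<in> ?W" "w \<in> ?W" for v w
    proof -
      obtain p q where p: "p \<in> ball (snd c z) r" "v = chart_inv c p"
        and q: "q \<in> ball (snd c z) r" "w = chart_inv c q" using vw by blast
      show ?thesis
        using chart_segment(1)[OF c(1) convex_ball r(2) p(1) q(1)] p(2) q(2)
        by (intro exI[of _ "\<lambda>t. chart_inv c (p + t *\<^sub>R (q - p))"]) simp
    qed
    moreover have "open ?W" by (rule chart_inv_open[OF A c(1) open_ball r(2)])
    moreover have "z \<in> ?W" using r(1) chart_inv_left[OF A c] by (metis centre_in_ball imageI)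
    ultimately show ?thesis by blast
  qed
  have ext: "w \<in> R" if v: "v \<in> R" and \<sigma>: "C1_path (charts X) 0 1 \<sigma>" "\<sigma> 0 = v" "\<sigma> 1 = w" for v w \<sigma>
  proof -
    obtain a b \<sigma>' where \<sigma>': "a < b" "C1_path (charts X) a b \<sigma>'" "\<sigma>' a = u" "\<sigma>' b = v"
      using v unfolding R_def by blast
    then obtain \<tau> where "C1_path (charts X) 0 2 \<tau>" "\<tau> 0 = u" "\<tau> 2 = w"
      using C1_path_concat[OF \<sigma>'(2,1) \<sigma>(1)] \<sigma>(2,3) by auto
    then show ?thesis unfolding R_def by (intro CollectI exI[of _ 0] exI[of _ 2] exI[of _ \<tau>]) simp
  qed
  have "open R"
  proof (subst open_subopen, intro ballI)
    fix z assume z: "z \<in> R"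
    obtain W where W: "open W" "z \<in> W"
      "\<forall>v\<in>W. \<forall>w\<in>W. \<exists>\<sigma>. C1_path (charts X) 0 1 \<sigma> \<and> \<sigma> 0 = v \<and> \<sigma> 1 = w" using nbhd by blast
    have "W \<subseteq> R"
    proof
      fix w assume "w \<in> W"
      then obtain \<sigma> where "C1_path (charts X) 0 1 \<sigma>" "\<sigma> 0 = z" "\<sigma> 1 = w" using W by meson
      then show "w \<in> R" by (rule ext[OF z])
    qed
    then show "\<exists>T. open T \<and> z \<in> T \<and> T \<subseteq> R" using W by blast
  qed
  moreover have "open (- R)"
  proof (subst open_subopen, intro ballI)
    fix z assume z: "z \<in> - R"
    obtain W where W: "open W" "z \<in> W"
      "\<forall>v\<in>W. \<forall>w\<in>W. \<exists>\<sigma>. C1_path (charts X) 0 1 \<sigma> \<and> \<sigma> 0 = v \<and> \<sigma> 1 = w" using nbhd by blast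
    have "W \<subseteq> - R"
    proof
      fix w assume "w \<in> W"
      then obtain \<sigma> where \<sigma>: "C1_path (charts X) 0 1 \<sigma>" "\<sigma> 0 = w" "\<sigma> 1 = z" using W by meson
      show "w \<in> - R" using ext[OF _ \<sigma>] z by blast
    qed
    then show "\<exists>T. open T \<and> z \<in> T \<and> T \<subseteq> - R" using W by blast
  qed
  moreover have "u \<in> R"
  proof -
    obtain W where W: "u \<in> W"
      "\<forall>v\<in>W. \<forall>w\<in>W. \<exists>\<sigma>. C1_path (charts X) 0 1 \<sigma> \<and> \<sigma> 0 = v \<and> \<sigma> 1 = w" using nbhd by blast
    then obtain \<sigma> where "C1_path (charts X) 0 1 \<sigma>" "\<sigma> 0 = u" "\<sigma> 1 = u" by blast
    then show ?thesis unfolding R_def by (intro CollectI exI[of _ 0] exI[of _ 1] exI[of _ \<sigma>]) simp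
  qed
  moreover have "connected (UNIV :: 'x set)" using X unfolding finsler_manifold_def by blast
  ultimately have "R = UNIV" using connectedD[of UNIV R "- R"] by blast
  then show ?thesis unfolding R_def by blast
qed

lemma fdist_less_path:
  assumes "fdist X u v < r"
  obtains a b \<sigma> where "a < b" "C1_path (charts X) a b \<sigma>" "\<sigma> a = u" "\<sigma> b = v" "path_len X a b \<sigma> < r"
proof -
  let ?L = "{path_len X a b \<sigma> | a b \<sigma>. a < b \<and> C1_path (charts X) a b \<sigma> \<and> \<sigma> a = u \<and> \<sigma> b = v}"
  have "?L \<noteq> {}" using C1_path_connected by blast
  then obtain l where l: "l \<in> ?L" "l < r"
    using cInf_lessD[of ?L r] assms unfolding fdist_def by blast
  from l(1) obtain a b \<sigma> where "l = path_len X a b \<sigma>" "a < b" "C1_path (charts X) a b \<sigma>"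
    "\<sigma> a = u" "\<sigma> b = v" by blast
  then show ?thesis using that l(2) by blast
qed

lemma fdist_nonneg: "0 \<le> fdist X u v"
proof (rule ccontr)
  assume "\<not> 0 \<le> fdist X u v"
  then have "fdist X u v < 0" by simp
  then obtain a b \<sigma> where "a < b" "C1_path (charts X) a b \<sigma>" "path_len X a b \<sigma> < 0"
    by (rule fdist_less_path)
  then show False using path_len_nonneg[OF X] by force
qed

end


section \<open>The Finsler distance in charts\<close>

context
  fixes X :: "('x::t2_space, 'e::banach) finsler"
  assumes X: "finsler_manifold X"
begin

text \<open>A norming functional of the coordinate increment reduces the claim to the fundamental
  theorem of calculus for a real function, whose derivative is at most n of the coordinate velocity
  and hence at most \<kappa> times the speed.\<close>

lemma chart_norm_le_length:
  assumes \<sigma>: "C1_path (charts X) a b \<sigma>" "a < b" and c: "c \<in> charts X" and n: "equivalent_norm n"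
    and \<kappa>: "0 < \<kappa>" and s: "a \<le> s'" "s' \<le> s" "s \<le> b"
    and V: "\<And>t. t \<in> {s'..s} \<Longrightarrow> \<sigma> t \<in> fst c \<and> (\<forall>e. n e \<le> \<kappa> * cnorm X c (\<sigma> t) e)"
  shows "n (snd c (\<sigma> s) - snd c (\<sigma> s')) \<le> \<kappa> * integral {s'..s} (speed X a b \<sigma>)"
proof -
  let ?w = "snd c (\<sigma> s) - snd c (\<sigma> s')"
  obtain l :: "'e \<Rightarrow>\<^sub>L real" where l: "\<And>v. \<bar>l v\<bar> \<le> n v" "n ?w \<le> l ?w"
    using mazur_orlicz_blinfun[OF n convex_singleton[of ?w], of "n ?w"] by blast
  obtain D where D: "\<And>t. t \<in> {a..b} \<Longrightarrow> \<sigma> t \<in> fst c \<Longrightarrow>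
      ((snd c \<circ> \<sigma>) has_vector_derivative D t) (at t within {a..b})"
    using C1_pathD(2)[OF \<sigma>(1) c] by blast
  have sub: "{s'..s} \<subseteq> {a..b}" using s by auto
  have "((\<lambda>t. l (D t)) has_integral l (snd c (\<sigma> s)) - l (snd c (\<sigma> s'))) {s'..s}"
  proof (rule fundamental_theorem_of_calculus[OF s(2)])
    fix t assume t: "t \<in> {s'..s}"
    have "((snd c \<circ> \<sigma>) has_vector_derivative D t) (at t within {s'..s})"
      using D[of t] V[OF t] t sub has_vector_derivative_within_subset by blast
    then show "((\<lambda>t. l (snd c (\<sigma> t))) has_vector_derivative l (D t)) (at t within {s'..s})"
      using bounded_linear.has_vector_derivative[OF blinfun.bounded_linear_right[of l]]
      by (simp add: comp_def)
  qed
  moreover have "((\<lambda>t. \<kappa> * speed X a b \<sigma> t) has_integral \<kappa> * integral {s'..s} (speed X a b \<sigma>)) {s'..s}"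
    using integrable_on_subinterval[OF speed_integrable[OF X \<sigma>] sub]
    by (intro has_integral_mult_right integrable_integral)
  moreover have "l (D t) \<le> \<kappa> * speed X a b \<sigma> t" if t: "t \<in> {s'..s}" for t
  proof -
    have tab: "t \<in> {a..b}" using t sub by blast
    have "speed X a b \<sigma> t = cnorm X c (\<sigma> t) (D t)"
      using speed_eq[OF X C1_pathD(1)[OF \<sigma>(1)] \<sigma>(2) tab c _ D[OF tab]] V[OF t] by blast
    moreover have "n (D t) \<le> \<kappa> * cnorm X c (\<sigma> t) (D t)" using V[OF t] by blast
    moreover have "l (D t) \<le> n (D t)" using l(1)[of "D t"] by linarith
    ultimately show ?thesis by (metis order_trans)
  qed
  ultimately have "l (snd c (\<sigma> s)) - l (snd c (\<sigma> s')) \<le> \<kappa> * integral {s'..s} (speed X a b \<sigma>)"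
    by (rule has_integral_le)
  then show ?thesis using l(2) by (simp add: blinfun.diff_right)
qed

text \<open>
  A path cannot leave the chart ball of radius \<open>3 \<rho>\<close> with too small a length: up to the first exit
  time its coordinates form a Cauchy family, whose limit lies in the ball by completeness of the
  model space and is the exit point because the manifold is Hausdorff.
\<close>

lemma short_path_stays:
  assumes \<sigma>: "C1_path (charts X) a b \<sigma>" "a < b" and c: "c \<in> charts X" and n: "equivalent_norm n"
    and \<kappa>: "0 < \<kappa>" and B: "nball n p0 (3 * \<rho>) \<subseteq> chart_image c"
    and comp: "\<And>p e. p \<in> nball n p0 (3 * \<rho>) \<Longrightarrow> n e \<le> \<kappa> * cnorm X c (chart_inv c p) e"
    and start: "\<sigma> a \<in> fst c" "snd c (\<sigma> a) \<in> nball n p0 \<rho>"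
    and len: "\<kappa> * path_len X a b \<sigma> < 2 * \<rho>"
  shows "\<sigma> b \<in> fst c" and "snd c (\<sigma> b) \<in> nball n p0 (3 * \<rho>)"
    and "n (snd c (\<sigma> b) - snd c (\<sigma> a)) \<le> \<kappa> * path_len X a b \<sigma>"
proof -
  note A = finsler_C1[OF X]
  note cont = C1_pathD(1)[OF \<sigma>(1)] and int = speed_integrable[OF X \<sigma>]
  define V where "V = chart_inv c ` nball n p0 (3 * \<rho>)"
  define I where "I t = integral {a..t} (speed X a b \<sigma>)" for t
  have Vopen: "open V" unfolding V_def by (rule chart_inv_open[OF A c nball_open[OF n] B])
  have VD: "z \<in> fst c" "snd c z \<in> nball n p0 (3 * \<rho>)" "\<And>e. n e \<le> \<kappa> * cnorm X c z e" if z: "z \<in> V" for z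
  proof -
    obtain p where p: "p \<in> nball n p0 (3 * \<rho>)" "z = chart_inv c p" using z V_def by blast
    then have "p \<in> chart_image c" using B by blast
    then show "z \<in> fst c" "snd c z \<in> nball n p0 (3 * \<rho>)"
      using chart_inv_mem[OF A, of p c] chart_inv_right[OF A, of p c] p by auto
    show "n e \<le> \<kappa> * cnorm X c z e" for e using comp[OF p(1)] p(2) by simp
  qed
  have "0 < \<rho>"
    using start(2) equivalent_normD(3)[OF n, of "snd c (\<sigma> a) - p0"] unfolding nball_def by simp
  then have "snd c (\<sigma> a) \<in> nball n p0 (3 * \<rho>)" using start(2) nball_mono[of \<rho> "3 * \<rho>" n p0] by auto
  then have "chart_inv c (snd c (\<sigma> a)) \<in> V" unfolding V_def by blast
  then have aV: "\<sigma> a \<in> V" using chart_inv_left[OF A c start(1)] by simp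
  have I_diff: "integral {s'..s} (speed X a b \<sigma>) = I s - I s'" if "a \<le> s'" "s' \<le> s" "s \<le> b" for s s'
    using Henstock_Kurzweil_Integration.integral_combine[OF that(1,2) integrable_on_subinterval[OF int]] that
    unfolding I_def by fastforce
  have I_mono: "I s' \<le> I s" if s: "a \<le> s'" "s' \<le> s" "s \<le> b" for s s'
  proof -
    have "0 \<le> integral {s'..s} (speed X a b \<sigma>)"
      using s speed_nonneg[OF X \<sigma>] integrable_on_subinterval[OF int]
      by (intro integral_nonneg) auto
    then show ?thesis using I_diff[OF s] by simp
  qed
  have Ib: "I b = path_len X a b \<sigma>" unfolding I_def path_len_speed[OF X] ..
  have Ia: "I a = 0" unfolding I_def by simp
  have est: "n (snd c (\<sigma> s) - snd c (\<sigma> s')) \<le> \<kappa> * (I s - I s')"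
    if s: "a \<le> s'" "s' \<le> s" "s \<le> b" and inV: "\<And>t. t \<in> {s'..s} \<Longrightarrow> \<sigma> t \<in> V" for s s'
    using chart_norm_le_length[OF \<sigma> c n \<kappa> s] VD inV I_diff[OF s] by auto
  have all: "\<sigma> t \<in> V" if t: "t \<in> {a..b}" for t
  proof (rule ccontr)
    assume tV: "\<sigma> t \<notin> V"
    define S where "S = {t \<in> {a..b}. \<sigma> t \<notin> V}"
    obtain O' where O': "open O'" "O' \<inter> {a..b} = \<sigma> -` V \<inter> {a..b}"
      using cont Vopen unfolding continuous_on_open_invariant by blast
    have "S = {a..b} - O'" using O'(2) unfolding S_def by blast
    then have Sc: "closed S" using O'(1) by (simp add: closed_Diff)
    have tS: "t \<in> S" using t tV S_def by simp
    have bdd: "bdd_below S" unfolding S_def by (rule bdd_belowI[of _ a]) auto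
    define t1 where "t1 = Inf S"
    have t1: "t1 \<in> S" unfolding t1_def using closed_contains_Inf[OF _ bdd Sc] tS by blast
    then have t1': "a \<le> t1" "t1 \<le> b" "\<sigma> t1 \<notin> V" unfolding S_def by auto
    have "t1 \<noteq> a" using t1'(3) aV by auto
    then have t1a: "a < t1" using t1'(1) by simp
    have before: "\<sigma> s \<in> V" if s: "a \<le> s" "s < t1" for s
    proof (rule ccontr)
      assume "\<sigma> s \<notin> V"
      then have "s \<in> S" using s t1' unfolding S_def by simp
      then have "t1 \<le> s" unfolding t1_def using bdd by (rule cInf_lower)
      then show False using s by simp
    qed
    \<comment> \<open>Times increasing to the first exit time \<open>t1\<close>, all in the part of
      the path that is still in V.\<close>
    define \<tau> where "\<tau> k = t1 - (t1 - a) / real (Suc k)" for k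
    have \<tau>: "a \<le> \<tau> k" "\<tau> k < t1" "\<tau> k \<le> b" for k
    proof -
      define x where "x = (t1 - a) / real (Suc k)"
      have "x \<le> (t1 - a) / 1" unfolding x_def using t1a by (intro divide_left_mono) auto
      moreover have "x > 0" using t1a by (simp add: x_def)
      moreover have "\<tau> k = t1 - x" by (simp add: \<tau>_def x_def)
      ultimately show "a \<le> \<tau> k" "\<tau> k < t1" "\<tau> k \<le> b" using t1'(2) by auto
    qed
    have \<tau>lim: "\<tau> \<longlonglongrightarrow> t1"
    proof -
      have "(\<lambda>k. t1 - (t1 - a) / real (Suc k)) \<longlonglongrightarrow> t1 - 0"
        by (intro tendsto_diff tendsto_const LIMSEQ_Suc[OF lim_const_over_n])
      then show ?thesis unfolding \<tau>_def by simp
    qed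
    have "continuous_on {a..b} I" unfolding I_def by (rule indefinite_integral_continuous_1[OF int])
    then have "(\<lambda>k. I (\<tau> k)) \<longlonglongrightarrow> I t1"
      using \<tau>lim \<tau> t1' by (intro continuous_on_tendsto_compose[of "{a..b}" I \<tau> t1]) auto
    then have IC: "Cauchy (\<lambda>k. I (\<tau> k))" by (rule LIMSEQ_imp_Cauchy)
    obtain \<alpha> where \<alpha>: "\<alpha> > 0" "\<And>v. \<alpha> * norm v \<le> n v" using n unfolding equivalent_norm_def by blast
    obtain \<beta> where \<beta>: "\<beta> > 0" "\<And>v. n v \<le> \<beta> * norm v" using n unfolding equivalent_norm_def by blast
    define \<gamma> where "\<gamma> k = snd c (\<sigma> (\<tau> k))" for k
    have "\<alpha> * dist (\<gamma> j) (\<gamma> k) \<le> \<kappa> * dist (I (\<tau> j)) (I (\<tau> k))" for j k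
    proof -
      have le: "\<alpha> * dist (\<gamma> j) (\<gamma> k) \<le> \<kappa> * dist (I (\<tau> j)) (I (\<tau> k))" if jk: "\<tau> k \<le> \<tau> j" for j k
      proof -
        have "n (\<gamma> j - \<gamma> k) \<le> \<kappa> * (I (\<tau> j) - I (\<tau> k))"
          unfolding \<gamma>_def
        proof (rule est[OF \<tau>(1) jk \<tau>(3)])
          fix s assume "s \<in> {\<tau> k..\<tau> j}"
          then show "\<sigma> s \<in> V" using before[of s] \<tau>[of k] \<tau>[of j] by auto
        qed
        also have "\<dots> \<le> \<kappa> * dist (I (\<tau> j)) (I (\<tau> k))" using \<kappa> by (simp add: dist_real_def)
        finally show ?thesis using \<alpha>(2)[of "\<gamma> j - \<gamma> k"] by (simp add: dist_norm)
      qed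
      show ?thesis
        using le[of k j] le[of j k] by (cases "\<tau> k \<le> \<tau> j") (auto simp: dist_commute)
    qed
    then have \<gamma>d: "dist (\<gamma> j) (\<gamma> k) \<le> \<kappa> / \<alpha> * dist (I (\<tau> j)) (I (\<tau> k))" for j k
      using \<alpha>(1) by (simp add: field_simps)
    have "Cauchy \<gamma>"
    proof (rule metric_CauchyI)
      fix e :: real assume "e > 0"
      then have "e * \<alpha> / \<kappa> > 0" using \<alpha> \<kappa> by simp
      then obtain M where M: "\<And>j k. j \<ge> M \<Longrightarrow> k \<ge> M \<Longrightarrow> dist (I (\<tau> j)) (I (\<tau> k)) < e * \<alpha> / \<kappa>"
        using metric_CauchyD[OF IC] by blast
      have "dist (\<gamma> j) (\<gamma> k) < e" if "j \<ge> M" "k \<ge> M" for j k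
      proof -
        have "\<kappa> / \<alpha> * dist (I (\<tau> j)) (I (\<tau> k)) < \<kappa> / \<alpha> * (e * \<alpha> / \<kappa>)"
          using M[OF that] \<alpha> \<kappa> by (intro mult_strict_left_mono) auto
        also have "\<dots> = e" using \<alpha> \<kappa> by simp
        finally show ?thesis using \<gamma>d[of j k] by simp
      qed
      then show "\<exists>M. \<forall>m\<ge>M. \<forall>n\<ge>M. dist (\<gamma> m) (\<gamma> n) < e" by blast
    qed
    then obtain p where p: "\<gamma> \<longlonglongrightarrow> p" using Cauchy_convergent convergentD by blast
    \<comment> \<open>The strict bound on the length leaves this margin: the path starts within
      \<rho> of the centre, moves by at most \<open>\<kappa> * path_len X a b \<sigma>\<close>, and
      the passage to the limit costs less than \<eta>, which adds up to less than
      \<open>3 * \<rho>\<close>.\<close>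
    define \<eta> where "\<eta> = 2 * \<rho> - \<kappa> * path_len X a b \<sigma>"
    have \<eta>: "\<eta> > 0" using len by (simp add: \<eta>_def)
    then have "\<eta> / \<beta> > 0" using \<beta> by simp
    then obtain k where k: "dist (\<gamma> k) p < \<eta> / \<beta>" using p unfolding lim_sequentially by blast
    have "n (\<gamma> k - snd c (\<sigma> a)) \<le> \<kappa> * (I (\<tau> k) - I a)"
      unfolding \<gamma>_def
    proof (rule est[OF order_refl \<tau>(1) \<tau>(3)])
      fix s assume "s \<in> {a..\<tau> k}"
      then show "\<sigma> s \<in> V" using before[of s] \<tau>[of k] by auto
    qed
    also have "\<dots> \<le> \<kappa> * path_len X a b \<sigma>"
      using I_mono[OF \<tau>(1) \<tau>(3), of k] \<kappa> Ia Ib by simp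
    finally have 1: "n (\<gamma> k - snd c (\<sigma> a)) \<le> \<kappa> * path_len X a b \<sigma>" .
    have "n (p - \<gamma> k) \<le> \<beta> * norm (p - \<gamma> k)" by (rule \<beta>(2))
    also have "\<dots> < \<eta>" using k \<beta>(1) by (simp add: dist_norm norm_minus_commute field_simps)
    finally have 2: "n (p - \<gamma> k) < \<eta>" .
    have 3: "n (snd c (\<sigma> a) - p0) < \<rho>" using start(2) unfolding nball_def by simp
    have "n (p - p0) \<le> n (p - \<gamma> k) + (n (\<gamma> k - snd c (\<sigma> a)) + n (snd c (\<sigma> a) - p0))"
      using equivalent_normD(7)[OF n, of p p0 "\<gamma> k"]
        equivalent_normD(7)[OF n, of "\<gamma> k" p0 "snd c (\<sigma> a)"] by linarith
    then have pB: "p \<in> nball n p0 (3 * \<rho>)" using 1 2 3 unfolding nball_def \<eta>_def by simp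
    have "(\<lambda>k. chart_inv c (\<gamma> k)) \<longlonglongrightarrow> chart_inv c p"
    proof (rule continuous_on_tendsto_compose[OF chart_cont(2)[OF A c] p])
      show "p \<in> chart_image c" using pB B by blast
      show "\<forall>\<^sub>F k in sequentially. \<gamma> k \<in> chart_image c"
        using VD(1) before \<tau> unfolding \<gamma>_def by (intro always_eventually) blast
    qed
    moreover have "chart_inv c (\<gamma> k) = \<sigma> (\<tau> k)" for k
      unfolding \<gamma>_def using chart_inv_left[OF A c] VD(1) before \<tau> by blast
    ultimately have "(\<lambda>k. \<sigma> (\<tau> k)) \<longlonglongrightarrow> chart_inv c p" by simp
    moreover have "(\<lambda>k. \<sigma> (\<tau> k)) \<longlonglongrightarrow> \<sigma> t1"
      using \<tau>lim \<tau> t1' by (intro continuous_on_tendsto_compose[OF cont]) auto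
    ultimately have "\<sigma> t1 = chart_inv c p" using LIMSEQ_unique by blast
    then show False using t1'(3) pB unfolding V_def by blast
  qed
  show "\<sigma> b \<in> fst c" "snd c (\<sigma> b) \<in> nball n p0 (3 * \<rho>)" using VD[OF all[of b]] \<sigma>(2) by auto
  show "n (snd c (\<sigma> b) - snd c (\<sigma> a)) \<le> \<kappa> * path_len X a b \<sigma>"
    using est[of a b] all \<sigma>(2) Ia Ib by simp
qed

text \<open>Straight segments bound the distance from above, the confinement of short paths bounds
  it from below. The radius \<open>3 * \<rho>\<close> consists of \<rho> for the starting point and
  \<open>2 * \<rho>\<close> of room to move. The clause in which z is arbitrary shows that a small
  Finsler ball lies in the chart.\<close>

lemma local_distance:
  assumes c: "c \<in> charts_at (charts X) x0" and \<kappa>: "1 < \<kappa>" and W: "open W" "x0 \<in> W"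
  defines "n \<equiv> cnorm X c x0" and "p0 \<equiv> snd c x0"
  shows "\<exists>\<rho>>0. nball n p0 (3 * \<rho>) \<subseteq> chart_image c \<and> chart_inv c ` nball n p0 (3 * \<rho>) \<subseteq> W \<and>
    (\<forall>p\<in>nball n p0 (3 * \<rho>). \<forall>e. n e \<le> \<kappa> * cnorm X c (chart_inv c p) e \<and>
        cnorm X c (chart_inv c p) e \<le> \<kappa> * n e) \<and>
    (\<forall>p\<in>nball n p0 (3 * \<rho>). \<forall>q\<in>nball n p0 (3 * \<rho>).
        fdist X (chart_inv c p) (chart_inv c q) \<le> \<kappa> * n (q - p)) \<and>
    (\<forall>u\<in>fst c. \<forall>z. snd c u \<in> nball n p0 \<rho> \<longrightarrow> \<kappa> * fdist X u z < 2 * \<rho> \<longrightarrow>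
        z \<in> fst c \<and> snd c z \<in> nball n p0 (3 * \<rho>) \<and> n (snd c z - snd c u) \<le> \<kappa> * fdist X u z) \<and>
    (\<forall>u\<in>fst c. \<forall>z\<in>fst c. snd c u \<in> nball n p0 \<rho> \<longrightarrow> snd c z \<in> nball n p0 \<rho> \<longrightarrow>
        n (snd c z - snd c u) \<le> \<kappa> * fdist X u z)"
proof -
  note A = finsler_C1[OF X]
  have cA: "c \<in> charts X" "x0 \<in> fst c" using c charts_at_iff[OF A] by auto
  have n: "equivalent_norm n" unfolding n_def by (rule cnorm_equivalent[OF X c])
  obtain U where U: "open U" "x0 \<in> U" "U \<subseteq> fst c"
    "\<And>x e. x \<in> U \<Longrightarrow> n e \<le> \<kappa> * cnorm X c x e \<and> cnorm X c x e \<le> \<kappa> * n e"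
    using cnorm_compare[OF X c \<kappa>] unfolding n_def by blast
  have "open (snd c ` (U \<inter> W))" using U W by (intro chart_image_open[OF A cA(1)]) auto
  moreover have "p0 \<in> snd c ` (U \<inter> W)" using U W by (simp add: p0_def)
  ultimately obtain r where r: "r > 0" "nball n p0 r \<subseteq> snd c ` (U \<inter> W)" using nball_small[OF n] by meson
  define \<rho> where "\<rho> = r / 3"
  have \<rho>: "\<rho> > 0" "3 * \<rho> = r" using r by (auto simp: \<rho>_def)
  let ?B = "nball n p0 (3 * \<rho>)"
  have Bmem: "p \<in> chart_image c \<and> chart_inv c p \<in> U \<and> chart_inv c p \<in> W" if p: "p \<in> ?B" for p
  proof -
    obtain z where z: "z \<in> U" "z \<in> W" "p = snd c z" using p r(2) unfolding \<rho>(2) by blast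
    then have "z \<in> fst c" using U(3) by blast
    then show ?thesis using chart_inv_left[OF A cA(1)] z by auto
  qed
  then have B: "?B \<subseteq> chart_image c" by blast
  have comp: "n e \<le> \<kappa> * cnorm X c (chart_inv c p) e" "cnorm X c (chart_inv c p) e \<le> \<kappa> * n e"
    if "p \<in> ?B" for p e using U(4) Bmem[OF that] by blast+
  have up: "fdist X (chart_inv c p) (chart_inv c q) \<le> \<kappa> * n (q - p)" if "p \<in> ?B" "q \<in> ?B" for p q
    by (rule fdist_le_chart[OF X cA(1) nball_convex[OF n] B that]) (rule comp(2))
  have low: "z \<in> fst c \<and> snd c z \<in> ?B \<and> n (snd c z - snd c u) \<le> \<kappa> * fdist X u z"
    if u: "u \<in> fst c" "snd c u \<in> nball n p0 \<rho>" and d: "\<kappa> * fdist X u z < 2 * \<rho>" for u z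
  proof -
    have path: "z \<in> fst c \<and> snd c z \<in> ?B \<and> n (snd c z - snd c u) \<le> \<kappa> * r'"
      if r': "fdist X u z < r'" "\<kappa> * r' < 2 * \<rho>" for r'
    proof -
      obtain a b \<sigma> where \<sigma>: "a < b" "C1_path (charts X) a b \<sigma>" "\<sigma> a = u" "\<sigma> b = z" "path_len X a b \<sigma> < r'"
        using fdist_less_path[OF X r'(1)] by metis
      have len: "\<kappa> * path_len X a b \<sigma> < \<kappa> * r'" using \<sigma>(5) \<kappa> by simp
      have "\<kappa> > 0" using \<kappa> by simp
      note st = short_path_stays[OF \<sigma>(2,1) cA(1) n this B comp(1), unfolded \<sigma>(3,4)]
      have "\<kappa> * path_len X a b \<sigma> < 2 * \<rho>" using len r'(2) by simp
      from st[OF _ u this] show ?thesis using len by simp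
    qed
    have d': "fdist X u z < 2 * \<rho> / \<kappa>" using d \<kappa> by (simp add: field_simps)
    have lt: "\<kappa> * r' < 2 * \<rho>" if "r' < 2 * \<rho> / \<kappa>" for r' using that \<kappa> by (simp add: field_simps)
    obtain r' where r': "fdist X u z < r'" "r' < 2 * \<rho> / \<kappa>" using dense[OF d'] by blast
    \<comment> \<open>The infimum need not be attained, so the estimate is proved for every
      admissible number above the distance and passed to the limit.\<close>
    have "n (snd c z - snd c u) / \<kappa> \<le> fdist X u z"
    proof (rule dense_ge_bounded[OF d'])
      fix w assume "fdist X u z < w" "w < 2 * \<rho> / \<kappa>"
      then have "n (snd c z - snd c u) \<le> \<kappa> * w" using path lt by blast
      then show "n (snd c z - snd c u) / \<kappa> \<le> w" using \<kappa> by (simp add: field_simps)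
    qed
    then show ?thesis using path[OF r'(1) lt[OF r'(2)]] \<kappa> by (simp add: field_simps)
  qed
  \<comment> \<open>No smallness of the distance is assumed: two points of the ball of radius \<rho>
    are less than \<open>2 * \<rho>\<close> apart, so the estimate is trivial once
    \<open>2 * \<rho> \<le> \<kappa> * fdist X u z\<close>.\<close>
  have low2: "n (snd c z - snd c u) \<le> \<kappa> * fdist X u z"
    if u: "u \<in> fst c" "snd c u \<in> nball n p0 \<rho>" and z: "z \<in> fst c" "snd c z \<in> nball n p0 \<rho>" for u z
  proof (cases "\<kappa> * fdist X u z < 2 * \<rho>")
    case True then show ?thesis using low[OF u] by blast
  next
    case False
    have "n (snd c z - snd c u) \<le> n (snd c z - p0) + n (snd c u - p0)"
      using equivalent_normD(7)[OF n, of "snd c z" "snd c u" p0] equivalent_normD(5)[OF n, of p0 "snd c u"]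
      by simp
    then show ?thesis using False u z unfolding nball_def by simp
  qed
  have img: "chart_inv c ` ?B \<subseteq> W" using Bmem by blast
  show ?thesis
    by (intro exI[of _ \<rho>] conjI ballI allI impI \<rho>(1) B img comp up low low2)
qed

end


section \<open>Indices of an operator\<close>

definition dualn :: "('e::real_normed_vector \<Rightarrow> real) \<Rightarrow> ('e \<Rightarrow>\<^sub>L real) \<Rightarrow> real" where
  "dualn n l = (SUP e\<in>{e. n e \<le> 1}. \<bar>l e\<bar>)"

lemma blinfun_le_equivalent_norm:
  fixes l :: "'e::real_normed_vector \<Rightarrow>\<^sub>L real"
  assumes n: "equivalent_norm n"
  shows "\<exists>K\<ge>0. \<forall>e. \<bar>l e\<bar> \<le> K * n e"
proof -
  obtain a where a: "a > 0" "\<And>v. a * norm v \<le> n v" using n unfolding equivalent_norm_def by blast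
  have "\<bar>l e\<bar> \<le> (norm l / a) * n e" for e
  proof -
    have "\<bar>l e\<bar> \<le> norm l * norm e" using norm_blinfun[of l e] by simp
    also have "\<dots> \<le> norm l * (n e / a)" using a by (intro mult_left_mono) (auto simp: field_simps)
    finally show ?thesis by simp
  qed
  then show ?thesis using a(1) by (intro exI[of _ "norm l / a"]) auto
qed

lemma dualn_bdd:
  fixes l :: "'e::real_normed_vector \<Rightarrow>\<^sub>L real"
  assumes n: "equivalent_norm n"
  shows "bdd_above ((\<lambda>e. \<bar>blinfun_apply l e\<bar>) ` {e. n e \<le> 1})"
proof -
  obtain K where "K \<ge> 0" "\<And>e. \<bar>l e\<bar> \<le> K * n e" using blinfun_le_equivalent_norm[OF n, of l] by blast
  then have "\<bar>l e\<bar> \<le> K" if "n e \<le> 1" for e using that mult_left_le[of "n e" K] by (meson order_trans)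
  then show ?thesis by (intro bdd_aboveI[of _ K]) auto
qed

lemma dualn_upper:
  assumes n: "equivalent_norm n" and e: "n e \<le> 1"
  shows "\<bar>blinfun_apply l e\<bar> \<le> dualn n l"
  unfolding dualn_def using dualn_bdd[OF n] e by (intro cSUP_upper) auto

lemma dualn_least:
  assumes n: "equivalent_norm n" and r: "\<And>e. n e \<le> 1 \<Longrightarrow> \<bar>blinfun_apply l e\<bar> \<le> r"
  shows "dualn n l \<le> r"
  unfolding dualn_def using r equivalent_normD(4)[OF n] by (intro cSUP_least) (auto intro: exI[of _ 0])

lemma dualn_nonneg: "equivalent_norm n \<Longrightarrow> 0 \<le> dualn n l"
  using dualn_upper[of n 0 l] equivalent_normD(4)[of n] by simp

lemma dualn_bound:
  assumes n: "equivalent_norm n"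
  shows "\<bar>blinfun_apply l e\<bar> \<le> dualn n l * n e"
proof (cases "e = 0")
  case False
  then have pos: "n e > 0" using equivalent_normD(3,6)[OF n, of e] by (simp add: less_le)
  have "n ((1 / n e) *\<^sub>R e) \<le> 1" using pos by (simp add: equivalent_normD(2)[OF n])
  then have "\<bar>l ((1 / n e) *\<^sub>R e)\<bar> \<le> dualn n l" by (rule dualn_upper[OF n])
  then show ?thesis using pos by (simp add: blinfun.scaleR_right abs_mult field_simps)
qed (simp add: equivalent_normD(4)[OF n])

section \<open>Lower bounds for an operator and for its adjoint\<close>

context
  fixes nE :: "'e::banach \<Rightarrow> real" and nF :: "'f::banach \<Rightarrow> real" and S :: "'e \<Rightarrow>\<^sub>L 'f" and m :: real
  assumes nE: "equivalent_norm nE" and nF: "equivalent_norm nF" and m: "0 < m"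
begin

text \<open>Every w in the unit ball of \<open>nF\<close> is \<open>S v\<close> with
  \<open>nE v \<le> 1 / m\<close>, so the supremum defining \<open>dualn nF l\<close> is at most
  \<open>1 / m\<close> times the dual norm of \<open>l o\<^sub>L S\<close>.\<close>

lemma dual_bound_of_expanding:
  assumes lower: "\<And>e. m * nE e \<le> nF (S e)" and surj: "surj (blinfun_apply S)"
  shows "m * dualn nF l \<le> dualn nE (l o\<^sub>L S)"
proof -
  have "dualn nF l \<le> dualn nE (l o\<^sub>L S) / m"
  proof (rule dualn_least[OF nF])
    fix w assume w: "nF w \<le> 1"
    obtain v where v: "w = S v" using surj by blast
    have "m * nE v \<le> 1" using lower[of v] w v by simp
    then have "nE v \<le> 1 / m" using m by (simp add: field_simps)
    have "\<bar>(l o\<^sub>L S) v\<bar> \<le> dualn nE (l o\<^sub>L S) * nE v" by (rule dualn_bound[OF nE])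
    also have "\<dots> \<le> dualn nE (l o\<^sub>L S) * (1 / m)"
      by (rule mult_left_mono[OF \<open>nE v \<le> 1 / m\<close> dualn_nonneg[OF nE]])
    finally show "\<bar>l w\<bar> \<le> dualn nE (l o\<^sub>L S) / m" by (simp add: v)
  qed
  then show ?thesis using m by (simp add: field_simps)
qed

text \<open>Otherwise a functional l separates y by \<delta> from the image of the ball of radius
  \<open>r = nF y / m\<close>, that is \<open>l (S v) \<le> l y - \<delta>\<close> there, hence
  \<open>r * dualn nE (l o\<^sub>L S) \<le> l y - \<delta>\<close>. By the dual bound the left side
  is at least \<open>nF y * dualn nF l\<close>, hence at least \<open>l y\<close>, a
  contradiction.\<close>

lemma dual_bound_dense:
  assumes dual: "\<And>l. m * dualn nF l \<le> dualn nE (l o\<^sub>L S)" and \<delta>: "0 < \<delta>"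
  shows "\<exists>v. nE v \<le> nF y / m \<and> nF (y - S v) \<le> \<delta>"
proof (rule ccontr)
  assume neg: "\<not> ?thesis"
  define r where "r = nF y / m"
  have r: "0 \<le> r" using equivalent_normD(3)[OF nF] m by (simp add: r_def)
  let ?V = "{v. nE v \<le> r}"
  have "convex ?V"
    unfolding convex_alt
  proof clarify
    fix v w :: 'e and u :: real assume v: "nE v \<le> r" and w: "nE w \<le> r" and u: "0 \<le> u" "u \<le> 1"
    have "nE ((1 - u) *\<^sub>R v + u *\<^sub>R w) \<le> (1 - u) * nE v + u * nE w"
      using equivalent_normD(1)[OF nE, of "(1 - u) *\<^sub>R v" "u *\<^sub>R w"] u
      by (simp add: equivalent_normD(2)[OF nE])
    also have "\<dots> \<le> r" by (rule convex_bound_le[OF v w]) (use u in auto)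
    finally show "nE ((1 - u) *\<^sub>R v + u *\<^sub>R w) \<le> r" .
  qed
  then have "convex (blinfun_apply S ` ?V)"
    by (intro convex_linear_image) (rule bounded_linear.linear[OF blinfun.bounded_linear_right])
  moreover have "convex ((\<lambda>w. y - w) ` Z)" if "convex Z" for Z
    using convex_translation[OF convex_negations[OF that], of y] by (simp add: image_image)
  ultimately have cK: "convex ((\<lambda>w. y - w) ` (blinfun_apply S ` ?V))" by blast
  have "0 \<in> ?V" using r equivalent_normD(4)[OF nE] by simp
  then have "(\<lambda>w. y - w) ` (blinfun_apply S ` ?V) \<noteq> {}" by blast
  moreover have "\<delta> \<le> nF w" if "w \<in> (\<lambda>w. y - w) ` (blinfun_apply S ` ?V)" for w
    using neg that unfolding r_def by force
  ultimately obtain l :: "'f \<Rightarrow>\<^sub>L real" where l: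
    "\<And>w. w \<in> (\<lambda>w. y - w) ` (blinfun_apply S ` ?V) \<Longrightarrow> \<delta> \<le> l w"
    using mazur_orlicz_blinfun[OF nF cK, of \<delta>] by blast
  have lS: "l (S v) \<le> l y - \<delta>" if "nE v \<le> r" for v
    using l[of "y - S v"] that by (auto simp: blinfun.diff_right)
  \<comment> \<open>The ball is symmetric, so the one-sided bound also holds for the absolute
    value.\<close>
  have lS': "\<bar>l (S v)\<bar> \<le> l y - \<delta>" if "nE v \<le> r" for v
    using lS[OF that] lS[of "- v"] that equivalent_normD(8)[OF nE, of v] by (simp add: blinfun.minus_right)
  have "r * dualn nE (l o\<^sub>L S) \<le> l y - \<delta>"
  proof (cases "r = 0")
    case True
    then show ?thesis using lS[of 0] equivalent_normD(4)[OF nE] by simp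
  next
    case False
    then have r0: "r > 0" using r by simp
    have "dualn nE (l o\<^sub>L S) \<le> (l y - \<delta>) / r"
    proof (rule dualn_least[OF nE])
      fix e assume e: "nE e \<le> 1"
      have "nE (r *\<^sub>R e) \<le> r" using e r0 by (simp add: equivalent_normD(2)[OF nE])
      then have "\<bar>l (S (r *\<^sub>R e))\<bar> \<le> l y - \<delta>" by (rule lS')
      then show "\<bar>(l o\<^sub>L S) e\<bar> \<le> (l y - \<delta>) / r"
        using r0 by (simp add: blinfun.scaleR_right abs_mult field_simps)
    qed
    then show ?thesis using r0 by (simp add: field_simps)
  qed
  moreover have "nF y * dualn nF l \<le> r * dualn nE (l o\<^sub>L S)"
  proof -
    have "r * (m * dualn nF l) \<le> r * dualn nE (l o\<^sub>L S)" using dual r by (intro mult_left_mono) auto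
    then show ?thesis using m by (simp add: r_def)
  qed
  moreover have "l y \<le> nF y * dualn nF l" using dualn_bound[OF nF, of l y] by (simp add: mult.commute)
  ultimately show False using \<delta> by linarith
qed

text \<open>Successive approximation, as in the second half of the open mapping theorem.\<close>

lemma expanding_of_dual_bound:
  assumes dual: "\<And>l. m * dualn nF l \<le> dualn nE (l o\<^sub>L S)" and inj: "inj (blinfun_apply S)"
  shows "m * nE e \<le> nF (S e)"
proof -
  obtain a where a: "a > 0" "\<And>v. a * norm v \<le> nE v" using nE unfolding equivalent_norm_def by blast
  obtain a' where a': "a' > 0" "\<And>v. a' * norm v \<le> nF v" using nF unfolding equivalent_norm_def by blast
  define y where "y = S e"
  define C where "C = nF y / m"
  have C: "C \<ge> 0" using equivalent_normD(3)[OF nF] m by (simp add: C_def)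
  \<comment> \<open>With relative error \<delta> in each approximation the residuals decay like
    \<open>\<delta> ^ k\<close>, and the corrections sum to an exact solution of norm at most
    \<open>C / (1 - \<delta>)\<close>. Injectivity identifies this solution with e, and \<delta>
    then tends to 0.\<close>
  have main: "nE e * (1 - \<delta>) \<le> C" if \<delta>: "0 < \<delta>" "\<delta> < 1" for \<delta>
  proof -
    have "\<exists>v. nE v \<le> nF y / m \<and> nF (y - S v) \<le> \<delta> * nF y" for y
    proof (cases "y = 0")
      case True
      then show ?thesis using equivalent_normD(4)[OF nF] equivalent_normD(4)[OF nE]
        by (intro exI[of _ 0]) simp
    next
      case False
      then have "nF y > 0" using equivalent_normD(3,6)[OF nF, of y] by (simp add: less_le)
      then show ?thesis using dual_bound_dense[OF dual, of "\<delta> * nF y"] \<delta> by simp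
    qed
    then obtain h where h: "\<And>y. nE (h y) \<le> nF y / m" "\<And>y. nF (y - S (h y)) \<le> \<delta> * nF y" by metis
    define r where "r k = ((\<lambda>w. w - S (h w)) ^^ k) y" for k
    have rS: "r (Suc k) = r k - S (h (r k))" for k by (simp add: r_def)
    have rk: "nF (r k) \<le> \<delta> ^ k * nF y" for k
    proof (induction k)
      case (Suc k)
      have "nF (r (Suc k)) \<le> \<delta> * nF (r k)" unfolding rS by (rule h(2))
      also have "\<dots> \<le> \<delta> * (\<delta> ^ k * nF y)" using Suc \<delta> by (intro mult_left_mono) auto
      finally show ?case by (simp add: mult.assoc)
    qed (simp add: r_def)
    define v where "v k = h (r k)" for k
    have vk: "nE (v k) \<le> \<delta> ^ k * C" for k
    proof -
      have "nE (v k) \<le> nF (r k) / m" unfolding v_def by (rule h(1))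
      also have "\<dots> \<le> (\<delta> ^ k * nF y) / m" using rk m by (intro divide_right_mono) auto
      finally show ?thesis by (simp add: C_def)
    qed
    have geo: "summable (\<lambda>k. \<delta> ^ k)" using \<delta> by (intro summable_geometric) auto
    have sum: "summable v"
    proof (rule summable_comparison_test)
      show "summable (\<lambda>k. \<delta> ^ k * (C / a))" by (rule summable_mult2[OF geo])
      have "norm (v k) \<le> \<delta> ^ k * (C / a)" for k
        using a(1) a(2)[of "v k"] vk[of k] by (simp add: field_simps)
      then show "\<exists>N. \<forall>k\<ge>N. norm (v k) \<le> \<delta> ^ k * (C / a)" by blast
    qed
    have Ssum: "(\<Sum>i<k. S (v i)) = y - r k" for k
      by (induction k) (simp_all add: r_def v_def)
    have "r \<longlonglongrightarrow> 0"
    proof (rule Lim_null_comparison)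
      have "norm (r k) \<le> \<delta> ^ k * (nF y / a')" for k
        using a'(1) a'(2)[of "r k"] rk[of k] by (simp add: field_simps)
      then show "\<forall>\<^sub>F k in sequentially. norm (r k) \<le> \<delta> ^ k * (nF y / a')" by simp
      have "(\<lambda>k. \<delta> ^ k * (nF y / a')) \<longlonglongrightarrow> 0 * (nF y / a')"
        using \<delta> by (intro tendsto_mult LIMSEQ_power_zero tendsto_const) auto
      then show "(\<lambda>k. \<delta> ^ k * (nF y / a')) \<longlonglongrightarrow> 0" by simp
    qed
    then have "(\<lambda>k. y - r k) \<longlonglongrightarrow> y - 0" by (intro tendsto_intros)
    then have "(\<lambda>k. S (v k)) sums y" unfolding sums_def Ssum by simp
    moreover have "(\<lambda>k. S (v k)) sums S (suminf v)"
      using bounded_linear.sums[OF blinfun.bounded_linear_right summable_sums[OF sum]] .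
    ultimately have "S (suminf v) = y" using sums_unique2 by blast
    then have v_eq: "suminf v = e" using inj unfolding y_def by (simp add: inj_eq)
    have part: "nE (\<Sum>i<k. v i) \<le> C / (1 - \<delta>)" for k
    proof -
      have "nE (\<Sum>i<k. v i) \<le> (\<Sum>i<k. nE (v i))"
      proof (induction k)
        case (Suc k)
        have "nE (\<Sum>i<Suc k. v i) \<le> nE (\<Sum>i<k. v i) + nE (v k)"
          using equivalent_normD(1)[OF nE] by simp
        then show ?case using Suc by simp
      qed (simp add: equivalent_normD(4)[OF nE])
      also have "\<dots> \<le> (\<Sum>i<k. \<delta> ^ i * C)" by (intro sum_mono vk)
      also have "\<dots> = (\<Sum>i<k. \<delta> ^ i) * C" by (simp add: sum_distrib_right)
      also have "\<dots> \<le> (1 / (1 - \<delta>)) * C"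
      proof (rule mult_right_mono[OF _ C])
        have "(\<Sum>i<k. \<delta> ^ i) \<le> (\<Sum>i. \<delta> ^ i)" using \<delta> by (intro sum_le_suminf[OF geo]) auto
        also have "\<dots> = 1 / (1 - \<delta>)" using \<delta> by (intro suminf_geometric) auto
        finally show "(\<Sum>i<k. \<delta> ^ i) \<le> 1 / (1 - \<delta>)" .
      qed
      finally show ?thesis by simp
    qed
    have "(\<lambda>k. \<Sum>i<k. v i) \<longlonglongrightarrow> e" using summable_LIMSEQ[OF sum] v_eq by simp
    then have "(\<lambda>k. nE (\<Sum>i<k. v i)) \<longlonglongrightarrow> nE e"
      by (rule continuous_on_tendsto_compose[OF equivalent_norm_continuous[OF nE, of UNIV]]) auto
    then have "nE e \<le> C / (1 - \<delta>)" by (rule LIMSEQ_le_const2) (use part in blast)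
    then show ?thesis using \<delta> by (simp add: field_simps)
  qed
  have "nE e \<le> C"
  proof (rule field_le_mult_one_interval)
    fix z :: real assume "0 < z" "z < 1"
    then show "z * nE e \<le> C" using main[of "1 - z"] by (simp add: mult.commute)
  qed
  then show ?thesis using m by (simp add: C_def y_def field_simps)
qed

end

section \<open>The Finsler indices in coordinates\<close>

text \<open>Lower bounds are compared instead of values because the index may be \<infinity>: over a
  zero space the sphere is empty and the right side holds trivially. Otherwise homogeneity leads
  from the sphere to all vectors.\<close>

lemma finsler_C_star_ge_iff:
  fixes X :: "('x::t2_space, 'e::banach) finsler" and Y :: "('y::t2_space, 'f::banach) finsler"
  assumes X: "finsler_manifold X" and Y: "finsler_manifold Y"
    and c: "c \<in> charts_at (charts X) x" and k: "k \<in> charts_at (charts Y) y" and m: "0 \<le> m"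
  shows "ennreal m \<le> finsler_C_star X Y x y (chart_operator (charts X) (charts Y) c k x y S) \<longleftrightarrow>
    (\<forall>e. m * cnorm X c x e \<le> cnorm Y k y (blinfun_apply S e))"
proof -
  note A = finsler_C1[OF X] and nX = cnorm_equivalent[OF X c] and nY = cnorm_equivalent[OF Y k]
  have ball: "(\<forall>v\<in>{v \<in> range g. P v}. Q v) = (\<forall>e. P (g e) \<longrightarrow> Q (g e))"
    for g :: "'e \<Rightarrow> ('x, 'e) tangent" and P Q by blast
  have "ennreal m \<le> finsler_C_star X Y x y (chart_operator (charts X) (charts Y) c k x y S) \<longleftrightarrow>
      (\<forall>e. cnorm X c x e = 1 \<longrightarrow> ennreal m \<le> ennreal (cnorm Y k y (S e)))"
    unfolding finsler_C_star_def le_INF_iff cnorm_def tangent_space_eq[OF A c] ball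
      chart_operator_vec[OF A c, of "charts Y" k y S] ..
  also have "\<dots> \<longleftrightarrow> (\<forall>e. cnorm X c x e = 1 \<longrightarrow> m \<le> cnorm Y k y (S e))"
    using m equivalent_normD(3)[OF nY] by (simp add: ennreal_le_iff)
  also have "\<dots> \<longleftrightarrow> (\<forall>e. m * cnorm X c x e \<le> cnorm Y k y (S e))"
  proof (intro iffI allI impI)
    fix e assume *: "\<forall>e. cnorm X c x e = 1 \<longrightarrow> m \<le> cnorm Y k y (S e)"
    show "m * cnorm X c x e \<le> cnorm Y k y (S e)"
    proof (cases "e = 0")
      case True
      then show ?thesis using equivalent_normD(4)[OF nX] equivalent_normD(4)[OF nY] by simp
    next
      case False
      then have pos: "cnorm X c x e > 0" using equivalent_normD(3,6)[OF nX, of e] by (simp add: less_le)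
      then have "cnorm X c x ((1 / cnorm X c x e) *\<^sub>R e) = 1"
        unfolding equivalent_normD(2)[OF nX] by simp
      then have "m \<le> cnorm Y k y (S ((1 / cnorm X c x e) *\<^sub>R e))" using * by blast
      then show ?thesis
        using pos unfolding blinfun.scaleR_right equivalent_normD(2)[OF nY] by (simp add: field_simps)
    qed
  next
    fix e assume "\<forall>e. m * cnorm X c x e \<le> cnorm Y k y (S e)" "cnorm X c x e = 1"
    then have "m * cnorm X c x e \<le> cnorm Y k y (S e)" "cnorm X c x e = 1" by blast+
    then show "m \<le> cnorm Y k y (S e)" by simp
  qed
  finally show ?thesis .
qed

lemma dual_norm_eq_dualn:
  fixes X :: "('x::t2_space, 'e::banach) finsler"
  assumes X: "finsler_manifold X" and c: "c \<in> charts_at (charts X) x"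
    and l: "\<And>e. l' (tangent_vec (charts X) x c e) = blinfun_apply l e"
  shows "dual_norm X x l' = dualn (cnorm X c x) l"
proof -
  have "{v \<in> tangent_space (charts X) x. fnorm X x v \<le> 1} =
      tangent_vec (charts X) x c ` {e. cnorm X c x e \<le> 1}"
    unfolding tangent_space_eq[OF finsler_C1[OF X] c] cnorm_def by auto
  then show ?thesis unfolding dual_norm_def dualn_def by (simp add: image_image l)
qed

text \<open>Functionals of dual norm 1 and arbitrary ones are exchanged by scaling, tangent and
  model functionals by the chart. If \<open>dualn\<close> is 0 there is nothing to normalise, but
  the inequality is then trivial. Conversely, boundedness on the tangent space makes the functional
  bounded in coordinates.\<close>

lemma finsler_C_ge_iff:
  fixes X :: "('x::t2_space, 'e::banach) finsler" and Y :: "('y::t2_space, 'f::banach) finsler"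
  assumes X: "finsler_manifold X" and Y: "finsler_manifold Y"
    and c: "c \<in> charts_at (charts X) x" and k: "k \<in> charts_at (charts Y) y" and m: "0 \<le> m"
  shows "ennreal m \<le> finsler_C X Y x y (chart_operator (charts X) (charts Y) c k x y S) \<longleftrightarrow>
    (\<forall>l. m * dualn (cnorm Y k y) l \<le> dualn (cnorm X c x) (l o\<^sub>L S))"
proof -
  note A = finsler_C1[OF X] and B = finsler_C1[OF Y]
  note nX = cnorm_equivalent[OF X c] and nY = cnorm_equivalent[OF Y k]
  let ?T = "chart_operator (charts X) (charts Y) c k x y S"
  note op = chart_operator_vec[OF A c, of "charts Y" k y S]
  have compose: "dual_norm X x (l' \<circ> ?T) = dualn (cnorm X c x) (l o\<^sub>L S)"
    if "\<And>w. l' (tangent_vec (charts Y) y k w) = blinfun_apply l w" for l' l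
    by (rule dual_norm_eq_dualn[OF X c]) (simp add: op that)
  show ?thesis
  proof (intro iffI allI)
    fix l :: "'f \<Rightarrow>\<^sub>L real"
    assume C: "ennreal m \<le> finsler_C X Y x y ?T"
    define d where "d = dualn (cnorm Y k y) l"
    show "m * dualn (cnorm Y k y) l \<le> dualn (cnorm X c x) (l o\<^sub>L S)"
    proof (cases "d = 0")
      case True
      then show ?thesis using dualn_nonneg[OF nX] by (simp add: d_def)
    next
      case False
      then have d: "d > 0" using dualn_nonneg[OF nY, of l] by (simp add: d_def)
      define l1 where "l1 = (1 / d) *\<^sub>R l"
      define l' where "l' v = blinfun_apply l1 (tangent_coord k v)" for v
      have l': "l' (tangent_vec (charts Y) y k w) = l1 w" for w
        by (simp add: l'_def tangent_coord_self[OF B k])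
      obtain K where K: "\<And>e. \<bar>l1 e\<bar> \<le> K * cnorm Y k y e" using blinfun_le_equivalent_norm[OF nY, of l1] by blast
      have mem: "l' \<in> tangent_dual Y y"
        unfolding tangent_dual_def tangent_space_eq[OF B k]
      proof (intro CollectI conjI ballI allI)
        fix v w assume "v \<in> range (tangent_vec (charts Y) y k)" "w \<in> range (tangent_vec (charts Y) y k)"
        then show "l' (tangent_add v w) = l' v + l' w"
          by (auto simp: tangent_add_vec[OF B k] l' blinfun.add_right)
      next
        fix v r assume "v \<in> range (tangent_vec (charts Y) y k)"
        then show "l' (tangent_scale r v) = r * l' v"
          by (auto simp: tangent_scale_vec[OF B k] l' blinfun.scaleR_right)
      next
        show "\<exists>K. \<forall>v\<in>range (tangent_vec (charts Y) y k). \<bar>l' v\<bar> \<le> K * fnorm Y y v"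
          using K by (intro exI[of _ K]) (auto simp: l' cnorm_def)
      qed
      have dl: "dualn n ((1 / d) *\<^sub>R l) = dualn n l / d" if n: "equivalent_norm n" for n :: "'z::real_normed_vector \<Rightarrow> real" and l
      proof (rule antisym)
        show "dualn n ((1 / d) *\<^sub>R l) \<le> dualn n l / d"
        proof (rule dualn_least[OF n])
          fix e assume "n e \<le> 1"
          then show "\<bar>((1 / d) *\<^sub>R l) e\<bar> \<le> dualn n l / d"
            using dualn_upper[OF n, of e l] d by (simp add: blinfun.scaleR_left abs_mult field_simps)
        qed
        have "dualn n l \<le> d * dualn n ((1 / d) *\<^sub>R l)"
        proof (rule dualn_least[OF n])
          fix e assume "n e \<le> 1"
          then show "\<bar>l e\<bar> \<le> d * dualn n ((1 / d) *\<^sub>R l)"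
            using dualn_upper[OF n, of e "(1 / d) *\<^sub>R l"] d by (simp add: blinfun.scaleR_left abs_mult field_simps)
        qed
        then show "dualn n l / d \<le> dualn n ((1 / d) *\<^sub>R l)" using d by (simp add: field_simps)
      qed
      have "dual_norm Y y l' = 1"
        using dual_norm_eq_dualn[OF Y k l'] dl[OF nY, of l] d by (simp add: l1_def d_def)
      then have "l' \<in> {l \<in> tangent_dual Y y. dual_norm Y y l = 1}" using mem by simp
      from INF_lower[OF this] C have "ennreal m \<le> ennreal (dual_norm X x (l' \<circ> ?T))"
        unfolding finsler_C_def by (rule order_trans[rotated])
      moreover have "l1 o\<^sub>L S = (1 / d) *\<^sub>R (l o\<^sub>L S)"
        by (rule blinfun_eqI) (simp add: l1_def blinfun.scaleR_left)
      ultimately have "ennreal m \<le> ennreal (dualn (cnorm X c x) (l o\<^sub>L S) / d)"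
        using compose[OF l'] dl[OF nX, of "l o\<^sub>L S"] by simp
      then have "m \<le> dualn (cnorm X c x) (l o\<^sub>L S) / d"
        using dualn_nonneg[OF nX, of "l o\<^sub>L S"] d by (simp add: ennreal_le_iff)
      then show ?thesis using d by (simp add: d_def[symmetric] field_simps)
    qed
  next
    assume dual: "\<forall>l. m * dualn (cnorm Y k y) l \<le> dualn (cnorm X c x) (l o\<^sub>L S)"
    show "ennreal m \<le> finsler_C X Y x y ?T"
      unfolding finsler_C_def
    proof (rule INF_greatest)
      fix l' assume l': "l' \<in> {l \<in> tangent_dual Y y. dual_norm Y y l = 1}"
      define g where "g w = l' (tangent_vec (charts Y) y k w)" for w
      obtain K where K: "\<And>v. v \<in> tangent_space (charts Y) y \<Longrightarrow> \<bar>l' v\<bar> \<le> K * fnorm Y y v"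
        using l' unfolding tangent_dual_def by blast
      obtain b where b: "b > 0" "\<And>w. cnorm Y k y w \<le> b * norm w"
        using nY unfolding equivalent_norm_def by blast
      have gb: "\<bar>g w\<bar> \<le> norm w * (\<bar>K\<bar> * b)" for w
      proof -
        have "\<bar>g w\<bar> \<le> K * cnorm Y k y w" unfolding g_def cnorm_def by (rule K[OF tangent_vec_mem[OF B k]])
        also have "\<dots> \<le> \<bar>K\<bar> * cnorm Y k y w" using equivalent_normD(3)[OF nY, of w] by (intro mult_right_mono) auto
        also have "\<dots> \<le> \<bar>K\<bar> * (b * norm w)" using b by (intro mult_left_mono) auto
        finally show ?thesis by (simp add: algebra_simps)
      qed
      have l'D: "\<And>v w. v \<in> tangent_space (charts Y) y \<Longrightarrow> w \<in> tangent_space (charts Y) y \<Longrightarrow>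
            l' (tangent_add v w) = l' v + l' w"
          "\<And>v r. v \<in> tangent_space (charts Y) y \<Longrightarrow> l' (tangent_scale r v) = r * l' v"
        using l' unfolding tangent_dual_def by auto
      have add: "g (v + w) = g v + g w" for v w
        using l'D(1)[OF tangent_vec_mem[OF B k] tangent_vec_mem[OF B k]]
        unfolding g_def tangent_add_vec[OF B k] .
      have scale: "g (r *\<^sub>R v) = r * g v" for r v
        using l'D(2)[OF tangent_vec_mem[OF B k]] unfolding g_def tangent_scale_vec[OF B k] .
      have "bounded_linear g" using gb add scale by (intro bounded_linear_intro) auto
      then have g: "l' (tangent_vec (charts Y) y k w) = Blinfun g w" for w
        by (simp add: bounded_linear_Blinfun_apply g_def)
      have "dualn (cnorm Y k y) (Blinfun g) = 1" using dual_norm_eq_dualn[OF Y k g] l' by simp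
      then have "m \<le> dual_norm X x (l' \<circ> ?T)" using dual[rule_format, of "Blinfun g"] compose[OF g] by simp
      then show "ennreal m \<le> ennreal (dual_norm X x (l' \<circ> ?T))" by (rule ennreal_leI)
    qed
  qed
qed

text \<open>Here the index defined by adjoints becomes a lower bound for the operator itself.
  Injectivity serves this direction, surjectivity the converse.\<close>

lemma finsler_C_expanding:
  fixes X :: "('x::t2_space, 'e::banach) finsler" and Y :: "('y::t2_space, 'f::banach) finsler"
  assumes X: "finsler_manifold X" and Y: "finsler_manifold Y"
    and c: "c \<in> charts_at (charts X) x" and k: "k \<in> charts_at (charts Y) y"
    and S: "bij (blinfun_apply S)" and m: "0 < m"
  shows "ennreal m \<le> finsler_C X Y x y (chart_operator (charts X) (charts Y) c k x y S) \<longleftrightarrow>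
    (\<forall>e. m * cnorm X c x e \<le> cnorm Y k y (blinfun_apply S e))"
proof -
  note n = cnorm_equivalent[OF X c] cnorm_equivalent[OF Y k]
  have "inj (blinfun_apply S)" "surj (blinfun_apply S)" using S unfolding bij_def by auto
  then show ?thesis
    unfolding finsler_C_ge_iff[OF X Y c k less_imp_le[OF m]]
    using expanding_of_dual_bound[OF n m, of S] dual_bound_of_expanding[OF n m, of S] by auto
qed

text \<open>Both indices have the same positive real lower bounds, and these determine an element of
  \<open>[0, \<infinity>]\<close>.\<close>

lemma finsler_C_eq_C_star:
  fixes X :: "('x::t2_space, 'e::banach) finsler" and Y :: "('y::t2_space, 'f::banach) finsler"
  assumes X: "finsler_manifold X" and Y: "finsler_manifold Y"
    and c: "c \<in> charts_at (charts X) x" and k: "k \<in> charts_at (charts Y) y"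
    and S: "bij (blinfun_apply S)"
  defines "T \<equiv> chart_operator (charts X) (charts Y) c k x y S"
  shows "finsler_C X Y x y T = finsler_C_star X Y x y T"
proof -
  have iff: "ennreal m \<le> finsler_C X Y x y T \<longleftrightarrow> ennreal m \<le> finsler_C_star X Y x y T" if "0 < m" for m
    unfolding T_def using finsler_C_expanding[OF X Y c k S that] finsler_C_star_ge_iff[OF X Y c k, of m S] that
    by simp
  have le: "a \<le> b" if "\<And>m. 0 < m \<Longrightarrow> ennreal m \<le> a \<Longrightarrow> ennreal m \<le> b" for a b :: ennreal
  proof (rule dense_le)
    fix z assume z: "z < a"
    obtain m where m: "z = ennreal m" "0 \<le> m" using z by (cases z) auto
    show "z \<le> b"
    proof (cases "m = 0")
      case False
      then show ?thesis using that[of m] m z by simp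
    qed (simp add: m)
  qed
  show ?thesis by (rule antisym; rule le) (simp_all add: iff)
qed


section \<open>Local representations of the pseudo-Jacobian\<close>

text \<open>The lower estimate of the distance keeps a small Finsler ball inside the chart. With the
  converse \<open>open_subset_fball\<close>, which rests on the upper estimate, the Finsler distance
  induces the topology of the manifold.\<close>

lemma fball_subset_open:
  fixes X :: "('x::t2_space, 'e::banach) finsler"
  assumes X: "finsler_manifold X" and W: "open W" "u \<in> W"
  shows "\<exists>R>0. fball X u R \<subseteq> W"
proof -
  note A = finsler_C1[OF X]
  obtain c where c: "c \<in> charts_at (charts X) u" using ex_chart_at[OF A] by blast
  then have cA: "c \<in> charts X" "u \<in> fst c" using charts_at_iff[OF A] by auto
  have n: "equivalent_norm (cnorm X c u)" by (rule cnorm_equivalent[OF X c])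
  obtain \<rho> where \<rho>: "\<rho> > 0" "chart_inv c ` nball (cnorm X c u) (snd c u) (3 * \<rho>) \<subseteq> W"
    and low: "\<And>z. 2 * fdist X u z < 2 * \<rho> \<Longrightarrow> z \<in> fst c \<and> snd c z \<in> nball (cnorm X c u) (snd c u) (3 * \<rho>)"
    using local_distance[OF X c _ W, of 2] cA(2) nball_center[OF n] by fastforce
  have "fball X u \<rho> \<subseteq> W"
  proof
    fix z assume "z \<in> fball X u \<rho>"
    then have z: "z \<in> fst c" "snd c z \<in> nball (cnorm X c u) (snd c u) (3 * \<rho>)"
      using low[of z] unfolding fball_def by auto
    then have "chart_inv c (snd c z) \<in> W" using \<rho>(2) by blast
    then show "z \<in> W" using chart_inv_left[OF A cA(1) z(1)] by simp
  qed
  then show ?thesis using \<rho>(1) by blast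
qed

lemma open_subset_fball:
  fixes X :: "('x::t2_space, 'e::banach) finsler"
  assumes X: "finsler_manifold X" and R: "0 < R"
  shows "\<exists>W. open W \<and> u \<in> W \<and> W \<subseteq> fball X u R"
proof -
  note A = finsler_C1[OF X]
  obtain c where c: "c \<in> charts_at (charts X) u" using ex_chart_at[OF A] by blast
  then have cA: "c \<in> charts X" "u \<in> fst c" using charts_at_iff[OF A] by auto
  let ?n = "cnorm X c u"
  have n: "equivalent_norm ?n" by (rule cnorm_equivalent[OF X c])
  obtain \<rho> where \<rho>: "\<rho> > 0" "nball ?n (snd c u) (3 * \<rho>) \<subseteq> chart_image c"
    "\<forall>p\<in>nball ?n (snd c u) (3 * \<rho>). \<forall>q\<in>nball ?n (snd c u) (3 * \<rho>).
        fdist X (chart_inv c p) (chart_inv c q) \<le> 2 * ?n (q - p)"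
    using local_distance[OF X c _ open_UNIV, of 2] by force
  define r where "r = min (3 * \<rho>) (R / 2)"
  have r: "r > 0" "r \<le> 3 * \<rho>" "2 * r \<le> R" using \<rho>(1) R by (auto simp: r_def)
  have sub: "nball ?n (snd c u) r \<subseteq> nball ?n (snd c u) (3 * \<rho>)" by (rule nball_mono[OF r(2)])
  let ?W = "chart_inv c ` nball ?n (snd c u) r"
  have "open ?W" by (rule chart_inv_open[OF A cA(1) nball_open[OF n]]) (use sub \<rho>(2) in blast)
  moreover have "u \<in> ?W"
    using nball_center[OF n r(1), of "snd c u"] chart_inv_left[OF A cA] by (metis imageI)
  moreover have "?W \<subseteq> fball X u R"
  proof
    fix z assume "z \<in> ?W"
    then obtain q where q: "q \<in> nball ?n (snd c u) r" "z = chart_inv c q" by blast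
    have "fdist X (chart_inv c (snd c u)) (chart_inv c q) \<le> 2 * ?n (q - snd c u)"
      using \<rho>(1,3) q(1) sub nball_center[OF n, of "3 * \<rho>" "snd c u"] by auto
    then have "fdist X u z \<le> 2 * ?n (q - snd c u)" using chart_inv_left[OF A cA] q(2) by simp
    then show "z \<in> fball X u R" using q(1) r(3) unfolding nball_def fball_def by simp
  qed
  ultimately show ?thesis by blast
qed

lemma locally_lipschitz_map_continuous:
  fixes X :: "('x::t2_space, 'e::banach) finsler" and Y :: "('y::t2_space, 'f::banach) finsler"
  assumes X: "finsler_manifold X" and Y: "finsler_manifold Y" and f: "locally_lipschitz_map X Y f"
  shows "continuous_on UNIV f"
proof -
  have "open (f -` V)" if V: "open V" for V
  proof (subst open_subopen, intro ballI)
    fix x assume "x \<in> f -` V"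
    then obtain R where R: "R > 0" "fball Y (f x) R \<subseteq> V" using fball_subset_open[OF Y V] by blast
    obtain U where U: "open U" "x \<in> U" "lipschitz_map (fdist X) (fdist Y) U f"
      using f unfolding locally_lipschitz_map_def by blast
    then obtain L where L: "L \<ge> 0" "\<And>z. z \<in> U \<Longrightarrow> fdist Y (f x) (f z) \<le> L * fdist X x z"
      unfolding lipschitz_map_def by blast
    \<comment> \<open>The summand 1 covers \<open>L = 0\<close>.\<close>
    have "R / (L + 1) > 0" using R L by simp
    then obtain W where W: "open W" "x \<in> W" "W \<subseteq> fball X x (R / (L + 1))"
      using open_subset_fball[OF X] by blast
    have "U \<inter> W \<subseteq> f -` V"
    proof
      fix z assume z: "z \<in> U \<inter> W"
      have "fdist Y (f x) (f z) \<le> L * fdist X x z" using L(2) z by blast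
      also have "\<dots> \<le> (L + 1) * fdist X x z"
        using fdist_nonneg[OF X, of x z] by (intro mult_right_mono) auto
      also have "\<dots> < R" using z W(3) L(1) unfolding fball_def by (auto simp: field_simps)
      finally show "z \<in> f -` V" using R(2) unfolding fball_def by blast
    qed
    then show "\<exists>T. open T \<and> x \<in> T \<and> T \<subseteq> f -` V" using U W by (intro exI[of _ "U \<inter> W"]) auto
  qed
  then show ?thesis using continuous_on_open_vimage[OF open_UNIV, of f] by simp
qed

definition rep_hull ::
    "('x::topological_space, 'e::real_normed_vector) finsler \<Rightarrow> ('x, 'e) chart \<Rightarrow>
     ('e \<Rightarrow> ('e \<Rightarrow>\<^sub>L 'f::real_normed_vector) set) \<Rightarrow> 'x \<Rightarrow> real \<Rightarrow> ('e \<Rightarrow>\<^sub>L 'f) set" where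
  "rep_hull X c J x R = convex hull (\<Union>u\<in>fball X x R. J (snd c u))"

lemma rep_hull_mono: "R \<le> R' \<Longrightarrow> rep_hull X c J x R \<subseteq> rep_hull X c J x R'"
  unfolding rep_hull_def fball_def by (intro hull_mono) force

lemma chosen_rep_jacobian_rep:
  assumes "strong_pseudo_jacobian_mapping X Y f Jf" and ch: "chosen_rep X Y f Jf x = (c, k, J)"
  shows "jacobian_rep X Y f Jf x c k J"
proof -
  obtain c' k' J' where "jacobian_rep X Y f Jf x c' k' J'"
    using assms(1) unfolding strong_pseudo_jacobian_mapping_def by blast
  then have "case (c', k', J') of (c, k, J) \<Rightarrow> jacobian_rep X Y f Jf x c k J" by simp
  then have "case chosen_rep X Y f Jf x of (c, k, J) \<Rightarrow> jacobian_rep X Y f Jf x c k J"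
    unfolding chosen_rep_def by (rule someI)
  then show ?thesis unfolding ch by simp
qed

lemma chosen_rep_small_radii:
  "chosen_rep X Y f Jf x = (c, k, J) \<Longrightarrow> R \<in> small_radii X Y f Jf x \<longleftrightarrow> 0 < R \<and> fball X x R \<subseteq> fst c"
  by (simp add: small_radii_def)

lemma chosen_rep_co_jacobian:
  "chosen_rep X Y f Jf x = (c, k, J) \<Longrightarrow> co_jacobian X Y f Jf x R =
    chart_operator (charts X) (charts Y) c k x (f x) ` rep_hull X c J x R"
  by (simp add: co_jacobian_def rep_hull_def)

lemma jacobian_rep_charts:
  fixes X :: "('x::t2_space, 'e::banach) finsler" and Y :: "('y::t2_space, 'f::banach) finsler"
  assumes "jacobian_rep X Y f Jf x c k J"
  shows "c \<in> charts_at (charts X) x" "k \<in> charts_at (charts Y) (f x)" "f ` fst c \<subseteq> fst k"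
    "pseudo_jacobian_mapping_on (chart_image c) (snd k \<circ> f \<circ> chart_inv c) J"
    "locally_bounded_on (chart_image c) J"
    "u \<in> fst c \<Longrightarrow> Jf u = chart_operator (charts X) (charts Y) c k u (f u) ` J (snd c u)"
  using assms unfolding jacobian_rep_def by auto

lemma fball_mono: "R \<le> R' \<Longrightarrow> fball X x R \<subseteq> fball X x R'"
  unfolding fball_def by auto

text \<open>The index may be \<infinity>, so a real C0 is inserted strictly between \<alpha> and the
  infimum at a suitable radius. The smaller of the radii for invertibility and for the bound serves
  both, as the hull shrinks with the radius.\<close>

lemma J_regular_data:
  fixes X :: "('x::t2_space, 'e::banach) finsler" and Y :: "('y::t2_space, 'f::banach) finsler"
  assumes X: "finsler_manifold X" and Y: "finsler_manifold Y"
    and J: "strong_pseudo_jacobian_mapping X Y f Jf" and reg: "J_regular X Y f Jf x"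
    and \<alpha>: "0 < \<alpha>" "ennreal \<alpha> < index_C X Y f Jf x" and ch: "chosen_rep X Y f Jf x = (c, k, J)"
  shows "\<exists>R C0. 0 < R \<and> \<alpha> < C0 \<and> fball X x R \<subseteq> fst c \<and> (\<forall>S\<in>rep_hull X c J x R. bij (blinfun_apply S) \<and>
    (\<forall>e. C0 * cnorm X c x e \<le> cnorm Y k (f x) (blinfun_apply S e)))"
proof -
  let ?op = "chart_operator (charts X) (charts Y) c k x (f x)"
  note rep = chosen_rep_jacobian_rep[OF J ch]
  note ck = jacobian_rep_charts(1,2)[OF rep]
  obtain R1 where R1: "R1 \<in> small_radii X Y f Jf x"
    "\<And>T. T \<in> co_jacobian X Y f Jf x R1 \<Longrightarrow> tangent_isomorphism (charts X) (charts Y) x (f x) T"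
    using reg unfolding J_regular_def by blast
  obtain R2 where R2: "R2 \<in> small_radii X Y f Jf x"
    "ennreal \<alpha> < (INF T\<in>co_jacobian X Y f Jf x R2. finsler_C X Y x (f x) T)"
    using \<alpha>(2) unfolding index_C_def less_SUP_iff by blast
  obtain z where z: "ennreal \<alpha> < z" "z < (INF T\<in>co_jacobian X Y f Jf x R2. finsler_C X Y x (f x) T)"
    using dense[OF R2(2)] by blast
  obtain C0 where C0: "z = ennreal C0" "0 \<le> C0" using z(2) by (cases z) auto
  have C0\<alpha>: "\<alpha> < C0" using z(1) C0 \<alpha>(1) by (simp add: ennreal_less_iff)
  define R where "R = min R1 R2"
  have R: "0 < R" "fball X x R \<subseteq> fst c" "R \<le> R1" "R \<le> R2"
    using R1(1) R2(1) fball_mono[of R R1 X x] unfolding chosen_rep_small_radii[OF ch] R_def by auto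
  have "bij (blinfun_apply S) \<and> (\<forall>e. C0 * cnorm X c x e \<le> cnorm Y k (f x) (blinfun_apply S e))"
    if S: "S \<in> rep_hull X c J x R" for S
  proof -
    have "?op S \<in> co_jacobian X Y f Jf x R1"
      using S rep_hull_mono[OF R(3), of X c J x] unfolding chosen_rep_co_jacobian[OF ch] by blast
    then have bij: "bij (blinfun_apply S)"
      using R1(2) tangent_isomorphism_chart_operator[OF finsler_C1[OF X] finsler_C1[OF Y] ck] by blast
    have "?op S \<in> co_jacobian X Y f Jf x R2"
      using S rep_hull_mono[OF R(4), of X c J x] unfolding chosen_rep_co_jacobian[OF ch] by blast
    then have "ennreal C0 \<le> finsler_C X Y x (f x) (?op S)"
      using z(2) C0(1) by (meson INF_lower less_imp_le order_trans)
    then show ?thesis using bij finsler_C_expanding[OF X Y ck bij] C0\<alpha> \<alpha>(1) by auto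
  qed
  then show ?thesis using R C0\<alpha> by blast
qed

text \<open>The infimum over the hull grows as the radius decreases, so the supremum over all small
  radii is that over the radii at most R. There every operator is an isomorphism and the two indices
  agree operator by operator.\<close>

lemma index_C_eq_index_C_star:
  fixes X :: "('x::t2_space, 'e::banach) finsler" and Y :: "('y::t2_space, 'f::banach) finsler"
  assumes X: "finsler_manifold X" and Y: "finsler_manifold Y"
    and J: "strong_pseudo_jacobian_mapping X Y f Jf" and ch: "chosen_rep X Y f Jf x = (c, k, J)"
    and m: "0 < m" and R: "0 < R" "fball X x R \<subseteq> fst c"
    and S: "\<And>S. S \<in> rep_hull X c J x R \<Longrightarrow> surj (blinfun_apply S)"
      "\<And>S e. S \<in> rep_hull X c J x R \<Longrightarrow> m * cnorm X c x e \<le> cnorm Y k (f x) (blinfun_apply S e)"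
  shows "index_C_star X Y f Jf x = index_C X Y f Jf x" and "ennreal m \<le> index_C X Y f Jf x"
proof -
  let ?op = "chart_operator (charts X) (charts Y) c k x (f x)"
  note rep = chosen_rep_jacobian_rep[OF J ch]
  note ck = jacobian_rep_charts(1,2)[OF rep]
  note nX = cnorm_equivalent[OF X ck(1)] and nY = cnorm_equivalent[OF Y ck(2)]
  let ?s = "small_radii X Y f Jf x"
  define g where "g r = (INF T\<in>co_jacobian X Y f Jf x r. finsler_C X Y x (f x) T)" for r
  define h where "h r = (INF T\<in>co_jacobian X Y f Jf x r. finsler_C_star X Y x (f x) T)" for r
  have bij: "bij (blinfun_apply S)" if s: "S \<in> rep_hull X c J x R" for S
  proof -
    have "inj (blinfun_apply S)"
    proof (rule injI)
      fix v w assume "S v = S w"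
      then have "S (v - w) = 0" by (simp add: blinfun.diff_right)
      then have "m * cnorm X c x (v - w) \<le> 0" using S(2)[OF s, of "v - w"] equivalent_normD(4)[OF nY] by simp
      then have "cnorm X c x (v - w) = 0"
        using m equivalent_normD(3)[OF nX, of "v - w"] by (simp add: mult_le_0_iff)
      then show "v = w" using equivalent_normD(6)[OF nX] by simp
    qed
    then show ?thesis using S(1)[OF s] unfolding bij_def by blast
  qed
  have mono: "co_jacobian X Y f Jf x r \<subseteq> co_jacobian X Y f Jf x r'" if "r \<le> r'" for r r'
    unfolding chosen_rep_co_jacobian[OF ch] using rep_hull_mono[OF that] by blast
  have eq: "g r = h r" if r: "r \<le> R" for r
    unfolding g_def h_def
  proof (rule INF_cong[OF refl])
    fix T assume "T \<in> co_jacobian X Y f Jf x r"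
    then obtain S where "S \<in> rep_hull X c J x R" "T = ?op S"
      using mono[OF r] unfolding chosen_rep_co_jacobian[OF ch] by blast
    then show "finsler_C X Y x (f x) T = finsler_C_star X Y x (f x) T"
      using finsler_C_eq_C_star[OF X Y ck bij] by simp
  qed
  have le_g: "g r \<le> g r'" and le_h: "h r \<le> h r'" if "r' \<le> r" for r r'
    unfolding g_def h_def using mono[OF that] by (auto intro: INF_superset_mono)
  have small: "min r R \<in> ?s" if "r \<in> ?s" for r
    using that R fball_mono[of "min r R" R X x] unfolding chosen_rep_small_radii[OF ch] by auto
  have "(SUP r\<in>?s. h r) \<le> (SUP r\<in>?s. g r)"
  proof (rule SUP_least)
    fix r assume "r \<in> ?s"
    have "h r \<le> g (min r R)" using le_h[of "min r R" r] eq[of "min r R"] by simp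
    then show "h r \<le> (SUP r\<in>?s. g r)" using SUP_upper[OF small[OF \<open>r \<in> ?s\<close>], of g] by (rule order_trans)
  qed
  moreover have "(SUP r\<in>?s. g r) \<le> (SUP r\<in>?s. h r)"
  proof (rule SUP_least)
    fix r assume "r \<in> ?s"
    have "g r \<le> h (min r R)" using le_g[of "min r R" r] eq[of "min r R"] by simp
    then show "g r \<le> (SUP r\<in>?s. h r)" using SUP_upper[OF small[OF \<open>r \<in> ?s\<close>], of h] by (rule order_trans)
  qed
  ultimately have "(SUP r\<in>?s. h r) = (SUP r\<in>?s. g r)" by (rule antisym)
  then show "index_C_star X Y f Jf x = index_C X Y f Jf x"
    unfolding index_C_def index_C_star_def g_def h_def .
  have "ennreal m \<le> g R"
    unfolding g_def
  proof (rule INF_greatest)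
    fix T assume "T \<in> co_jacobian X Y f Jf x R"
    then obtain S' where S': "S' \<in> rep_hull X c J x R" "T = ?op S'"
      unfolding chosen_rep_co_jacobian[OF ch] by blast
    show "ennreal m \<le> finsler_C X Y x (f x) T"
      unfolding S'(2) finsler_C_expanding[OF X Y ck bij[OF S'(1)] m] using S(2)[OF S'(1)] by blast
  qed
  moreover have "R \<in> ?s" using R unfolding chosen_rep_small_radii[OF ch] by blast
  ultimately show "ennreal m \<le> index_C X Y f Jf x"
    unfolding index_C_def g_def by (meson SUP_upper order_trans)
qed

lemma norm_blinfun_compose3_diff:
  fixes A A' :: "'f::real_normed_vector \<Rightarrow>\<^sub>L 'g::real_normed_vector"
    and B B' :: "'d::real_normed_vector \<Rightarrow>\<^sub>L 'e::real_normed_vector"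
  assumes S: "norm S \<le> M"
  shows "norm ((A o\<^sub>L S o\<^sub>L B) - (A' o\<^sub>L S o\<^sub>L B'))
    \<le> norm (A - A') * M * norm B + norm A' * M * norm (B - B')"
proof -
  have "(A o\<^sub>L S o\<^sub>L B) - (A' o\<^sub>L S o\<^sub>L B') = ((A - A') o\<^sub>L S o\<^sub>L B) + (A' o\<^sub>L S o\<^sub>L (B - B'))"
    by (rule blinfun_eqI) (simp add: blinfun.diff_left blinfun.diff_right blinfun.add_left)
  then have "norm ((A o\<^sub>L S o\<^sub>L B) - (A' o\<^sub>L S o\<^sub>L B'))
      \<le> norm ((A - A') o\<^sub>L S o\<^sub>L B) + norm (A' o\<^sub>L S o\<^sub>L (B - B'))"
    by (metis norm_triangle_ineq)
  also have "norm ((A - A') o\<^sub>L S o\<^sub>L B) \<le> norm (A - A') * M * norm B"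
    using S by (intro order_trans[OF norm_blinfun_compose] mult_right_mono mult_left_mono) auto
  also have "norm (A' o\<^sub>L S o\<^sub>L (B - B')) \<le> norm A' * M * norm (B - B')"
    using S by (intro order_trans[OF norm_blinfun_compose] mult_right_mono mult_left_mono) auto
  finally show ?thesis by simp
qed

text \<open>The set is the Minkowski sum of the image of H under L and the closed ball of radius
  \<eta>. Its convexity reduces the approximation of a whole hull to that of its generators.\<close>

lemma convex_near_convex_image:
  fixes L :: "'a::real_vector \<Rightarrow> 'b::real_normed_vector"
  assumes "linear L" "convex H"
  shows "convex {T. \<exists>S\<in>H. norm (T - L S) \<le> \<eta>}"
proof -
  have "{T. \<exists>S\<in>H. norm (T - L S) \<le> \<eta>} = (\<Union>x\<in>L ` H. \<Union>y\<in>cball 0 \<eta>. {x + y})"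
  proof (intro equalityI subsetI)
    fix T assume "T \<in> {T. \<exists>S\<in>H. norm (T - L S) \<le> \<eta>}"
    then obtain S where "S \<in> H" "norm (T - L S) \<le> \<eta>" by blast
    then show "T \<in> (\<Union>x\<in>L ` H. \<Union>y\<in>cball 0 \<eta>. {x + y})"
      by (intro UN_I[of "L S"] UN_I[of "T - L S"]) auto
  next
    fix T assume "T \<in> (\<Union>x\<in>L ` H. \<Union>y\<in>cball 0 \<eta>. {x + y})"
    then obtain S y where "S \<in> H" "norm y \<le> \<eta>" "T = L S + y" by auto
    then show "T \<in> {T. \<exists>S\<in>H. norm (T - L S) \<le> \<eta>}" by (auto intro!: bexI[of _ S])
  qed
  then show ?thesis using assms convex_sums[OF convex_linear_image[OF assms] convex_cball] by simp
qed

text \<open>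
  Near u the operators of one local pseudo-Jacobian are, up to a small error, those of the other
  one transported by the differentials of the transition maps at u; the error is controlled by
  the continuity of these differentials and the local boundedness.
\<close>

lemma rep_hull_nearby:
  fixes X :: "('x::t2_space, 'e::banach) finsler" and Y :: "('y::t2_space, 'f::banach) finsler"
  assumes X: "finsler_manifold X" and Y: "finsler_manifold Y" and f: "continuous_on UNIV f"
    and rep: "jacobian_rep X Y f Jf x c k J" and rep': "jacobian_rep X Y f Jf u c' k' J'"
    and W: "open W" "u \<in> W" "W \<subseteq> fst c" "W \<subseteq> fball X x R"
    and M: "\<And>z S. z \<in> W \<Longrightarrow> S \<in> J (snd c z) \<Longrightarrow> norm S \<le> M"
    and surj: "\<And>S. S \<in> rep_hull X c J x R \<Longrightarrow> surj (blinfun_apply S)"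
    and low: "\<And>S e. S \<in> rep_hull X c J x R \<Longrightarrow> C0 * cnorm X c x e \<le> cnorm Y k (f x) (blinfun_apply S e)"
    and \<kappa>: "0 < \<kappa>" "\<And>e. cnorm X c u e \<le> \<kappa> * cnorm X c x e"
      "\<And>w. cnorm Y k (f x) w \<le> \<kappa> * cnorm Y k (f u) w"
    and m: "0 < m" "m < C0 / \<kappa>\<^sup>2"
  shows "\<exists>R1>0. fball X u R1 \<subseteq> fst c' \<and> (\<forall>T\<in>rep_hull X c' J' u R1. surj (blinfun_apply T) \<and>
    (\<forall>e. m * cnorm X c' u e \<le> cnorm Y k' (f u) (blinfun_apply T e)))"
proof -
  note XA = finsler_C1[OF X] and YA = finsler_C1[OF Y]
  note r = jacobian_rep_charts[OF rep] and r' = jacobian_rep_charts[OF rep']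
  have cA: "c \<in> charts X" "k \<in> charts Y" "c' \<in> charts X" "u \<in> fst c'" "k' \<in> charts Y" "f u \<in> fst k'"
    using r(1,2) r'(1,2) charts_at_iff[OF XA] charts_at_iff[OF YA] by auto
  have fk: "f z \<in> fst k" if "z \<in> fst c" for z using r(3) that by blast
  have uc: "u \<in> fst c" using W by blast
  have cu: "c \<in> charts_at (charts X) u" "k \<in> charts_at (charts Y) (f u)"
    using uc fk[OF uc] cA charts_at_iff[OF XA] charts_at_iff[OF YA] by auto
  let ?nX = "cnorm X c' u" and ?nY = "cnorm Y k' (f u)" and ?H = "rep_hull X c J x R"
  note nX = cnorm_equivalent[OF X r'(1)] and nY = cnorm_equivalent[OF Y r'(2)]
  obtain a where a: "a > 0" "\<And>v. a * norm v \<le> ?nX v" using nX unfolding equivalent_norm_def by blast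
  obtain b where b: "b > 0" "\<And>v. ?nY v \<le> b * norm v" using nY unfolding equivalent_norm_def by blast
  define A where "A z = trans_deriv k k' (f z)" for z
  define B where "B z = trans_deriv c' c z" for z
  \<comment> \<open>The transport is frozen at u, although an operator at z is transported by the
    differentials at z: a fixed linear map is needed to carry a convex hull to a convex set.\<close>
  define L where "L S = A u o\<^sub>L S o\<^sub>L B u" for S
  define m' where "m' = C0 / \<kappa>\<^sup>2"
  have C0: "C0 = m' * \<kappa>\<^sup>2" using \<kappa>(1) by (simp add: m'_def)
  have m': "0 < m'" "m < m'" using m by (auto simp: m'_def)
  \<comment> \<open>One factor \<kappa> comes from the change of norm between \<open>f x\<close> and
    \<open>f u\<close>, the other from that between x and u.\<close>
  have lowL: "m' * ?nX e \<le> ?nY (L S e)" if S: "S \<in> ?H" for S e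
  proof -
    have "C0 * cnorm X c x (B u e) \<le> cnorm Y k (f x) (S (B u e))" by (rule low[OF S])
    also have "\<dots> \<le> \<kappa> * cnorm Y k (f u) (S (B u e))" by (rule \<kappa>(3))
    also have "cnorm Y k (f u) (S (B u e)) = ?nY (L S e)"
      unfolding L_def A_def by (simp add: cnorm_change[OF Y cu(2) r'(2)])
    finally have 1: "C0 * cnorm X c x (B u e) \<le> \<kappa> * ?nY (L S e)" .
    have "?nX e = cnorm X c u (B u e)" unfolding B_def by (rule cnorm_change[OF X r'(1) cu(1), symmetric])
    also have "\<dots> \<le> \<kappa> * cnorm X c x (B u e)" by (rule \<kappa>(2))
    finally have "(m' * \<kappa>) * ?nX e \<le> (m' * \<kappa>) * (\<kappa> * cnorm X c x (B u e))"
      using m' \<kappa>(1) by (intro mult_left_mono) auto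
    also have "\<dots> = C0 * cnorm X c x (B u e)" unfolding C0 by (simp add: power2_eq_square)
    also note 1
    finally have "\<kappa> * (m' * ?nX e) \<le> \<kappa> * ?nY (L S e)" by (simp add: mult_ac)
    then show ?thesis using \<kappa>(1) by simp
  qed
  have surjL: "surj (blinfun_apply (L S))" if S: "S \<in> ?H" for S
  proof -
    have "\<exists>v. L S v = w" for w
    proof -
      obtain v where v: "S v = trans_deriv k' k (f u) w" using surj[OF S] by (metis surjD)
      have "L S (trans_deriv c c' u v) = w"
        unfolding L_def A_def B_def
        by (simp add: trans_deriv_inverse[OF XA cu(1) r'(1)] v trans_deriv_inverse[OF YA r'(2) cu(2)])
      then show ?thesis by blast
    qed
    then show ?thesis unfolding surj_def by metis
  qed
  \<comment> \<open>Since \<open>b * \<eta> = (m' - m) * a\<close>, an error of norm at most \<eta>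
    lowers the constant \<open>m'\<close> at most to m; and \<eta> is below
    \<open>m' * a / b\<close>, so surjectivity survives as well.\<close>
  define \<eta> where "\<eta> = (m' - m) * a / b"
  have \<eta>: "\<eta> > 0" using m' a b by (simp add: \<eta>_def)
  have good: "surj (blinfun_apply T) \<and> (\<forall>e. m * ?nX e \<le> ?nY (T e))"
    if S: "S \<in> ?H" and T: "norm (T - L S) \<le> \<eta>" for S T
  proof (intro conjI allI)
    have "m' * a / b * norm v \<le> norm (L S v)" for v
    proof -
      have "m' * (a * norm v) \<le> m' * ?nX v" using a m' by (intro mult_left_mono) auto
      also have "\<dots> \<le> b * norm (L S v)" using lowL[OF S, of v] b(2)[of "L S v"] by linarith
      finally show ?thesis using b(1) by (simp add: field_simps)
    qed
    moreover have "norm (T - L S) < m' * a / b"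
      using T m a b(1) unfolding \<eta>_def by (simp add: field_simps) (smt (verit) mult_pos_pos)
    moreover have "0 < m' * a / b" using m' a b by simp
    ultimately show "surj (blinfun_apply T)" using surjL[OF S] by (intro surj_perturbation[of _ "L S" T])
    fix e
    have "?nY ((T - L S) e) \<le> b * norm ((T - L S) e)" by (rule b(2))
    also have "\<dots> \<le> b * (\<eta> * norm e)"
    proof (rule mult_left_mono)
      show "norm ((T - L S) e) \<le> \<eta> * norm e"
        using norm_blinfun[of "T - L S" e] mult_right_mono[OF T norm_ge_zero[of e]] by linarith
    qed (use b(1) in simp)
    also have "\<dots> = (m' - m) * (a * norm e)" using b(1) by (simp add: \<eta>_def)
    also have "\<dots> \<le> (m' - m) * ?nX e" using m' a(2) by (intro mult_left_mono) auto
    finally have "?nY ((T - L S) e) \<le> (m' - m) * ?nX e" .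
    moreover have "?nY (L S e) \<le> ?nY (T e) + ?nY ((T - L S) e)"
      using equivalent_normD(1)[OF nY, of "T e" "- ((T - L S) e)"]
        equivalent_normD(8)[OF nY, of "(T - L S) e"] by (simp add: blinfun.diff_left)
    ultimately show "m * ?nX e \<le> ?nY (T e)" using lowL[OF S, of e] by (simp add: algebra_simps)
  qed
  \<comment> \<open>This bounds the error between the transports at z and at u. It is continuous and
    vanishes at u, so it stays below \<eta> near u.\<close>
  define g where "g z = norm (A z - A u) * M * norm (B z) + norm (A u) * M * norm (B z - B u)" for z
  define O1 where "O1 = W \<inter> fst c' \<inter> f -` fst k'"
  have "open (f -` fst k')"
    using f chart_open(1)[OF YA cA(5)] continuous_on_open_vimage[OF open_UNIV, of f] by auto
  then have O1: "open O1" unfolding O1_def using W(1) chart_open(1)[OF XA cA(3)] by (intro open_Int)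
  have "continuous_on O1 A"
    unfolding A_def
    by (rule continuous_on_compose2[OF trans_deriv_C1(2)[OF YA cA(2,5)] continuous_on_subset[OF f]])
       (use fk W(3) in \<open>auto simp: O1_def\<close>)
  moreover have "continuous_on O1 B"
    unfolding B_def
    by (rule continuous_on_subset[OF trans_deriv_C1(2)[OF XA cA(3,1)]]) (use W(3) in \<open>auto simp: O1_def\<close>)
  ultimately have "continuous_on O1 g" unfolding g_def by (intro continuous_intros)
  then have "open (O1 \<inter> g -` {..<\<eta>})" by (rule continuous_open_preimage[OF _ O1 open_lessThan])
  moreover have "u \<in> O1 \<inter> g -` {..<\<eta>}" using W(2) cA \<eta> by (simp add: O1_def g_def)
  ultimately obtain R1 where R1: "R1 > 0" "fball X u R1 \<subseteq> O1 \<inter> g -` {..<\<eta>}"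
    using fball_subset_open[OF X] by blast
  have "linear L"
    unfolding L_def
    by (intro linearI blinfun_eqI) (simp_all add: blinfun.add_left blinfun.add_right blinfun.scaleR_left blinfun.scaleR_right)
  then have conv: "convex {T. \<exists>S\<in>?H. norm (T - L S) \<le> \<eta>}"
    by (rule convex_near_convex_image) (simp add: rep_hull_def)
  \<comment> \<open>Because the larger set is convex, only the operators of a single
    \<open>J' (snd c' z)\<close> have to be approximated.\<close>
  have "rep_hull X c' J' u R1 \<subseteq> {T. \<exists>S\<in>?H. norm (T - L S) \<le> \<eta>}"
    unfolding rep_hull_def[of X c' J']
  proof (rule hull_minimal[of _ _ convex, OF _ conv], rule subsetI)
    fix T assume "T \<in> (\<Union>z\<in>fball X u R1. J' (snd c' z))"
    then obtain z where z: "z \<in> fball X u R1" "T \<in> J' (snd c' z)" by blast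
    have zO: "z \<in> W" "z \<in> fst c'" "f z \<in> fst k'" "g z < \<eta>" using R1(2) z(1) by (auto simp: O1_def)
    then have zc: "z \<in> fst c" using W by blast
    have ch: "c \<in> charts_at (charts X) z" "c' \<in> charts_at (charts X) z"
      "k \<in> charts_at (charts Y) (f z)" "k' \<in> charts_at (charts Y) (f z)"
      using zO zc fk[OF zc] cA charts_at_iff[OF XA] charts_at_iff[OF YA] by auto
    have "chart_operator (charts X) (charts Y) c' k' z (f z) T \<in> Jf z"
      using r'(6)[OF zO(2)] z(2) by blast
    then obtain S where S: "S \<in> J (snd c z)" and
      "chart_operator (charts X) (charts Y) c k z (f z) S = chart_operator (charts X) (charts Y) c' k' z (f z) T"
      using r(6)[OF zc] by force
    then have T: "T = A z o\<^sub>L S o\<^sub>L B z"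
      unfolding A_def B_def by (intro chart_operator_eq_iff[OF XA YA ch])
    have "norm (T - L S) \<le> g z"
      unfolding T L_def g_def by (rule norm_blinfun_compose3_diff[OF M[OF zO(1) S]])
    moreover have "S \<in> ?H" unfolding rep_hull_def using S zO(1) W(4) by (intro hull_inc) blast
    ultimately show "T \<in> {T. \<exists>S\<in>?H. norm (T - L S) \<le> \<eta>}" using zO(4) by force
  qed
  then have "\<forall>T\<in>rep_hull X c' J' u R1. surj (blinfun_apply T) \<and>
      (\<forall>e. m * ?nX e \<le> ?nY (blinfun_apply T e))" using good by blast
  moreover have "fball X u R1 \<subseteq> fst c'" using R1(2) by (auto simp: O1_def)
  ultimately show ?thesis using R1(1) by blast
qed


section \<open>The local inverse\<close>

lemma open_rate_on_open_map:
  assumes rate: "open_rate_on N m g" and m: "0 < m" and P: "open P" "P \<subseteq> N"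
  shows "open (g ` P)"
proof (subst open_contains_ball, intro ballI)
  fix y assume "y \<in> g ` P"
  then obtain p where p: "p \<in> P" "y = g p" by blast
  obtain s where s: "s > 0" "ball p s \<subseteq> P" using P(1) p(1) open_contains_ball by blast
  then have "ball (g p) (m * s) \<subseteq> g ` ball p s"
    using rate P(2) unfolding open_rate_on_def by (meson subset_trans)
  then have "ball y (m * s) \<subseteq> g ` P" using s(2) p(2) by blast
  then show "\<exists>e>0. ball y e \<subseteq> g ` P" using m s(1) by (intro exI[of _ "m * s"]) simp
qed

text \<open>Injectivity of a chart shrinks its domain to a point, so points are open as well as
  closed, and connectedness leaves only one. This covers the case in which no nonzero vector is
  available to bound the radii in the linear rate.\<close>

lemma finsler_manifold_trivial_model:
  fixes Y :: "('y::t2_space, 'f::banach) finsler"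
  assumes Y: "finsler_manifold Y" and trivial: "\<And>w :: 'f. w = 0"
  shows "y = (y' :: 'y)"
proof -
  note A = finsler_C1[OF Y]
  obtain k where "k \<in> charts_at (charts Y) y" using ex_chart_at[OF A] by blast
  then have k: "k \<in> charts Y" "y \<in> fst k" using charts_at_iff[OF A] by auto
  have "z = y" if "z \<in> fst k" for z
    using inj_onD[OF chart_inj[OF A k(1)] _ that k(2)] trivial[of "snd k z"] trivial[of "snd k y"] by simp
  then have "fst k = {y}" using k(2) by blast
  then have "open {y}" using chart_open(1)[OF A k(1)] by simp
  moreover have "open (- {y})" by (rule open_Compl[OF closed_singleton])
  moreover have "connected (UNIV :: 'y set)" using Y unfolding finsler_manifold_def by blast
  ultimately have "{y} \<inter> UNIV = {} \<or> - {y} \<inter> UNIV = {}" by (intro connectedD) auto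
  then have "y' \<notin> - {y}" by simp
  then show ?thesis by simp
qed

theorem theorem21:
  fixes X :: "('x::t2_space, 'e::banach) finsler"
    and Y :: "('y::t2_space, 'f::banach) finsler"
    and f :: "'x \<Rightarrow> 'y"
    and Jf :: "'x \<Rightarrow> (('x, 'e) tangent \<Rightarrow> ('y, 'f) tangent) set"
    and x :: 'x and \<alpha> :: real
  assumes "finsler_manifold X" and "finsler_manifold Y" and "smooth_norm Y"
    and "locally_lipschitz_map X Y f"
    and "strong_pseudo_jacobian_mapping X Y f Jf"
    and "J_regular X Y f Jf x"
    and "0 < \<alpha>" and "ennreal \<alpha> < index_C X Y f Jf x"
  shows "\<exists>U. open U \<and> x \<in> U \<and>
    (homeomorphism U (f ` U) f (inv_into U f) \<and>
     (\<forall>u\<in>U. \<forall>u'\<in>U. fdist Y (f u) (f u') \<ge> \<alpha> * fdist X u u')) \<and>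
    (\<forall>u\<in>U. open_linear_rate_around U (fdist X) UNIV (fdist Y) f u \<and>
       index_C_star X Y f Jf u = index_C X Y f Jf u \<and> index_C X Y f Jf u \<ge> ennreal \<alpha>) \<and>
    (lipschitz_map (fdist Y) (fdist X) (f ` U) (inv_into U f) \<and>
     (\<forall>u\<in>U. lip_at (fdist Y) (fdist X) (f ` U) (inv_into U f) (f u) \<le> ennreal (1 / \<alpha>)))"
proof -

  \<comment> \<open>Operators and constants at the point x\<close>
  note X = assms(1) and Y = assms(2) and strong = assms(5) and \<alpha> = assms(7)
  note XA = finsler_C1[OF X] and YA = finsler_C1[OF Y]
  have f: "continuous_on UNIV f" by (rule locally_lipschitz_map_continuous[OF X Y assms(4)])
  obtain c k J where ch: "chosen_rep X Y f Jf x = (c, k, J)" by (metis prod_cases3)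
  note rep = chosen_rep_jacobian_rep[OF strong ch]
  note r = jacobian_rep_charts[OF rep]
  have cA: "c \<in> charts X" "x \<in> fst c" "k \<in> charts Y" "f x \<in> fst k"
    using r(1,2) charts_at_iff[OF XA] charts_at_iff[OF YA] by auto
  obtain R C0 where R: "0 < R" "fball X x R \<subseteq> fst c" and C0: "\<alpha> < C0"
    and hull: "\<And>S. S \<in> rep_hull X c J x R \<Longrightarrow> bij (blinfun_apply S)"
      "\<And>S e. S \<in> rep_hull X c J x R \<Longrightarrow> C0 * cnorm X c x e \<le> cnorm Y k (f x) (blinfun_apply S e)"
    using J_regular_data[OF X Y strong assms(6) \<alpha> assms(8) ch] by blast
  define p0 where "p0 = snd c x"
  define g where "g = snd k \<circ> f \<circ> chart_inv c"
  let ?nX = "cnorm X c x" and ?nY = "cnorm Y k (f x)"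
  note nX = cnorm_equivalent[OF X r(1)] and nY = cnorm_equivalent[OF Y r(2)]
  have p0: "p0 \<in> chart_image c" using cA by (simp add: p0_def)
  obtain r0 M where r0: "r0 > 0" "ball p0 r0 \<subseteq> chart_image c"
    and M: "\<And>p S. p \<in> ball p0 r0 \<Longrightarrow> S \<in> J p \<Longrightarrow> norm S \<le> M"
  proof -
    obtain r0 where r0: "r0 > 0" "ball p0 r0 \<subseteq> chart_image c" "bounded (\<Union>z\<in>ball p0 r0. J z)"
      using r(5) p0 unfolding locally_bounded_on_def by blast
    obtain M where "\<And>S. S \<in> (\<Union>z\<in>ball p0 r0. J z) \<Longrightarrow> norm S \<le> M"
      using r0(3) unfolding bounded_iff by blast
    then show ?thesis using that[of r0 M] r0(1,2) by blast
  qed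
  \<comment> \<open>Two factors \<kappa> are lost, one for the distance in X and one for that in Y,
    so \<kappa> is the square root of a number between 1 and \<open>C0 / \<alpha>\<close>.\<close>
  obtain \<kappa> where \<kappa>: "1 < \<kappa>" "\<alpha> < C0 / \<kappa>\<^sup>2"
  proof -
    have "1 < C0 / \<alpha>" using C0 \<alpha> by simp
    then obtain q where q: "1 < q" "q < C0 / \<alpha>" using dense by blast
    have "(sqrt q)\<^sup>2 = q" using q(1) by simp
    then show ?thesis using that[of "sqrt q"] q \<alpha> by (simp add: field_simps)
  qed

  \<comment> \<open>The neighbourhood U and the map in coordinates\<close>
  obtain \<rho>Y where \<rho>Y: "\<rho>Y > 0" "nball ?nY (snd k (f x)) (3 * \<rho>Y) \<subseteq> chart_image k"
    and compY: "\<And>p w. p \<in> nball ?nY (snd k (f x)) (3 * \<rho>Y) \<Longrightarrow> ?nY w \<le> \<kappa> * cnorm Y k (chart_inv k p) w"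
    and lowY: "\<And>v z. v \<in> fst k \<Longrightarrow> snd k v \<in> nball ?nY (snd k (f x)) \<rho>Y \<Longrightarrow> \<kappa> * fdist Y v z < 2 * \<rho>Y \<Longrightarrow>
        z \<in> fst k \<and> ?nY (snd k z - snd k v) \<le> \<kappa> * fdist Y v z"
    and lowY2: "\<And>v z. v \<in> fst k \<Longrightarrow> z \<in> fst k \<Longrightarrow> snd k v \<in> nball ?nY (snd k (f x)) \<rho>Y \<Longrightarrow>
        snd k z \<in> nball ?nY (snd k (f x)) \<rho>Y \<Longrightarrow> ?nY (snd k z - snd k v) \<le> \<kappa> * fdist Y v z"
    using local_distance[OF Y r(2) \<kappa>(1) open_UNIV UNIV_I] by metis
  define V where "V = chart_inv k ` nball ?nY (snd k (f x)) \<rho>Y"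
  have subY: "nball ?nY (snd k (f x)) \<rho>Y \<subseteq> nball ?nY (snd k (f x)) (3 * \<rho>Y)"
    using \<rho>Y(1) by (intro nball_mono) simp
  have Vopen: "open V"
    unfolding V_def by (rule chart_inv_open[OF YA cA(3) nball_open[OF nY]]) (use subY \<rho>Y(2) in blast)
  have VD: "y \<in> fst k" "snd k y \<in> nball ?nY (snd k (f x)) \<rho>Y" if y: "y \<in> V" for y
  proof -
    obtain q where q: "q \<in> nball ?nY (snd k (f x)) \<rho>Y" "y = chart_inv k q" using y V_def by blast
    then have "q \<in> chart_image k" using subY \<rho>Y(2) by blast
    then show "y \<in> fst k" "snd k y \<in> nball ?nY (snd k (f x)) \<rho>Y"
      using q chart_inv_mem[OF YA, of q k] chart_inv_right[OF YA, of q k] by auto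
  qed
  have fxV: "f x \<in> V"
    using nball_center[OF nY \<rho>Y(1), of "snd k (f x)"] chart_inv_left[OF YA cA(3,4)]
    unfolding V_def by (metis imageI)
  obtain WR where WR: "open WR" "x \<in> WR" "WR \<subseteq> fball X x R" using open_subset_fball[OF X R(1)] by blast
  \<comment> \<open>On W the values of f lie in V, the operators belong to the hull of radius R, and
    the local pseudo-Jacobian is bounded by M.\<close>
  define W where "W = f -` V \<inter> WR \<inter> chart_inv c ` ball p0 r0"
  have "open (f -` V)" using f Vopen continuous_on_open_vimage[OF open_UNIV, of f] by auto
  then have Wopen: "open W"
    unfolding W_def using WR(1) chart_inv_open[OF XA cA(1) open_ball r0(2)] by (intro open_Int)
  have "x \<in> chart_inv c ` ball p0 r0"
    using chart_inv_left[OF XA cA(1,2)] r0(1) unfolding p0_def by (metis centre_in_ball imageI)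
  then have xW: "x \<in> W" unfolding W_def using fxV WR(2) by blast
  obtain \<rho> where \<rho>: "\<rho> > 0" "nball ?nX p0 (3 * \<rho>) \<subseteq> chart_image c"
    "chart_inv c ` nball ?nX p0 (3 * \<rho>) \<subseteq> W"
    and compX: "\<And>p e. p \<in> nball ?nX p0 (3 * \<rho>) \<Longrightarrow> cnorm X c (chart_inv c p) e \<le> \<kappa> * ?nX e"
    and upX: "\<And>p q. p \<in> nball ?nX p0 (3 * \<rho>) \<Longrightarrow> q \<in> nball ?nX p0 (3 * \<rho>) \<Longrightarrow>
        fdist X (chart_inv c p) (chart_inv c q) \<le> \<kappa> * ?nX (q - p)"
    using local_distance[OF X r(1) \<kappa>(1) Wopen xW, folded p0_def] by metis
  define N where "N = nball ?nX p0 \<rho>"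
  have N3: "N \<subseteq> nball ?nX p0 (3 * \<rho>)" unfolding N_def using \<rho>(1) by (intro nball_mono) simp
  have Nimg: "N \<subseteq> chart_image c" using N3 \<rho>(2) by blast
  have Nopen: "open N" and Nconv: "convex N" and p0N: "p0 \<in> N"
    unfolding N_def using nball_open[OF nX] nball_convex[OF nX] nball_center[OF nX \<rho>(1)] by auto
  define U where "U = chart_inv c ` N"
  have Uopen: "open U" unfolding U_def by (rule chart_inv_open[OF XA cA(1) Nopen Nimg])
  have UW: "U \<subseteq> W" using N3 \<rho>(3) unfolding U_def by blast
  have UN: "p \<in> N \<Longrightarrow> chart_inv c p \<in> U \<and> snd c (chart_inv c p) = p" for p
    using Nimg chart_inv_right[OF XA, of p c] unfolding U_def by blast
  have UD: "u \<in> fst c" "snd c u \<in> N" "chart_inv c (snd c u) = u" if u: "u \<in> U" for u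
  proof -
    obtain p where p: "p \<in> N" "u = chart_inv c p" using u U_def by blast
    then have "p \<in> chart_image c" using Nimg by blast
    then show "u \<in> fst c" "snd c u \<in> N" "chart_inv c (snd c u) = u"
      using p chart_inv_mem[OF XA, of p c] chart_inv_right[OF XA, of p c] by auto
  qed
  have UV: "f u \<in> V" if "u \<in> U" for u using UW that unfolding W_def by blast
  have xU: "x \<in> U" using UN[OF p0N] chart_inv_left[OF XA cA(1,2)] by (simp add: p0_def)
  have UR: "U \<subseteq> fball X x R" using UW WR(3) unfolding W_def by blast
  have Nball: "N \<subseteq> ball p0 r0"
  proof
    fix p assume p: "p \<in> N"
    then have "chart_inv c p \<in> chart_inv c ` ball p0 r0" using UN[OF p] UW unfolding W_def by blast
    then obtain q where q: "q \<in> ball p0 r0" "chart_inv c p = chart_inv c q" by blast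
    have "snd c (chart_inv c p) = snd c (chart_inv c q)" using q(2) by simp
    then have "p = q" using UN[OF p] chart_inv_right[OF XA, of q c] q(1) r0(2) by auto
    then show "p \<in> ball p0 r0" using q(1) by simp
  qed
  have gU: "snd k (f u) = g (snd c u)" if "u \<in> U" for u using UD(3)[OF that] by (simp add: g_def)
  have contg: "continuous_on N g"
    unfolding g_def
  proof (intro continuous_on_compose)
    show "continuous_on N (chart_inv c)" by (rule continuous_on_subset[OF chart_cont(2)[OF XA cA(1)] Nimg])
    show "continuous_on (chart_inv c ` N) f" by (rule continuous_on_subset[OF f]) simp
    show "continuous_on (f ` chart_inv c ` N) (snd k)"
      by (rule continuous_on_subset[OF chart_cont(1)[OF YA cA(3)]]) (use UV VD in \<open>auto simp: U_def\<close>)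
  qed
  have JN: "pseudo_jacobian_mapping_on N g J"
    using r(4) Nimg unfolding pseudo_jacobian_mapping_on_def g_def by blast
  let ?H = "convex hull (\<Union>p\<in>N. J p)"
  have HN: "?H \<subseteq> rep_hull X c J x R"
    unfolding rep_hull_def
  proof (rule hull_mono, rule UN_least)
    fix p assume "p \<in> N"
    then have "chart_inv c p \<in> fball X x R" "snd c (chart_inv c p) = p" using UN UR by auto
    then show "J p \<subseteq> (\<Union>u\<in>fball X x R. J (snd c u))" by (metis UN_upper)
  qed
  have C0pos: "0 < C0" using C0 \<alpha> by simp
  have lowH: "C0 * ?nX e \<le> ?nY (blinfun_apply T e)" if "T \<in> ?H" for T e
    using hull(2) HN that by blast
  have MN: "norm T \<le> M" if "p \<in> N" "T \<in> J p" for p T using M Nball that by blast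

  \<comment> \<open>Expansion, injectivity and openness of f on U\<close>
  note pj = nX nY Nconv JN contg C0pos lowH MN
  have expand: "C0 * ?nX (p' - p) \<le> ?nY (g p' - g p)" if "p \<in> N" "p' \<in> N" for p p'
    by (rule pseudo_jacobian_expanding[OF pj that])
  \<comment> \<open>The starting point of the continuation: a pseudo-Jacobian is nonempty, and every
    operator of the hull is an isomorphism.\<close>
  obtain A0 where A0: "A0 \<in> ?H" "surj (blinfun_apply A0)"
  proof -
    obtain A0 where "A0 \<in> J p0"
      using JN p0N unfolding pseudo_jacobian_mapping_on_def pseudo_jacobian_at_def by blast
    then have "A0 \<in> ?H" using p0N by (intro hull_inc) blast
    then show ?thesis using that hull(1) HN unfolding bij_def by blast
  qed
  have "\<exists>m>0. open_rate_on N m g" by (rule pseudo_jacobian_open_rate[OF pj A0])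
  then obtain m0 where m0: "m0 > 0" "open_rate_on N m0 g" by blast
  have dX: "fdist X u u' \<le> \<kappa> * ?nX (snd c u' - snd c u)" if "u \<in> U" "u' \<in> U" for u u'
    using upX[of "snd c u" "snd c u'"] UD[OF that(1)] UD[OF that(2)] N3 by auto
  have est: "\<alpha> * fdist X u u' \<le> fdist Y (f u) (f u')" if u: "u \<in> U" "u' \<in> U" for u u'
  proof -
    have "C0 * fdist X u u' \<le> \<kappa> * (C0 * ?nX (snd c u' - snd c u))"
      using mult_left_mono[OF dX[OF u], of C0] C0pos by (simp add: mult_ac)
    also have "\<dots> \<le> \<kappa> * ?nY (g (snd c u') - g (snd c u))"
      using expand[OF UD(2)[OF u(1)] UD(2)[OF u(2)]] \<kappa>(1) by (intro mult_left_mono) auto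
    also have "\<dots> \<le> \<kappa> * (\<kappa> * fdist Y (f u) (f u'))"
      using lowY2[OF VD(1)[OF UV[OF u(1)]] VD(1)[OF UV[OF u(2)]] VD(2)[OF UV[OF u(1)]] VD(2)[OF UV[OF u(2)]]]
        \<kappa>(1) unfolding gU[OF u(1)] gU[OF u(2)] by (intro mult_left_mono) auto
    finally have "C0 / \<kappa>\<^sup>2 * fdist X u u' \<le> fdist Y (f u) (f u')"
      using \<kappa>(1) by (simp add: field_simps power2_eq_square)
    moreover have "\<alpha> * fdist X u u' \<le> C0 / \<kappa>\<^sup>2 * fdist X u u'"
      using \<kappa>(2) fdist_nonneg[OF X] by (intro mult_right_mono) auto
    ultimately show ?thesis by linarith
  qed
  have inj: "inj_on f U"
  proof (rule inj_onI)
    fix u u' assume u: "u \<in> U" "u' \<in> U" "f u = f u'"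
    have "C0 * ?nX (snd c u' - snd c u) \<le> 0"
      using expand[OF UD(2)[OF u(1)] UD(2)[OF u(2)]] gU[OF u(1)] gU[OF u(2)] u(3) equivalent_normD(4)[OF nY]
      by simp
    then have "?nX (snd c u' - snd c u) = 0"
      using C0pos equivalent_normD(3)[OF nX, of "snd c u' - snd c u"] by (simp add: mult_le_0_iff)
    then show "u = u'" using equivalent_normD(6)[OF nX] UD(3)[OF u(1)] UD(3)[OF u(2)] by simp
  qed
  have f_open: "open (f ` P)" if P: "open P" "P \<subseteq> U" for P
  proof -
    have Pc: "P \<subseteq> fst c" using P(2) UD(1) by blast
    have "open (snd c ` P)" by (rule chart_image_open[OF XA cA(1) P(1) Pc])
    moreover have "snd c ` P \<subseteq> N" using P(2) UD(2) by blast
    ultimately have "open (g ` snd c ` P)" by (rule open_rate_on_open_map[OF m0(2,1)])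
    moreover have gf: "g (snd c u) \<in> chart_image k \<and> chart_inv k (g (snd c u)) = f u" if "u \<in> P" for u
    proof -
      have "u \<in> U" using that P(2) by blast
      then show ?thesis using gU[of u] VD(1)[OF UV] chart_inv_left[OF YA cA(3)] by (metis imageI)
    qed
    ultimately have "open (chart_inv k ` g ` snd c ` P)"
      by (intro chart_inv_open[OF YA cA(3)]) auto
    moreover have "chart_inv k ` g ` snd c ` P = f ` P" using gf by (force simp: image_image)
    ultimately show ?thesis by simp
  qed
  have homeo: "homeomorphism U (f ` U) f (inv_into U f)"
    unfolding homeomorphism_def
  proof (intro conjI ballI)
    show "continuous_on U f" by (rule continuous_on_subset[OF f]) simp
    show "continuous_on (f ` U) (inv_into U f)"
    proof (rule continuous_on_inverse_open_map)
      show "continuous_on U f" by (rule continuous_on_subset[OF f]) simp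
      show "openin (top_of_set (f ` U)) (f ` P)" if "openin (top_of_set U) P" for P
        using that Uopen f_open by (simp add: openin_open_eq f_open image_mono)
    qed (use inj in auto)
  qed (use inj in \<open>auto simp: f_inv_into_f inv_into_into image_iff\<close>)

  \<comment> \<open>The indices at the points of U\<close>
  have index: "index_C_star X Y f Jf u = index_C X Y f Jf u \<and> ennreal \<alpha> \<le> index_C X Y f Jf u"
    if u: "u \<in> U" for u
  proof -
    obtain c' k' J' where ch': "chosen_rep X Y f Jf u = (c', k', J')" by (metis prod_cases3)
    note rep' = chosen_rep_jacobian_rep[OF strong ch']
    have "\<exists>R1>0. fball X u R1 \<subseteq> fst c' \<and> (\<forall>T\<in>rep_hull X c' J' u R1. surj (blinfun_apply T) \<and>
        (\<forall>e. \<alpha> * cnorm X c' u e \<le> cnorm Y k' (f u) (blinfun_apply T e)))"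
    proof (rule rep_hull_nearby[OF X Y f rep rep' Uopen u _ UR])
      show "U \<subseteq> fst c" using UD(1) by blast
      show "norm S \<le> M" if "z \<in> U" "S \<in> J (snd c z)" for z S using MN UD(2) that by blast
      show "surj (blinfun_apply S)" if "S \<in> rep_hull X c J x R" for S
        using hull(1)[OF that] unfolding bij_def by blast
      show "C0 * ?nX e \<le> ?nY (blinfun_apply S e)" if "S \<in> rep_hull X c J x R" for S e
        by (rule hull(2)[OF that])
      show "cnorm X c u e \<le> \<kappa> * ?nX e" for e using compX[of "snd c u" e] UD[OF u] N3 by auto
      show "?nY w \<le> \<kappa> * cnorm Y k (f u) w" for w
        using compY[of "snd k (f u)" w] VD[OF UV[OF u]] subY chart_inv_left[OF YA cA(3)] by auto
    qed (use \<kappa> \<alpha> in auto)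
    then obtain R1 where "0 < R1" "fball X u R1 \<subseteq> fst c'"
      "\<And>T. T \<in> rep_hull X c' J' u R1 \<Longrightarrow> surj (blinfun_apply T)"
      "\<And>T e. T \<in> rep_hull X c' J' u R1 \<Longrightarrow> \<alpha> * cnorm X c' u e \<le> cnorm Y k' (f u) (blinfun_apply T e)"
      by blast
    note eq = index_C_eq_index_C_star[OF X Y strong ch' \<alpha> this]
    show ?thesis using eq by blast
  qed

  \<comment> \<open>Openness with linear rate\<close>
  have rate: "open_linear_rate_around U (fdist X) UNIV (fdist Y) f u" if u: "u \<in> U" for u
  proof (cases "\<forall>e :: 'e. e = 0")
    case True
    have "w = 0" for w :: 'f
    proof -
      obtain e where "w = A0 e" using A0(2) by blast
      then show ?thesis using True[rule_format, of e] by simp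
    qed
    then have single: "y = y'" for y y' :: 'y by (rule finsler_manifold_trivial_model[OF Y])
    have "{y \<in> UNIV. fdist Y (f v) y < 1 * r} \<subseteq> f ` {z \<in> U. fdist X v z < r}" if v: "v \<in> U" and r: "0 < r" for v r
    proof -
      have "fdist X v v \<le> 0" using dX[OF v v] equivalent_normD(4)[OF nX] by simp
      then have "v \<in> {z \<in> U. fdist X v z < r}" using v r by simp
      then show ?thesis using single by blast
    qed
    then show ?thesis
      unfolding open_linear_rate_around_def using u
      by (intro exI[of _ U] exI[of _ 1]) auto
  next
    case False
    \<comment> \<open>The radius is limited only by the inclusion of the relative ball in the
      neighbourhood, so a point of U outside that neighbourhood is needed to bound it. A nonzero
      vector provides such a point; in the other case Y is a single point.\<close>
    then obtain e0 :: 'e where e0: "e0 \<noteq> 0" by blast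
    obtain bX where bX: "bX > 0" "\<And>v. ?nX v \<le> bX * norm v" using nX unfolding equivalent_norm_def by blast
    obtain aY where aY: "aY > 0" "\<And>v. aY * norm v \<le> ?nY v" using nY unfolding equivalent_norm_def by blast
    define K where "K = \<kappa> * bX"
    have K: "K > 0" using \<kappa> bX by (simp add: K_def)
    have dK: "fdist X v z \<le> K * norm (snd c z - snd c v)" if "v \<in> U" "z \<in> U" for v z
    proof -
      have "\<kappa> * ?nX (snd c z - snd c v) \<le> \<kappa> * (bX * norm (snd c z - snd c v))"
        using bX(2) \<kappa>(1) by (intro mult_left_mono) auto
      then show ?thesis using dX[OF that] by (simp add: K_def)
    qed
    define p where "p = snd c u"
    obtain s' where s': "s' > 0" "ball p s' \<subseteq> N"
      using Nopen UD(2)[OF u] open_contains_ball unfolding p_def by blast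
    \<comment> \<open>A third of the radius: for q within s of p, a ball about q of radius at most
      \<open>2 * s\<close> stays in \<open>ball p (3 * s)\<close>.\<close>
    define s where "s = s' / 3"
    have s: "s > 0" "ball p (3 * s) \<subseteq> N" using s' by (auto simp: s_def)
    have sN: "ball p s \<subseteq> N" using s by (auto intro: subset_trans[OF subset_ball])
    define Wu where "Wu = chart_inv c ` ball p s"
    have WuU: "Wu \<subseteq> U" unfolding Wu_def U_def using sN by blast
    have Wu_open: "open Wu" unfolding Wu_def using sN Nimg by (intro chart_inv_open[OF XA cA(1)]) auto
    have uWu: "u \<in> Wu" unfolding Wu_def p_def using UD(3)[OF u] s(1) by (metis centre_in_ball imageI)
    have Wu_ball: "snd c v \<in> ball p s" if v: "v \<in> Wu" for v
      using v UN sN unfolding Wu_def by auto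
    \<comment> \<open>The coordinates of a point of U just outside Wu, at distance s from p. A
      Finsler ball of radius t about v that lies in Wu misses this point, which forces
      \<open>t \<le> 2 * K * s\<close>.\<close>
    define q1 where "q1 = p + (s / norm e0) *\<^sub>R e0"
    have q1: "norm (q1 - p) = s" using e0 s(1) by (simp add: q1_def)
    have q1N: "q1 \<in> N" using s q1 by (auto simp: dist_norm norm_minus_commute)
    define z1 where "z1 = chart_inv c q1"
    have z1: "z1 \<in> U" "snd c z1 = q1" using UN[OF q1N] by (auto simp: z1_def)
    have z1W: "z1 \<notin> Wu" using Wu_ball[of z1] z1(2) q1 by (auto simp: dist_norm norm_minus_commute)
    \<comment> \<open>The first bound gives \<open>\<kappa> * a * t \<le> \<rho>Y\<close>, so that
      targets within \<open>a * t\<close> lie in the chart of Y. The second puts their coordinates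
      within \<open>m0 * (t / K)\<close> of those of \<open>f v\<close>, so that a preimage exists
      within \<open>t / K\<close> in coordinates and hence within t in the Finsler distance.\<close>
    define a where "a = min (\<rho>Y / (2 * \<kappa> * K * s)) (m0 * aY / (\<kappa> * K))"
    have a: "a > 0" "\<kappa> * a * (2 * K * s) \<le> \<rho>Y" "\<kappa> * a \<le> m0 * aY / K"
    proof -
      show "a > 0" using \<rho>Y(1) \<kappa>(1) K s(1) m0(1) aY(1) by (simp add: a_def)
      have "a \<le> \<rho>Y / (2 * \<kappa> * K * s)" "a \<le> m0 * aY / (\<kappa> * K)" by (auto simp: a_def)
      then show "\<kappa> * a * (2 * K * s) \<le> \<rho>Y" "\<kappa> * a \<le> m0 * aY / K"
        using \<kappa>(1) K s(1) by (auto simp: field_simps)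
    qed
    have "{y \<in> UNIV. fdist Y (f v) y < a * t} \<subseteq> f ` {z \<in> U. fdist X v z < t}"
      if v: "v \<in> Wu" and t: "0 < t" and sub: "{z \<in> U. fdist X v z < t} \<subseteq> Wu" for v t
    proof
      fix y assume "y \<in> {y \<in> UNIV. fdist Y (f v) y < a * t}"
      then have y: "fdist Y (f v) y < a * t" by simp
      have vU: "v \<in> U" using v WuU by blast
      define q where "q = snd c v"
      have q: "dist p q < s" using Wu_ball[OF v] by (simp add: q_def)
      have "t \<le> fdist X v z1" using sub z1(1) z1W by force
      also have "\<dots> \<le> K * norm (q1 - q)" using dK[OF vU z1(1)] by (simp add: z1(2) q_def)
      also have "norm (q1 - q) \<le> norm (q1 - p) + norm (p - q)" using norm_triangle_ineq[of "q1 - p" "p - q"] by simp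
      also have "\<dots> \<le> 2 * s" using q1 q by (simp add: dist_norm)
      finally have t2: "t \<le> 2 * K * s" using K by (simp add: mult_ac)
      have "\<kappa> * fdist Y (f v) y < \<kappa> * (a * t)" using y \<kappa>(1) by simp
      also have "\<dots> \<le> \<kappa> * (a * (2 * K * s))" using t2 a(1) \<kappa>(1) by (intro mult_left_mono) auto
      also have "\<dots> \<le> \<rho>Y" using a(2) by (simp add: mult_ac)
      finally have "\<kappa> * fdist Y (f v) y < 2 * \<rho>Y" using \<rho>Y(1) by simp
      then have yk: "y \<in> fst k" "?nY (snd k y - snd k (f v)) \<le> \<kappa> * fdist Y (f v) y"
        using lowY[OF VD(1)[OF UV[OF vU]] VD(2)[OF UV[OF vU]]] by auto
      have "aY * norm (snd k y - g q) \<le> \<kappa> * fdist Y (f v) y"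
        using aY(2)[of "snd k y - g q"] yk(2) gU[OF vU] by (simp add: q_def)
      also have "\<dots> < (\<kappa> * a) * t" using y \<kappa>(1) by simp
      also have "\<dots> \<le> (m0 * aY / K) * t" using a(3) t by (intro mult_right_mono) auto
      finally have "norm (snd k y - g q) < m0 * (t / K)" using aY(1) K by (simp add: field_simps)
      then have yball: "snd k y \<in> ball (g q) (m0 * (t / K))" by (simp add: dist_norm norm_minus_commute)
      have tK: "t / K \<le> 2 * s" "0 < t / K" using t2 t K by (auto simp: field_simps)
      have "ball q (t / K) \<subseteq> ball p (3 * s)"
      proof
        fix w assume "w \<in> ball q (t / K)"
        then have "dist q w < 2 * s" using tK by simp
        then show "w \<in> ball p (3 * s)" using q dist_triangle[of p w q] by simp
      qed
      then have bN: "ball q (t / K) \<subseteq> N" using s(2) by blast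
      then have "ball (g q) (m0 * (t / K)) \<subseteq> g ` ball q (t / K)"
        using m0(2) tK(2) unfolding open_rate_on_def by blast
      then obtain q' where q': "q' \<in> ball q (t / K)" "snd k y = g q'" using yball by blast
      define z where "z = chart_inv c q'"
      have z: "z \<in> U" "snd c z = q'" using UN[of q'] bN q'(1) by (auto simp: z_def)
      have "fdist X v z \<le> K * norm (q' - q)" using dK[OF vU z(1)] by (simp add: z(2) q_def)
      also have "\<dots> < t" using q'(1) K by (simp add: dist_norm norm_minus_commute field_simps)
      finally have "fdist X v z < t" .
      moreover have "snd k (f z) = snd k y" using gU[OF z(1)] z(2) q'(2) by simp
      then have "f z = y" using chart_inj[OF YA cA(3)] VD(1)[OF UV[OF z(1)]] yk(1) by (metis inj_onD)
      ultimately show "y \<in> f ` {z \<in> U. fdist X v z < t}" using z(1) by blast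
    qed
    moreover have "openin (top_of_set U) Wu" using Wu_open WuU by (simp add: openin_open_eq Uopen)
    ultimately show ?thesis
      unfolding open_linear_rate_around_def using uWu a(1) by (intro exI[of _ Wu] exI[of _ a]) simp
  qed

  \<comment> \<open>The Lipschitz constant of the inverse\<close>
  have inv: "inv_into U f (f u) = u" if "u \<in> U" for u using inj that by simp
  have quot: "fdist X u u' \<le> 1 / \<alpha> * fdist Y (f u) (f u')" if "u \<in> U" "u' \<in> U" for u u'
    using est[OF that] \<alpha> by (simp add: field_simps)
  have lip: "lipschitz_map (fdist Y) (fdist X) (f ` U) (inv_into U f)"
    unfolding lipschitz_map_def using quot inv \<alpha> by (intro exI[of _ "1 / \<alpha>"]) auto
  have lip_at: "lip_at (fdist Y) (fdist X) (f ` U) (inv_into U f) y \<le> ennreal (1 / \<alpha>)" for y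
    unfolding lip_at_def
  \<comment> \<open>The radius 1 is arbitrary, since the bound holds between all points of U. A
    quotient with denominator 0 would be 0 by convention.\<close>
  proof (rule INF_lower2[of 1], simp, rule SUP_least, clarify)
    fix u u' assume u: "u \<in> U" "u' \<in> U"
    have "fdist X u u' / fdist Y (f u) (f u') \<le> 1 / \<alpha>"
      using quot[OF u] fdist_nonneg[OF Y, of "f u" "f u'"] \<alpha>
      by (cases "fdist Y (f u) (f u') = 0") (simp_all add: field_simps)
    then show "ennreal (fdist X (inv_into U f (f u)) (inv_into U f (f u')) / fdist Y (f u) (f u')) \<le> ennreal (1 / \<alpha>)"
      using inv u by (simp add: ennreal_leI)
  qed
  show ?thesis
    using Uopen xU homeo est rate index lip lip_at by (intro exI[of _ U]) blast
qed

end
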